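(* Let $\mathcal D_{\mathrm{loc}}\subseteq\mathbb R^{n\times n}\times\mathbb R^{n\times n}$ and let $\mathcal D:=\{(F,P)\in X_{p,q}(\Omega):(F,P)\in\mathcal D_{\mathrm{loc}}\text{ a.e.}\}$. Then the set $\mathcal D$ is $(p,q)$-div-curl-closed if and only if $\mathcal D_{\mathrm{loc}}$ is locally $(p,q)$-div-curl-closed.
   Context: $\Omega\subseteq\mathbb R^n$ is a bounded, connected, open, nonempty Lipschitz set, and $p,q\in(1,\infty)$ with $1/p+1/q=1$. For open $\omega\subseteq\mathbb R^n$, $X_{p,q}(\omega):=L^p(\omega;\mathbb R^{n\times n})\times L^q(\omega;\mathbb R^{n\times n})$ with norm $\|F\|_{L^p}+\|P\|_{L^q}$. Distributional differential operators act rowwise: $(\mathrm{curl}\,F)_{ijk}=\partial_kF_{ij}-\partial_jF_{ik}$, $(\mathrm{div}\,P)_i=\sum_j\partial_jP_{ij}$. $W^{-1,p}(\omega)$ is the dual of $W^{1,q}_0(\omega)$ and $W^{-1,q}(\omega)$ is the dual of $W^{1,p}_0(\omega)$. A sequence $(F_k,P_k)\in X_{p,q}(\omega)$ is div-curl-convergent to $(F,P)\in X_{p,q}(\omega)$ if it converges weakly in $X_{p,q}(\omega)$ and $\mathrm{curl}\,F_k\to\mathrm{curl}\,F$ strongly in $W^{-1,p}(\omega;\mathbb R^{n\times n\times n})$ and $\mathrm{div}\,P_k\to\mathrm{div}\,P$ strongly in $W^{-1,q}(\omega;\mathbb R^n)$. A set $\mathcal D\subseteq X_{p,q}(\Omega)$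 is $(p,q)$-div-curl-closed if the limits of all div-curl-convergent sequences $(F_k,P_k)\in\mathcal D$ are in $\mathcal D$. A set $\mathcal D_{\mathrm{loc}}\subseteq\mathbb R^{n\times n}\times\mathbb R^{n\times n}$ is locally $(p,q)$-div-curl-closed if, for all bounded nonempty open sets $\omega\subseteq\mathbb R^n$ and all $(F_*,P_* )\in\mathbb R^{n\times n}\times\mathbb R^{n\times n}$, the following holds: if there is a sequence $(F_k,P_k)\in X_{p,q}(\omega)$ div-curl-converging to the constant function $(F_*,P_* )$ and such that $(F_k,P_k)\in\mathcal D_{\mathrm{loc}}$ almost everywhere, then $(F_*,P_* )\in\mathcal D_{\mathrm{loc}}$. *)

theory Defs
  imports "HOL-Analysis.Analysis"
begin

text \<open>
  Function spaces over an open set \<open>\<omega>\<close> are sets of total functions on \<open>real ^ 'n\<close>, carrying a seminorm;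
  almost-everywhere equal functions are not identified, and values outside \<open>\<omega>\<close> are irrelevant.
  The matrix entry $F_{ij}$ is \<open>F $ i $ j\<close> (row \<open>i\<close>, column \<open>j\<close>), and the norm of a matrix
  is the Frobenius norm.
\<close>

subsection \<open>Duals of seminormed function spaces\<close>

definition bounded_functional ::
    "('a \<Rightarrow> 'b::real_vector) set \<Rightarrow> (('a \<Rightarrow> 'b) \<Rightarrow> real) \<Rightarrow> (('a \<Rightarrow> 'b) \<Rightarrow> real) \<Rightarrow> bool" where
  "bounded_functional V N L \<longleftrightarrow>
     (\<forall>f\<in>V. \<forall>g\<in>V. L (\<lambda>x. f x + g x) = L f + L g) \<and>
     (\<forall>f\<in>V. \<forall>c. L (\<lambda>x. c *\<^sub>R f x) = c * L f) \<and>
     (\<exists>C. \<forall>f\<in>V. \<bar>L f\<bar> \<le> C * N f)"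

definition dual_norm ::
    "('a \<Rightarrow> 'b) set \<Rightarrow> (('a \<Rightarrow> 'b) \<Rightarrow> real) \<Rightarrow> (('a \<Rightarrow> 'b) \<Rightarrow> real) \<Rightarrow> real" where
  "dual_norm V N L = (SUP f \<in> {f \<in> V. N f \<le> 1}. \<bar>L f\<bar>)"

definition weakly_convergent_to ::
    "('a \<Rightarrow> 'b::real_vector) set \<Rightarrow> (('a \<Rightarrow> 'b) \<Rightarrow> real) \<Rightarrow> (nat \<Rightarrow> 'a \<Rightarrow> 'b) \<Rightarrow> ('a \<Rightarrow> 'b) \<Rightarrow> bool" where
  "weakly_convergent_to V N u u0 \<longleftrightarrow>
     (\<forall>k. u k \<in> V) \<and> u0 \<in> V \<and>
     (\<forall>L. bounded_functional V N L \<longrightarrow> (\<lambda>k. L (u k)) \<longlonglongrightarrow> L u0)"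

subsection \<open>Lebesgue spaces\<close>

definition Lp_space :: "real \<Rightarrow> (real ^ 'n) set \<Rightarrow> (real ^ 'n \<Rightarrow> 'b::euclidean_space) set" where
  "Lp_space p \<omega> = {f. f \<in> borel_measurable (lebesgue_on \<omega>) \<and>
                      integrable (lebesgue_on \<omega>) (\<lambda>x. norm (f x) powr p)}"

definition Lp_norm :: "real \<Rightarrow> (real ^ 'n) set \<Rightarrow> (real ^ 'n \<Rightarrow> 'b::euclidean_space) \<Rightarrow> real" where
  "Lp_norm p \<omega> f = (integral\<^sup>L (lebesgue_on \<omega>) (\<lambda>x. norm (f x) powr p)) powr (1 / p)"

text \<open>A pair \<open>(F, P)\<close> of matrix fields is one function with values in pairs of matrices.\<close>

type_synonym 'n fields = "real ^ 'n \<Rightarrow> (real ^ 'n ^ 'n) \<times> (real ^ 'n ^ 'n)"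

definition X_space :: "real \<Rightarrow> real \<Rightarrow> (real ^ 'n) set \<Rightarrow> 'n fields set" where
  "X_space p q \<omega> = {u. (\<lambda>x. fst (u x)) \<in> Lp_space p \<omega> \<and> (\<lambda>x. snd (u x)) \<in> Lp_space q \<omega>}"

definition X_norm :: "real \<Rightarrow> real \<Rightarrow> (real ^ 'n) set \<Rightarrow> 'n fields \<Rightarrow> real" where
  "X_norm p q \<omega> u = Lp_norm p \<omega> (\<lambda>x. fst (u x)) + Lp_norm q \<omega> (\<lambda>x. snd (u x))"

subsection \<open>Test functions and distributional derivatives\<close>

definition partial :: "'n \<Rightarrow> (real ^ 'n \<Rightarrow> real) \<Rightarrow> real ^ 'n \<Rightarrow> real" where
  "partial k f x = frechet_derivative f (at x) (axis k 1)"

definition grad :: "(real ^ 'n \<Rightarrow> real) \<Rightarrow> real ^ 'n \<Rightarrow> real ^ 'n" where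
  "grad f x = (\<chi> k. partial k f x)"

primrec times_differentiable :: "nat \<Rightarrow> (real ^ 'n \<Rightarrow> real) \<Rightarrow> bool" where
  "times_differentiable 0 f \<longleftrightarrow> continuous_on UNIV f"
| "times_differentiable (Suc m) f \<longleftrightarrow>
     (\<forall>x. f differentiable (at x)) \<and> (\<forall>k. times_differentiable m (partial k f))"

definition smooth :: "(real ^ 'n \<Rightarrow> real) \<Rightarrow> bool" where
  "smooth f \<longleftrightarrow> (\<forall>m. times_differentiable m f)"

definition test_functions :: "(real ^ 'n) set \<Rightarrow> (real ^ 'n \<Rightarrow> real) set" where
  "test_functions \<omega> = {\<phi>. smooth \<phi> \<and> compact (closure {x. \<phi> x \<noteq> 0}) \<and> closure {x. \<phi> x \<noteq> 0} \<subseteq> \<omega>}"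

type_synonym 'n distribution = "(real ^ 'n \<Rightarrow> real) \<Rightarrow> real"

definition dist_partial :: "(real ^ 'n) set \<Rightarrow> 'n \<Rightarrow> (real ^ 'n \<Rightarrow> real) \<Rightarrow> 'n distribution" where
  "dist_partial \<omega> k f \<phi> = - integral\<^sup>L (lebesgue_on \<omega>) (\<lambda>x. f x * partial k \<phi> x)"

definition dist_curl ::
    "(real ^ 'n) set \<Rightarrow> (real ^ 'n \<Rightarrow> real ^ 'n ^ 'n) \<Rightarrow> 'n \<Rightarrow> 'n \<Rightarrow> 'n \<Rightarrow> 'n distribution" where
  "dist_curl \<omega> F i j k \<phi> =
     dist_partial \<omega> k (\<lambda>x. F x $ i $ j) \<phi> - dist_partial \<omega> j (\<lambda>x. F x $ i $ k) \<phi>"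

definition dist_div ::
    "(real ^ 'n) set \<Rightarrow> (real ^ 'n \<Rightarrow> real ^ 'n ^ 'n) \<Rightarrow> 'n \<Rightarrow> 'n distribution" where
  "dist_div \<omega> P i \<phi> = (\<Sum>j\<in>UNIV. dist_partial \<omega> j (\<lambda>x. P x $ i $ j) \<phi>)"

subsection \<open>Sobolev spaces\<close>

text \<open>
  An element of $W^{1,q}(\omega)$ is represented together with its weak gradient, as the
  function \<open>x \<mapsto> (u x, \<nabla>u x)\<close>; the second component is determined almost everywhere
  in \<open>\<omega>\<close> by the first.
\<close>

definition W1_space :: "real \<Rightarrow> (real ^ 'n) set \<Rightarrow> (real ^ 'n \<Rightarrow> real \<times> (real ^ 'n)) set" where
  "W1_space q \<omega> = {U. (\<lambda>x. fst (U x)) \<in> Lp_space q \<omega> \<and> (\<lambda>x. snd (U x)) \<in> Lp_space q \<omega> \<and>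
     (\<forall>\<phi>\<in>test_functions \<omega>. \<forall>k. dist_partial \<omega> k (\<lambda>x. fst (U x)) \<phi>
        = integral\<^sup>L (lebesgue_on \<omega>) (\<lambda>x. snd (U x) $ k * \<phi> x))}"

definition W1_norm :: "real \<Rightarrow> (real ^ 'n) set \<Rightarrow> (real ^ 'n \<Rightarrow> real \<times> (real ^ 'n)) \<Rightarrow> real" where
  "W1_norm q \<omega> U = Lp_norm q \<omega> (\<lambda>x. fst (U x)) + Lp_norm q \<omega> (\<lambda>x. snd (U x))"

definition with_grad :: "(real ^ 'n \<Rightarrow> real) \<Rightarrow> real ^ 'n \<Rightarrow> real \<times> (real ^ 'n)" where
  "with_grad \<phi> x = (\<phi> x, grad \<phi> x)"

text \<open>$W^{1,q}_0(\omega)$ is the closure of the test functions in $W^{1,q}(\omega)$.\<close>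

definition W10_space :: "real \<Rightarrow> (real ^ 'n) set \<Rightarrow> (real ^ 'n \<Rightarrow> real \<times> (real ^ 'n)) set" where
  "W10_space q \<omega> = {U \<in> W1_space q \<omega>. \<exists>\<phi>. (\<forall>m. \<phi> m \<in> test_functions \<omega>) \<and>
     (\<lambda>m. W1_norm q \<omega> (\<lambda>x. with_grad (\<phi> m) x - U x)) \<longlonglongrightarrow> 0}"

definition conjugate_exponent :: "real \<Rightarrow> real" where
  "conjugate_exponent p = p / (p - 1)"

text \<open>
  The dual of $W^{1,p'}_0(\omega)$, where $p'$ is the conjugate exponent. A distribution lies in
  it if it is the restriction to test functions of some bounded functional \<open>L\<close>;
  by density \<open>L\<close> is then unique.
\<close>

definition represents_Wm1 ::
    "real \<Rightarrow> (real ^ 'n) set \<Rightarrow> ((real ^ 'n \<Rightarrow> real \<times> (real ^ 'n)) \<Rightarrow> real) \<Rightarrow> 'n distribution \<Rightarrow> bool" where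
  "represents_Wm1 p \<omega> L T \<longleftrightarrow>
     bounded_functional (W10_space (conjugate_exponent p) \<omega>) (W1_norm (conjugate_exponent p) \<omega>) L \<and>
     (\<forall>\<phi>\<in>test_functions \<omega>. L (with_grad \<phi>) = T \<phi>)"

definition Wm1_norm ::
    "real \<Rightarrow> (real ^ 'n) set \<Rightarrow> ((real ^ 'n \<Rightarrow> real \<times> (real ^ 'n)) \<Rightarrow> real) \<Rightarrow> real" where
  "Wm1_norm p \<omega> = dual_norm (W10_space (conjugate_exponent p) \<omega>) (W1_norm (conjugate_exponent p) \<omega>)"

definition Wm1_convergent_to ::
    "real \<Rightarrow> (real ^ 'n) set \<Rightarrow> (nat \<Rightarrow> 'n distribution) \<Rightarrow> 'n distribution \<Rightarrow> bool" where
  "Wm1_convergent_to p \<omega> T T0 \<longleftrightarrow>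
     (\<exists>L L0. (\<forall>m. represents_Wm1 p \<omega> (L m) (T m)) \<and> represents_Wm1 p \<omega> L0 T0 \<and>
        (\<lambda>m. Wm1_norm p \<omega> (\<lambda>U. L m U - L0 U)) \<longlonglongrightarrow> 0)"

subsection \<open>Div-curl convergence and closedness\<close>

definition div_curl_convergent_to ::
    "real \<Rightarrow> real \<Rightarrow> (real ^ 'n) set \<Rightarrow> (nat \<Rightarrow> 'n fields) \<Rightarrow> 'n fields \<Rightarrow> bool" where
  "div_curl_convergent_to p q \<omega> u u0 \<longleftrightarrow>
     weakly_convergent_to (X_space p q \<omega>) (X_norm p q \<omega>) u u0 \<and>
     (\<forall>i j k. Wm1_convergent_to p \<omega> (\<lambda>m. dist_curl \<omega> (\<lambda>x. fst (u m x)) i j k)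
                                     (dist_curl \<omega> (\<lambda>x. fst (u0 x)) i j k)) \<and>
     (\<forall>i. Wm1_convergent_to q \<omega> (\<lambda>m. dist_div \<omega> (\<lambda>x. snd (u m x)) i)
                                 (dist_div \<omega> (\<lambda>x. snd (u0 x)) i))"

definition div_curl_closed :: "real \<Rightarrow> real \<Rightarrow> (real ^ 'n) set \<Rightarrow> 'n fields set \<Rightarrow> bool" where
  "div_curl_closed p q \<Omega> D \<longleftrightarrow>
     (\<forall>u u0. (\<forall>m. u m \<in> D) \<and> div_curl_convergent_to p q \<Omega> u u0 \<longrightarrow> u0 \<in> D)"

definition locally_div_curl_closed ::
    "real \<Rightarrow> real \<Rightarrow> ((real ^ 'n ^ 'n) \<times> (real ^ 'n ^ 'n)) set \<Rightarrow> bool" where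
  "locally_div_curl_closed p q Dloc \<longleftrightarrow>
     (\<forall>(\<omega> :: (real ^ 'n) set) F P. bounded \<omega> \<and> \<omega> \<noteq> {} \<and> open \<omega> \<and>
        (\<exists>u. div_curl_convergent_to p q \<omega> u (\<lambda>_. (F, P)) \<and>
             (\<forall>m. AE x in lebesgue_on \<omega>. u m x \<in> Dloc))
        \<longrightarrow> (F, P) \<in> Dloc)"

subsection \<open>Lipschitz sets\<close>

text \<open>
  Near each boundary point the set is the strict epigraph of a Lipschitz function over the
  hyperplane orthogonal to a unit vector \<open>e\<close>, the direction of the last coordinate after a
  rigid motion.
\<close>

definition lipschitz_set :: "(real ^ 'n) set \<Rightarrow> bool" where
  "lipschitz_set \<Omega> \<longleftrightarrow>
     (\<forall>x\<in>frontier \<Omega>. \<exists>e r C \<gamma>. norm e = 1 \<and> r > 0 \<and> C-lipschitz_on {y. y \<bullet> e = 0} \<gamma> \<and>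
        \<Omega> \<inter> ball x r = {y \<in> ball x r. y \<bullet> e > (\<gamma> (y - (y \<bullet> e) *\<^sub>R e) :: real)})"

end

theory Submission
  imports Defs
begin

text \<open>
  If \<open>\<D>\<close> is closed, a sequence on \<open>\<omega>\<close> with constant limit is rescaled so that \<open>\<Omega>\<close> fits into \<open>\<omega>\<close>;
  div-curl convergence survives restriction and rescaling.

  Conversely, blow up at almost every \<open>x \<in> \<Omega>\<close>. Along radii \<open>r i\<close> going to 0 fast enough, the limit
  field \<open>u0 (x + r i y)\<close> tends strongly to \<open>u0 x\<close> on the unit ball. The rescaled \<open>u k (x + r i y)\<close> are bounded
  along infinitely many \<open>i\<close> and \<open>k\<close>, since \<open>u k\<close> is bounded in $L^p \times L^q$ and averaging in \<open>x\<close> preserves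
  integrals (Fatou). A diagonal sequence is therefore bounded and converges to the constant \<open>u0 x\<close>
  when tested on countably many sets, hence weakly, and its curl and divergence converge strongly.
\<close>

subsection \<open>Lebesgue spaces and their bounded functionals\<close>

text \<open>Two limits compete. For a fixed radius the rescaled curls and divergences converge in
  \<open>k\<close>, but the constants of the rescaling deteriorate as the radius shrinks, so
  \<open>k\<close> has to be chosen after the radius. Such a diagonal choice can meet only finitely
  many requirements at each step; hence the countable family of test sets, and a bound independent
  of radius and \<open>k\<close> then recovers all other tests. The bound is available only for
  infinitely many radii and \<open>k\<close>, which suffices because every other requirement holds
  for all large \<open>k\<close>. The radii are fixed before the point, since the exceptional null
  set depends on them.

  Weak convergence refers to arbitrary bounded functionals on \<open>X_space\<close>. Convergence
  against functions of the conjugate Lebesgue space is therefore lifted to all functionals by a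
  convexity argument, and boundedness of weakly convergent sequences is proved directly. Crude
  constants such as \<open>2 powr p\<close> are harmless throughout: they only multiply null
  sequences or fixed bounds.\<close>

lemma norm_add_powr_le:
  fixes a b :: "'b::real_normed_vector"
  assumes "p \<ge> 0"
  shows "norm (a + b) powr p \<le> 2 powr p * (norm a powr p + norm b powr p)"
proof -
  have "norm (a + b) \<le> 2 * max (norm a) (norm b)"
    using norm_triangle_ineq[of a b] by linarith
  then have "norm (a + b) powr p \<le> (2 * max (norm a) (norm b)) powr p"
    using assms by (intro powr_mono2) auto
  also have "\<dots> = 2 powr p * max (norm a) (norm b) powr p"
    by (simp add: powr_mult)
  also have "\<dots> \<le> 2 powr p * (norm a powr p + norm b powr p)"
    by (intro mult_left_mono) (auto simp: max_def)
  finally show ?thesis .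
qed

text \<open>Stated over an arbitrary measure because the duality arguments use no geometry of the
  domain; \<open>Lp_space_eq\<close> connects it with the spaces in the theorem.\<close>

definition Lp_fun :: "'a measure \<Rightarrow> real \<Rightarrow> ('a \<Rightarrow> 'b::euclidean_space) set" where
  "Lp_fun M p = {f. f \<in> borel_measurable M \<and> integrable M (\<lambda>x. norm (f x) powr p)}"

text \<open>The p-th power of the norm. Without the root, pointwise inequalities integrate directly,
  at the price of a factor \<open>2 powr p\<close> in the triangle inequality.\<close>

definition Lp_int :: "'a measure \<Rightarrow> real \<Rightarrow> ('a \<Rightarrow> 'b::euclidean_space) \<Rightarrow> real" where
  "Lp_int M p f = integral\<^sup>L M (\<lambda>x. norm (f x) powr p)"

lemma Lp_space_eq: "Lp_space p \<omega> = Lp_fun (lebesgue_on \<omega>) p"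
  by (simp add: Lp_space_def Lp_fun_def)

lemma Lp_norm_eq: "Lp_norm p \<omega> f = Lp_int (lebesgue_on \<omega>) p f powr (1 / p)"
  by (simp add: Lp_norm_def Lp_int_def)

lemma Lp_int_nonneg [simp]: "Lp_int M p f \<ge> 0"
  by (simp add: Lp_int_def)

lemma Lp_norm_nonneg [simp]: "Lp_norm p \<omega> f \<ge> 0"
  by (simp add: Lp_norm_eq)

lemma Lp_funD:
  assumes "f \<in> Lp_fun M p"
  shows "f \<in> borel_measurable M" "integrable M (\<lambda>x. norm (f x) powr p)"
  using assms by (auto simp: Lp_fun_def)

lemma Lp_fun_bound:
  assumes "f \<in> Lp_fun M p" "g \<in> borel_measurable M" "p \<ge> 0"
    and "\<And>x. x \<in> space M \<Longrightarrow> norm (g x) \<le> K * norm (f x)"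
  shows "g \<in> Lp_fun M p" "Lp_int M p g \<le> \<bar>K\<bar> powr p * Lp_int M p f"
proof -
  have le: "norm (g x) powr p \<le> \<bar>K\<bar> powr p * norm (f x) powr p" if "x \<in> space M" for x
  proof -
    have "norm (g x) \<le> \<bar>K\<bar> * norm (f x)"
      using assms(4)[OF that] by (meson abs_ge_self mult_right_mono norm_ge_zero order_trans)
    then have "norm (g x) powr p \<le> (\<bar>K\<bar> * norm (f x)) powr p"
      using assms(3) by (intro powr_mono2) auto
    then show ?thesis by (simp add: powr_mult)
  qed
  have i: "integrable M (\<lambda>x. \<bar>K\<bar> powr p * norm (f x) powr p)"
    using Lp_funD(2)[OF assms(1)] by simp
  have ig: "integrable M (\<lambda>x. norm (g x) powr p)"
    by (rule Bochner_Integration.integrable_bound[OF i]) (use le assms(2) in auto)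
  then show "g \<in> Lp_fun M p" using assms(2) by (simp add: Lp_fun_def)
  show "Lp_int M p g \<le> \<bar>K\<bar> powr p * Lp_int M p f"
    unfolding Lp_int_def integral_mult_right_zero[symmetric]
    by (intro integral_mono ig i le)
qed

lemma Lp_fun_add:
  assumes "f \<in> Lp_fun M p" "g \<in> Lp_fun M p" "p \<ge> 0"
  shows "(\<lambda>x. f x + g x) \<in> Lp_fun M p"
    and "Lp_int M p (\<lambda>x. f x + g x) \<le> 2 powr p * (Lp_int M p f + Lp_int M p g)"
proof -
  note [measurable] = Lp_funD(1)[OF assms(1)] Lp_funD(1)[OF assms(2)]
  have i: "integrable M (\<lambda>x. 2 powr p * (norm (f x) powr p + norm (g x) powr p))"
    using Lp_funD(2)[OF assms(1)] Lp_funD(2)[OF assms(2)] by simp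
  have ig: "integrable M (\<lambda>x. norm (f x + g x) powr p)"
    by (rule Bochner_Integration.integrable_bound[OF i]) (use norm_add_powr_le[OF assms(3)] in auto)
  then show "(\<lambda>x. f x + g x) \<in> Lp_fun M p" by (simp add: Lp_fun_def)
  have "Lp_int M p (\<lambda>x. f x + g x) \<le> (\<integral>x. 2 powr p * (norm (f x) powr p + norm (g x) powr p) \<partial>M)"
    unfolding Lp_int_def by (intro integral_mono ig i norm_add_powr_le assms)
  then show "Lp_int M p (\<lambda>x. f x + g x) \<le> 2 powr p * (Lp_int M p f + Lp_int M p g)"
    using Lp_funD(2)[OF assms(1)] Lp_funD(2)[OF assms(2)] by (simp add: Lp_int_def)
qed

lemma Lp_fun_scaleR:
  assumes "f \<in> Lp_fun M p"
  shows "(\<lambda>x. c *\<^sub>R f x) \<in> Lp_fun M p" "Lp_int M p (\<lambda>x. c *\<^sub>R f x) = \<bar>c\<bar> powr p * Lp_int M p f"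
  using assms by (auto simp: Lp_fun_def Lp_int_def powr_mult)

lemma Lp_fun_diff:
  assumes "f \<in> Lp_fun M p" "g \<in> Lp_fun M p" "p \<ge> 0"
  shows "(\<lambda>x. f x - g x) \<in> Lp_fun M p"
    and "Lp_int M p (\<lambda>x. f x - g x) \<le> 2 powr p * (Lp_int M p f + Lp_int M p g)"
  using Lp_fun_add[OF assms(1) Lp_fun_scaleR(1)[OF assms(2), of "-1"] assms(3)]
  by (auto simp: Lp_fun_scaleR(2)[OF assms(2), of "-1"] Lp_int_def)

lemma Lp_fun_zero [simp]: "(\<lambda>x. 0) \<in> Lp_fun M p" "Lp_int M p (\<lambda>x. 0) = 0"
  by (auto simp: Lp_fun_def Lp_int_def)

lemma Lp_fun_const: "finite_measure M \<Longrightarrow> (\<lambda>x. c) \<in> Lp_fun M p"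
  by (simp add: Lp_fun_def finite_measure.integrable_const)

lemma Lp_fun_linear:
  assumes "f \<in> Lp_fun M p" "bounded_linear T" "p \<ge> 0"
  shows "(\<lambda>x. T (f x)) \<in> Lp_fun M p"
    and "Lp_int M p (\<lambda>x. T (f x)) \<le> onorm T powr p * Lp_int M p f"
proof -
  have "(\<lambda>x. T (f x)) \<in> borel_measurable M"
    by (intro measurable_compose[OF Lp_funD(1)[OF assms(1)]] borel_measurable_continuous_onI
        bounded_linear.continuous_on[OF assms(2)] continuous_on_id)
  from Lp_fun_bound[OF assms(1) this assms(3), of "onorm T"] onorm[OF assms(2)] onorm_pos_le[OF assms(2)]
  show "(\<lambda>x. T (f x)) \<in> Lp_fun M p" "Lp_int M p (\<lambda>x. T (f x)) \<le> onorm T powr p * Lp_int M p f"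
    by auto
qed

lemma Lp_int_diff_commute: "Lp_int M p (\<lambda>x. f x - g x) = Lp_int M p (\<lambda>x. g x - f x)"
  by (simp add: Lp_int_def norm_minus_commute)

section \<open>Conjugate exponents and the Hoelder inequality\<close>

lemma conj_exponentsD:
  fixes p q :: real
  assumes "1 < p" "1 < q" "1 / p + 1 / q = 1"
  shows "(p - 1) * q = p" "conjugate_exponent p = q" "conjugate_exponent q = p"
proof -
  have "p + q = p * q" using assms by (simp add: field_simps)
  then show "(p - 1) * q = p" "conjugate_exponent p = q" "conjugate_exponent q = p"
    using assms by (simp_all add: conjugate_exponent_def field_simps)
qed

lemma Holder_inequality:
  fixes f :: "'a \<Rightarrow> 'b::euclidean_space" and g :: "'a \<Rightarrow> 'c::euclidean_space"
  assumes "f \<in> Lp_fun M p" "g \<in> Lp_fun M q"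
    and pq: "1 < p" "1 < q" "1 / p + 1 / q = 1"
  shows "integrable M (\<lambda>x. norm (f x) * norm (g x))"
    and "(\<integral>x. norm (f x) * norm (g x) \<partial>M) \<le> Lp_int M p f powr (1 / p) * Lp_int M q g powr (1 / q)"
proof -
  note [measurable] = Lp_funD(1)[OF assms(1)] Lp_funD(1)[OF assms(2)]
  note ints = Lp_funD(2)[OF assms(1)] Lp_funD(2)[OF assms(2)]
  have young: "a * b \<le> a powr p / p + b powr q / q" if "a \<ge> 0" "b \<ge> 0" for a b :: real
    using Youngs_inequality[of p q a b] pq that by auto
  have i: "integrable M (\<lambda>x. norm (f x) powr p / p + norm (g x) powr q / q)"
    using ints by simp
  show ifg: "integrable M (\<lambda>x. norm (f x) * norm (g x))"
    by (rule Bochner_Integration.integrable_bound[OF i]) (use young pq in \<open>auto intro!: AE_I2\<close>)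
  define A where "A = Lp_int M p f powr (1 / p)"
  define B where "B = Lp_int M q g powr (1 / q)"
  have A0: "A \<ge> 0" "B \<ge> 0" by (auto simp: A_def B_def)
  have Ap: "A powr p = Lp_int M p f" "B powr q = Lp_int M q g"
    using pq by (auto simp: A_def B_def powr_powr)
  show "(\<integral>x. norm (f x) * norm (g x) \<partial>M) \<le> A * B"
  \<comment> \<open>The main case divides by \<open>A\<close> and \<open>B\<close> before applying
    Young's inequality. If one of them is 0, the product vanishes almost everywhere.\<close>
  proof (cases "A = 0 \<or> B = 0")
    case True
    then have "AE x in M. norm (f x) * norm (g x) = 0"
    proof
      assume "A = 0"
      then have "(\<integral>x. norm (f x) powr p \<partial>M) = 0" using Ap pq by (simp add: Lp_int_def)
      then have "AE x in M. norm (f x) powr p = 0"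
        using integral_nonneg_eq_0_iff_AE[OF ints(1)] by simp
      then show ?thesis by eventually_elim auto
    next
      assume "B = 0"
      then have "(\<integral>x. norm (g x) powr q \<partial>M) = 0" using Ap pq by (simp add: Lp_int_def)
      then have "AE x in M. norm (g x) powr q = 0"
        using integral_nonneg_eq_0_iff_AE[OF ints(2)] by simp
      then show ?thesis by eventually_elim auto
    qed
    then have "(\<integral>x. norm (f x) * norm (g x) \<partial>M) = 0"
      using integral_nonneg_eq_0_iff_AE[OF ifg] by simp
    then show ?thesis using A0 by simp
  next
    case False
    then have pos: "A > 0" "B > 0" using A0 by auto
    have "norm (f x) * norm (g x) \<le> A * B * (norm (f x) powr p / (p * A powr p) + norm (g x) powr q / (q * B powr q))" for x
    proof -
      have "norm (f x) / A * (norm (g x) / B) \<le> (norm (f x) / A) powr p / p + (norm (g x) / B) powr q / q"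
        using pos by (intro young) auto
      then have "A * B * (norm (f x) / A * (norm (g x) / B)) \<le> A * B * ((norm (f x) / A) powr p / p + (norm (g x) / B) powr q / q)"
        using pos by (intro mult_left_mono) auto
      then show ?thesis using pos by (simp add: powr_divide mult.commute)
    qed
    then have "(\<integral>x. norm (f x) * norm (g x) \<partial>M) \<le>
        (\<integral>x. A * B * (norm (f x) powr p / (p * A powr p) + norm (g x) powr q / (q * B powr q)) \<partial>M)"
      using ints by (intro integral_mono ifg) auto
    also have "\<dots> = A * B * (Lp_int M p f / (p * A powr p) + Lp_int M q g / (q * B powr q))"
      using ints by (simp add: Lp_int_def)
    also have "\<dots> = A * B * (1 / p + 1 / q)"
      using pos pq unfolding Ap[symmetric] by simp
    also have "\<dots> = A * B" using pq by simp
    finally show ?thesis .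
  qed
qed

lemma Holder_inner:
  fixes f g :: "'a \<Rightarrow> 'b::euclidean_space"
  assumes "f \<in> Lp_fun M p" "g \<in> Lp_fun M q"
    and pq: "1 < p" "1 < q" "1 / p + 1 / q = 1"
  shows "integrable M (\<lambda>x. f x \<bullet> g x)"
    and "\<bar>\<integral>x. f x \<bullet> g x \<partial>M\<bar> \<le> Lp_int M p f powr (1 / p) * Lp_int M q g powr (1 / q)"
proof -
  note [measurable] = Lp_funD(1)[OF assms(1)] Lp_funD(1)[OF assms(2)]
  note H = Holder_inequality[OF assms]
  show i: "integrable M (\<lambda>x. f x \<bullet> g x)"
    by (rule Bochner_Integration.integrable_bound[OF H(1)]) (auto simp: Cauchy_Schwarz_ineq2)
  have "\<bar>\<integral>x. f x \<bullet> g x \<partial>M\<bar> \<le> (\<integral>x. \<bar>f x \<bullet> g x\<bar> \<partial>M)" by (rule integral_abs_bound)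
  also have "\<dots> \<le> (\<integral>x. norm (f x) * norm (g x) \<partial>M)"
    by (intro integral_mono integrable_abs i H Cauchy_Schwarz_ineq2)
  finally show "\<bar>\<integral>x. f x \<bullet> g x \<partial>M\<bar> \<le> Lp_int M p f powr (1 / p) * Lp_int M q g powr (1 / q)"
    using H(2) by linarith
qed

text \<open>The gradient of \<open>norm x powr p / p\<close>. Since \<open>0 powr a = 0\<close>, its
  value at the origin is 0 also for \<open>p < 2\<close>, where the exponent is negative.\<close>

definition duality_map :: "real \<Rightarrow> 'b::euclidean_space \<Rightarrow> 'b" where
  "duality_map p x = norm x powr (p - 2) *\<^sub>R x"

lemma powr_mult_self: "x \<ge> 0 \<Longrightarrow> x powr a * x = x powr (a + 1)" for x a :: real
  using powr_add[of x a 1] by simp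

lemma norm_duality_map: "norm (duality_map p x) = norm x powr (p - 1)"
  using powr_mult_self[of "norm x" "p - 2"] by (simp add: duality_map_def)

lemma duality_map_inner_self: "duality_map p x \<bullet> x = norm x powr p"
  using powr_mult_self[of "norm x" "p - 2"] powr_mult_self[of "norm x" "p - 1"]
  by (simp add: duality_map_def dot_square_norm power2_eq_square flip: mult.assoc)

lemma duality_map_scaleR: "s > 0 \<Longrightarrow> duality_map p (s *\<^sub>R x) = s powr (p - 1) *\<^sub>R duality_map p x"
  using powr_mult_self[of s "p - 2"] by (simp add: duality_map_def powr_mult mult_ac)

text \<open>Only the origin is delicate: for \<open>p < 2\<close> the scalar factor blows up there,
  but the norm of the product is \<open>norm x powr (p - 1)\<close>, which tends to 0 because
  \<open>p > 1\<close>.\<close>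

lemma continuous_on_duality_map:
  assumes "1 < p" shows "continuous_on UNIV (duality_map p :: 'b::euclidean_space \<Rightarrow> 'b)"
proof (intro continuous_at_imp_continuous_on ballI)
  fix x :: 'b
  show "isCont (duality_map p) x"
  proof (cases "x = 0")
    case False
    have "((\<lambda>y. norm y powr (p - 2) *\<^sub>R y) \<longlongrightarrow> norm x powr (p - 2) *\<^sub>R x) (at x)"
      by (rule tendsto_scaleR[OF tendsto_powr[OF tendsto_norm[OF tendsto_ident_at] tendsto_const] tendsto_ident_at])
        (use False in simp)
    then show ?thesis by (simp add: isCont_def duality_map_def[abs_def])
  next
    case True
    have "((\<lambda>x::'b. norm x powr (p - 1)) \<longlongrightarrow> 0) (at 0)"
      by (rule tendsto_zero_powrI[OF tendsto_norm_zero[OF tendsto_ident_at] tendsto_const])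
        (use assms in auto)
    then have "((\<lambda>x::'b. norm (duality_map p x)) \<longlongrightarrow> 0) (at 0)" by (simp add: norm_duality_map)
    then have "(duality_map p \<longlongrightarrow> (0::'b)) (at 0)" by (rule tendsto_norm_zero_cancel)
    then show ?thesis using True by (simp add: isCont_def duality_map_def)
  qed
qed

text \<open>Convexity of the p-th power of the norm. Young's inequality bounds the mixed term
  \<open>duality_map p x \<bullet> y\<close>, so no second derivative is involved.\<close>

lemma duality_map_subgradient:
  fixes x y :: "'b::euclidean_space"
  assumes "1 < p"
  shows "norm x powr p + p * (duality_map p x \<bullet> (y - x)) \<le> norm y powr p"
proof -
  define q where "q = p / (p - 1)"
  have pq: "1 < q" "1 / p + 1 / q = 1" "(p - 1) * q = p"
    using assms by (auto simp: q_def field_simps)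
  have "duality_map p x \<bullet> y \<le> norm x powr (p - 1) * norm y"
    using norm_cauchy_schwarz[of "duality_map p x" y] by (simp add: norm_duality_map)
  also have "\<dots> \<le> (norm x powr (p - 1)) powr q / q + norm y powr p / p"
    using Youngs_inequality[of q p "norm x powr (p - 1)" "norm y"] assms pq by auto
  also have "\<dots> = norm x powr p / q + norm y powr p / p" by (simp add: powr_powr pq)
  finally have "p * (duality_map p x \<bullet> y) \<le> p * (norm x powr p / q + norm y powr p / p)"
    using assms by (intro mult_left_mono) auto
  also have "\<dots> = (p / q) * norm x powr p + norm y powr p"
    using assms by (simp add: distrib_left)
  also have "p / q = p - 1" using assms by (simp add: q_def)
  finally show ?thesis
    by (simp add: inner_diff_right duality_map_inner_self algebra_simps)
qed

text \<open>Uniform differentiability of \<open>\<bar>\<cdot>\<bar>\<^sup>p\<close>; by homogeneity only the compact set \<open>max \<bar>a\<bar> \<bar>b\<bar> = 1\<close> matters.\<close>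

lemma norm_powr_uniformly_smooth:
  assumes "1 < p" "\<eta> > 0"
  obtains t where "0 < t" "t < 1"
    "\<And>a b :: 'b::euclidean_space. norm (a + t *\<^sub>R b) powr p \<le>
       norm a powr p + t * p * (duality_map p a \<bullet> b) + t * \<eta> * (norm a powr p + norm b powr p)"
proof -
  \<comment> \<open>Radius 2 contains both \<open>a\<close> and \<open>a + t b\<close> when the two
    norms are at most 1 and \<open>t < 1\<close>.\<close>
  have "uniformly_continuous_on (cball 0 2) (duality_map p :: 'b \<Rightarrow> 'b)"
    by (intro compact_uniformly_continuous continuous_on_subset[OF continuous_on_duality_map] assms) auto
  then obtain \<delta> where \<delta>: "\<delta> > 0" "\<And>x y::'b. x \<in> cball 0 2 \<Longrightarrow> y \<in> cball 0 2 \<Longrightarrow> dist y x < \<delta> \<Longrightarrow>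
      dist (duality_map p y) (duality_map p x) < \<eta> / p"
    unfolding uniformly_continuous_on_def using divide_pos_pos[OF assms(2), of p] assms(1)
    by (meson less_trans zero_less_one)
  define t where "t = min (1/2) (\<delta>/2)"
  have t: "0 < t" "t < 1" "t < \<delta>" using \<delta>(1) by (auto simp: t_def)
  have *: "norm (a + t *\<^sub>R b) powr p \<le>
       norm a powr p + t * p * (duality_map p a \<bullet> b) + t * \<eta> * (norm a powr p + norm b powr p)"
    if m: "max (norm a) (norm b) = 1" for a b :: 'b
  proof -
    have ab: "norm a \<le> 1" "norm b \<le> 1" "norm (t *\<^sub>R b) \<le> t"
      using m t by (auto simp: max_def mult_left_le split: if_splits)
    have n: "norm (a + t *\<^sub>R b) \<le> 2" using norm_triangle_ineq[of a "t *\<^sub>R b"] ab t by linarith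
    have "dist (duality_map p (a + t *\<^sub>R b)) (duality_map p a) < \<eta> / p"
    proof (rule \<delta>(2))
      show "a \<in> cball 0 2" "a + t *\<^sub>R b \<in> cball 0 2" using ab n by (simp_all add: mem_cball_0 del: mem_cball)
      show "dist (a + t *\<^sub>R b) a < \<delta>" using ab(3) t(3) unfolding dist_norm add_diff_cancel_left' by linarith
    qed
    then have d: "norm (duality_map p (a + t *\<^sub>R b) - duality_map p a) < \<eta> / p"
      by (simp add: dist_norm)
    have 1: "1 \<le> norm a powr p + norm b powr p"
      using m by (auto simp: max_def split: if_splits)
    \<comment> \<open>Convexity is applied at the moved point \<open>a + t b\<close>, looking back
      to \<open>a\<close>. This turns the lower bound into an upper bound whose error is the
      increment of the gradient, small by uniform continuity.\<close>
    have "norm (a + t *\<^sub>R b) powr p + p * (duality_map p (a + t *\<^sub>R b) \<bullet> (a - (a + t *\<^sub>R b))) \<le> norm a powr p"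
      by (rule duality_map_subgradient[OF assms(1)])
    then have "norm (a + t *\<^sub>R b) powr p \<le> norm a powr p + t * p * (duality_map p (a + t *\<^sub>R b) \<bullet> b)"
      by (simp add: algebra_simps)
    also have eq: "\<dots> = norm a powr p + t * p * (duality_map p a \<bullet> b)
        + t * (p * ((duality_map p (a + t *\<^sub>R b) - duality_map p a) \<bullet> b))"
      by (simp add: algebra_simps)
    also have "\<dots> \<le> norm a powr p + t * p * (duality_map p a \<bullet> b) + t * (\<eta> * (norm a powr p + norm b powr p))"
    proof -
      have "(duality_map p (a + t *\<^sub>R b) - duality_map p a) \<bullet> b
          \<le> norm (duality_map p (a + t *\<^sub>R b) - duality_map p a) * norm b" by (rule norm_cauchy_schwarz)
      also have "\<dots> \<le> (\<eta> / p) * 1" using d ab assms by (intro mult_mono) auto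
      finally have "p * ((duality_map p (a + t *\<^sub>R b) - duality_map p a) \<bullet> b) \<le> \<eta>"
        using assms by (simp add: field_simps)
      also have "\<eta> \<le> \<eta> * (norm a powr p + norm b powr p)" using 1 assms by simp
      finally show ?thesis using t by (intro add_left_mono mult_left_mono) auto
    qed
    finally show ?thesis by (simp only: mult.assoc)
  qed
  show ?thesis
  proof (rule that[OF t(1,2)])
    fix a b :: 'b
    define s where "s = max (norm a) (norm b)"
    show "norm (a + t *\<^sub>R b) powr p \<le>
       norm a powr p + t * p * (duality_map p a \<bullet> b) + t * \<eta> * (norm a powr p + norm b powr p)"
    proof (cases "s = 0")
      case True
      then have "a = 0" "b = 0" by (auto simp: s_def max_def split: if_splits)
      then show ?thesis by simp
    next
      case False
      then have s: "s > 0" by (auto simp: s_def max_def split: if_splits)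
      define a' b' where "a' = (1/s) *\<^sub>R a" and "b' = (1/s) *\<^sub>R b"
      have ab: "a = s *\<^sub>R a'" "b = s *\<^sub>R b'" using s by (auto simp: a'_def b'_def)
      have "s * max (norm a') (norm b') = s"
        using s unfolding a'_def b'_def s_def by (auto simp: max_def field_simps)
      then have "max (norm a') (norm b') = 1" using s by simp
      from *[OF this] have "s powr p * norm (a' + t *\<^sub>R b') powr p \<le> s powr p *
        (norm a' powr p + t * p * (duality_map p a' \<bullet> b') + t * \<eta> * (norm a' powr p + norm b' powr p))"
        by (intro mult_left_mono) auto
      moreover have "norm (a + t *\<^sub>R b) = s * norm (a' + t *\<^sub>R b')"
        using s unfolding ab by (metis abs_of_pos norm_scaleR scaleR_add_right scaleR_left_commute)
      moreover have "duality_map p a \<bullet> b = s powr p * (duality_map p a' \<bullet> b')"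
      proof -
        show ?thesis using s powr_mult_self[of s "p - 1"]
          unfolding ab by (simp add: duality_map_scaleR[OF s] mult.commute)
      qed
      ultimately show ?thesis using s
        by (simp add: ab powr_mult algebra_simps)
    qed
  qed
qed

lemma duality_map_Lp:
  assumes "f \<in> Lp_fun M p" and pq: "1 < p" "1 < q" "1 / p + 1 / q = 1"
  shows "(\<lambda>x. duality_map p (f x)) \<in> Lp_fun M q"
    and "Lp_int M q (\<lambda>x. duality_map p (f x)) = Lp_int M p f"
proof -
  have "(\<lambda>x. duality_map p (f x)) \<in> borel_measurable M"
    by (intro measurable_compose[OF Lp_funD(1)[OF assms(1)]] borel_measurable_continuous_onI
        continuous_on_duality_map pq)
  then show "(\<lambda>x. duality_map p (f x)) \<in> Lp_fun M q"
    "Lp_int M q (\<lambda>x. duality_map p (f x)) = Lp_int M p f"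
    using assms(1) by (auto simp: Lp_fun_def Lp_int_def norm_duality_map powr_powr conj_exponentsD[OF pq])
qed

text \<open>A Mazur-type argument that replaces the Riesz representation of the dual of $L^p$: if \<open>L (f m)\<close>
  stayed away from 0, a near-minimiser \<open>s\<close> of the $L^p$ norm on \<open>{L \<ge> \<epsilon>}\<close> could be improved by
  moving towards some \<open>\<plusminus> f m\<close>, which is almost orthogonal to the gradient at \<open>s\<close>.\<close>

lemma bounded_functional_tendsto_0:
  fixes f :: "nat \<Rightarrow> 'a \<Rightarrow> 'b::euclidean_space"
  assumes pq: "1 < p" "1 < q" "1 / p + 1 / q = 1"
    and L: "bounded_functional (Lp_fun M p) (\<lambda>f. Lp_int M p f powr (1 / p)) L"
    and f: "\<And>m. f m \<in> Lp_fun M p" "\<And>m. Lp_int M p (f m) \<le> K"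
    and weak: "\<And>\<psi>. \<psi> \<in> Lp_fun M q \<Longrightarrow> (\<lambda>m. \<integral>x. \<psi> x \<bullet> f m x \<partial>M) \<longlonglongrightarrow> 0"
  shows "(\<lambda>m. L (f m)) \<longlonglongrightarrow> 0"
proof (rule ccontr)
  assume "\<not> (\<lambda>m. L (f m)) \<longlonglongrightarrow> 0"
  then obtain \<epsilon> where \<epsilon>: "\<epsilon> > 0" "\<And>N. \<exists>m\<ge>N. \<bar>L (f m)\<bar> \<ge> \<epsilon>"
    unfolding LIMSEQ_def by (force simp: not_less)
  have p0: "p \<ge> 0" "p > 0" using pq by auto
  have Ladd: "L (\<lambda>x. g x + h x) = L g + L h" if "g \<in> Lp_fun M p" "h \<in> Lp_fun M p" for g h
    using L that by (auto simp: bounded_functional_def)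
  have Lscale: "L (\<lambda>x. c *\<^sub>R g x) = c * L g" if "g \<in> Lp_fun M p" for g c
    using L that by (auto simp: bounded_functional_def)
  obtain C0 where C0: "\<And>g. g \<in> Lp_fun M p \<Longrightarrow> \<bar>L g\<bar> \<le> C0 * Lp_int M p g powr (1 / p)"
    using L unfolding bounded_functional_def by blast
  \<comment> \<open>The bound of a functional may be given with a constant that is not positive;
    \<open>C\<close> is going to be divided by.\<close>
  define C where "C = max C0 1"
  have C2: "\<bar>L g\<bar> \<le> C * Lp_int M p g powr (1 / p)" if "g \<in> Lp_fun M p" for g
    using C0[OF that] mult_right_mono[of C0 C "Lp_int M p g powr (1 / p)"] by (auto simp: C_def)
  have C: "C > 0" by (simp add: C_def)
  define S where "S = {s \<in> Lp_fun M p. L s \<ge> \<epsilon>}"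
  \<comment> \<open>Since \<open>L s \<ge> \<epsilon>\<close> and \<open>L\<close> is bounded by
    \<open>C\<close> times the norm, no element of \<open>S\<close> has \<open>Lp_int\<close> below
    this value.\<close>
  define \<delta> where "\<delta> = (\<epsilon> / C) powr p"
  have \<delta>: "\<delta> > 0" using \<epsilon> C by (simp add: \<delta>_def)
  have low: "\<delta> \<le> Lp_int M p s" if "s \<in> S" for s
  proof -
    have "\<epsilon> \<le> C * Lp_int M p s powr (1 / p)" using C2[of s] that by (auto simp: S_def)
    then have "\<epsilon> / C \<le> Lp_int M p s powr (1 / p)" using C by (simp add: field_simps)
    then have "(\<epsilon> / C) powr p \<le> (Lp_int M p s powr (1 / p)) powr p"
      using \<epsilon> C p0 by (intro powr_mono2) auto
    then show ?thesis using p0 by (simp add: \<delta>_def powr_powr)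
  qed
  have sgn: "\<exists>\<sigma>. \<bar>\<sigma>\<bar> = 1 \<and> (\<lambda>x. \<sigma> *\<^sub>R f m x) \<in> S" if "\<bar>L (f m)\<bar> \<ge> \<epsilon>" for m
    using that Lscale[OF f(1), of "sgn (L (f m))" m] \<epsilon>
    by (intro exI[of _ "sgn (L (f m))"])
      (auto simp: S_def Lp_fun_scaleR[OF f(1)] sgn_if split: if_splits)
  obtain m0 where "\<bar>L (f m0)\<bar> \<ge> \<epsilon>" using \<epsilon>(2) by blast
  then have S0: "S \<noteq> {}" using sgn by blast
  define d where "d = (INF s\<in>S. Lp_int M p s)"
  have bdd: "bdd_below (Lp_int M p ` S)" by (auto intro: bdd_belowI2[OF low])
  have d: "d \<ge> \<delta>" unfolding d_def using S0 low by (intro cINF_greatest) auto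
  \<comment> \<open>\<open>K'\<close> bounds \<open>Lp_int\<close> of the near-minimiser plus that
    of the direction \<open>b\<close>, and \<open>\<eta>\<close> is such that the smoothness error
    costs at most \<open>t * p * \<delta> / 8\<close>.\<close>
  define K' where "K' = d + 1 + 2 powr p * (d + 1 + max K 0)"
  have K': "K' > 0" using d \<delta> by (auto simp: K'_def intro!: add_pos_nonneg)
  define \<eta> where "\<eta> = p * \<delta> / (8 * K')"
  have \<eta>: "\<eta> > 0" using \<delta> K' p0 by (simp add: \<eta>_def)
  obtain t where t: "0 < t" "t < 1"
    "\<And>a b :: 'b. norm (a + t *\<^sub>R b) powr p \<le>
       norm a powr p + t * p * (duality_map p a \<bullet> b) + t * \<eta> * (norm a powr p + norm b powr p)"
    using norm_powr_uniformly_smooth[OF pq(1) \<eta>] by metis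
  \<comment> \<open>The step length \<open>t\<close> is fixed before \<open>s\<close>, as the
    required quality of \<open>s\<close> depends on it. The step will gain
    \<open>(5/8) * t * p * \<delta>\<close>, more than the slack \<open>\<tau>\<close>; the cap 1
    keeps \<open>Lp_int\<close> of \<open>s\<close> below \<open>d + 1\<close>.\<close>
  define \<tau> where "\<tau> = min 1 (t * p * \<delta> / 4)"
  have \<tau>: "\<tau> > 0" "\<tau> \<le> 1" "\<tau> \<le> t * p * \<delta> / 4" using t p0 \<delta> by (auto simp: \<tau>_def)
  obtain s where s: "s \<in> S" "Lp_int M p s < d + \<tau>"
    using cINF_less_iff[OF S0 bdd, of "d + \<tau>"] \<tau> by (auto simp: d_def)
  have sL: "s \<in> Lp_fun M p" "L s \<ge> \<epsilon>" using s by (auto simp: S_def)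
  have sl: "Lp_int M p s \<ge> \<delta>" by (rule low[OF s(1)])
  note J = duality_map_Lp[OF sL(1) pq]
  \<comment> \<open>Weak convergence enters here, tested with one function only: the gradient at
    \<open>s\<close>.\<close>
  from weak[OF J(1)] have "\<forall>\<^sub>F m in sequentially. \<bar>\<integral>x. duality_map p (s x) \<bullet> f m x \<partial>M\<bar> < \<delta> / 4"
    using \<delta> by (auto simp: tendsto_iff dest: spec[of _ "\<delta> / 4"])
  then obtain N where N: "\<And>m. m \<ge> N \<Longrightarrow> \<bar>\<integral>x. duality_map p (s x) \<bullet> f m x \<partial>M\<bar> < \<delta> / 4"
    by (auto simp: eventually_sequentially)
  obtain m where m: "m \<ge> N" "\<bar>L (f m)\<bar> \<ge> \<epsilon>" using \<epsilon>(2) by blast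
  obtain \<sigma> where \<sigma>: "\<bar>\<sigma>\<bar> = 1" "(\<lambda>x. \<sigma> *\<^sub>R f m x) \<in> S" using sgn[OF m(2)] by blast
  define g where "g = (\<lambda>x. \<sigma> *\<^sub>R f m x)"
  have g: "g \<in> Lp_fun M p" "L g \<ge> \<epsilon>" "Lp_int M p g \<le> max K 0"
    using \<sigma> f(2)[of m] Lp_fun_scaleR(2)[OF f(1), of \<sigma> m] by (auto simp: S_def g_def)
  define b where "b = (\<lambda>x. g x - s x)"
  have b: "b \<in> Lp_fun M p" "Lp_int M p b \<le> 2 powr p * (d + 1 + max K 0)"
  proof -
    show "b \<in> Lp_fun M p" unfolding b_def by (rule Lp_fun_diff(1)[OF g(1) sL(1) p0(1)])
    have "Lp_int M p b \<le> 2 powr p * (Lp_int M p g + Lp_int M p s)"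
      unfolding b_def by (rule Lp_fun_diff(2)[OF g(1) sL(1) p0(1)])
    also have "\<dots> \<le> 2 powr p * (d + 1 + max K 0)"
      using g(3) s(2) \<tau>(2) by (intro mult_left_mono) auto
    finally show "Lp_int M p b \<le> 2 powr p * (d + 1 + max K 0)" .
  qed
  define s' where "s' = (\<lambda>x. s x + t *\<^sub>R b x)"
  have s'eq: "s' = (\<lambda>x. (1 - t) *\<^sub>R s x + t *\<^sub>R g x)"
    by (auto simp: s'_def b_def algebra_simps)
  have s'L: "s' \<in> Lp_fun M p" unfolding s'_def by (intro Lp_fun_add Lp_fun_scaleR sL b p0)
  have "L s' = (1 - t) * L s + t * L g"
    unfolding s'eq by (simp add: Ladd Lscale Lp_fun_scaleR sL g)
  moreover have "\<dots> \<ge> (1 - t) * \<epsilon> + t * \<epsilon>"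
    using t sL g by (intro add_mono mult_left_mono) auto
  ultimately have "s' \<in> S" using s'L by (simp add: S_def algebra_simps)
  then have "d \<le> Lp_int M p s'" unfolding d_def by (intro cINF_lower bdd)
  moreover have "Lp_int M p s' < d"
  proof -
    have iJ: "integrable M (\<lambda>x. duality_map p (s x) \<bullet> h x)" if "h \<in> Lp_fun M p" for h
      using Holder_inner(1)[OF that J(1) pq] by (simp add: inner_commute)
    note ints = Lp_funD(2)[OF sL(1)] Lp_funD(2)[OF b(1)]
    have "Lp_int M p s' \<le> (\<integral>x. norm (s x) powr p + t * p * (duality_map p (s x) \<bullet> b x)
          + t * \<eta> * (norm (s x) powr p + norm (b x) powr p) \<partial>M)"
      unfolding Lp_int_def s'_def using t(3) ints iJ[OF b(1)] Lp_funD(2)[OF s'L]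
      by (intro integral_mono) (auto simp: s'_def)
    also have "\<dots> = Lp_int M p s + t * p * (\<integral>x. duality_map p (s x) \<bullet> b x \<partial>M)
          + t * \<eta> * (Lp_int M p s + Lp_int M p b)"
      using ints iJ[OF b(1)] by (simp add: Lp_int_def)
    finally have 1: "Lp_int M p s' \<le> Lp_int M p s + t * p * (\<integral>x. duality_map p (s x) \<bullet> b x \<partial>M)
          + t * \<eta> * (Lp_int M p s + Lp_int M p b)" .
    \<comment> \<open>Up to the factor \<open>p\<close>, this is the derivative at \<open>s\<close>
      in the direction \<open>g - s\<close>. The pairing with \<open>g\<close> is at most
      \<open>\<delta> / 4\<close>, the subtracted term at least \<open>\<delta>\<close>, so the
      direction descends.\<close>
    have 2: "(\<integral>x. duality_map p (s x) \<bullet> b x \<partial>M) = (\<integral>x. duality_map p (s x) \<bullet> g x \<partial>M) - Lp_int M p s"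
      using iJ[OF g(1)] iJ[OF sL(1)] unfolding b_def
      by (simp add: inner_diff_right Lp_int_def duality_map_inner_self)
    have "(\<integral>x. duality_map p (s x) \<bullet> g x \<partial>M) = \<sigma> * (\<integral>x. duality_map p (s x) \<bullet> f m x \<partial>M)"
      by (simp add: g_def)
    also have "\<dots> \<le> \<bar>\<sigma> * (\<integral>x. duality_map p (s x) \<bullet> f m x \<partial>M)\<bar>" by simp
    also have "\<dots> \<le> \<delta> / 4" using N[OF m(1)] \<sigma>(1) by (simp add: abs_mult)
    finally have "(\<integral>x. duality_map p (s x) \<bullet> b x \<partial>M) \<le> \<delta> / 4 - \<delta>"
      using 2 sl by linarith
    then have 3: "t * p * (\<integral>x. duality_map p (s x) \<bullet> b x \<partial>M) \<le> t * p * (\<delta> / 4 - \<delta>)"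
      using t p0 by (intro mult_left_mono) auto
    have "\<eta> * (Lp_int M p s + Lp_int M p b) \<le> \<eta> * K'"
      using \<eta> s(2) \<tau>(2) b(2) unfolding K'_def by (intro mult_left_mono add_mono) auto
    also have "\<dots> = p * \<delta> / 8" using K' by (simp add: \<eta>_def)
    finally have "t * \<eta> * (Lp_int M p s + Lp_int M p b) \<le> t * (p * \<delta> / 8)"
      using t by (simp add: mult_left_mono mult.assoc)
    then have "Lp_int M p s' \<le> Lp_int M p s - (5/8) * (t * p * \<delta>)"
      using 1 3 by (simp add: algebra_simps)
    moreover have "t * p * \<delta> > 0" using t p0 \<delta> by simp
    ultimately show ?thesis using s(2) \<tau>(3) by argo
  qed
  ultimately show False by simp
qed

section \<open>Boundedness of weakly convergent sequences\<close>

lemma abs_suminf_le: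
  fixes a :: "nat \<Rightarrow> real"
  assumes "summable b" "\<And>i. \<bar>a i\<bar> \<le> b i"
  shows "\<bar>suminf a\<bar> \<le> suminf b"
proof -
  have s: "summable (\<lambda>i. \<bar>a i\<bar>)"
    by (rule summable_comparison_test'[OF assms(1)]) (use assms(2) in auto)
  have "\<bar>suminf a\<bar> \<le> (\<Sum>i. \<bar>a i\<bar>)" by (rule summable_rabs[OF s])
  also have "\<dots> \<le> suminf b" by (rule suminf_le[OF assms(2) s assms(1)])
  finally show ?thesis .
qed

text \<open>Uniform boundedness by a gliding hump: the signs in \<open>\<Sum> \<plusminus> 3\<^sup>-\<^sup>j \<Lambda> j\<close> are chosen so that no
  cancellation occurs at the \<open>j\<close>-th step.\<close>

lemma weakly_convergent_imp_bounded:
  fixes u :: "nat \<Rightarrow> 'a \<Rightarrow> 'b::real_vector"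
  assumes w: "weakly_convergent_to V N u u0"
    and N': "\<And>v. v \<in> V \<Longrightarrow> 0 \<le> N' v" "\<And>v. v \<in> V \<Longrightarrow> N' v \<le> N v"
    and norming: "\<And>k. \<exists>\<Lambda>. bounded_functional V N \<Lambda> \<and> (\<forall>v\<in>V. \<bar>\<Lambda> v\<bar> \<le> N' v) \<and> \<Lambda> (u k) = N' (u k)"
  shows "\<exists>C. \<forall>k. N' (u k) \<le> C"
proof (rule ccontr)
  assume "\<not> ?thesis"
  \<comment> \<open>Growth \<open>6 ^ j\<close> is set against the weights \<open>(1/3)^j\<close> of
    the series: the product \<open>2 ^ j\<close> is still unbounded.\<close>
  then have "\<exists>k. N' (u k) > 6 ^ j" for j :: nat by (meson not_le)
  then obtain k where k: "\<And>j. N' (u (k j)) > 6 ^ j" by metis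
  obtain \<Lambda>0 where \<Lambda>0: "\<And>i. bounded_functional V N (\<Lambda>0 i)" "\<And>i v. v \<in> V \<Longrightarrow> \<bar>\<Lambda>0 i v\<bar> \<le> N' v"
    "\<And>i. \<Lambda>0 i (u i) = N' (u i)" using norming by metis
  define y where "y j = u (k j)" for j
  define \<Lambda> where "\<Lambda> j = \<Lambda>0 (k j)" for j
  have y: "y j \<in> V" for j using w by (simp add: y_def weakly_convergent_to_def)
  have \<Lambda>: "bounded_functional V N (\<Lambda> j)" "\<And>v. v \<in> V \<Longrightarrow> \<bar>\<Lambda> j v\<bar> \<le> N' v" "\<Lambda> j (y j) = N' (y j)" for j
    using \<Lambda>0 by (auto simp: \<Lambda>_def y_def)
  have \<Lambda>add: "\<Lambda> j (\<lambda>x. f x + g x) = \<Lambda> j f + \<Lambda> j g" if "f \<in> V" "g \<in> V" for j f g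
    using \<Lambda>(1) that by (auto simp: bounded_functional_def)
  have \<Lambda>scale: "\<Lambda> j (\<lambda>x. c *\<^sub>R f x) = c * \<Lambda> j f" if "f \<in> V" for j f c
    using \<Lambda>(1) that by (auto simp: bounded_functional_def)
  \<comment> \<open>\<open>S j\<close> is the partial sum of the first \<open>j\<close> terms. The
    recursion runs over functionals because the next sign depends on the value of the partial sum at
    \<open>y j\<close>.\<close>
  define S where "S = rec_nat (\<lambda>_. 0) (\<lambda>j T v. T v + (if T (y j) \<ge> 0 then 1 else -1) * (1/3)^j * \<Lambda> j v)"
  define \<sigma> :: "nat \<Rightarrow> real" where "\<sigma> j = (if S j (y j) \<ge> 0 then 1 else -1)" for j
  have S0: "S 0 v = 0" and SS: "S (Suc j) v = S j v + \<sigma> j * (1/3)^j * \<Lambda> j v" for j v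
    by (auto simp: S_def \<sigma>_def)
  have S: "S j v = (\<Sum>i<j. \<sigma> i * (1/3)^i * \<Lambda> i v)" for j v
    by (induction j) (auto simp: S0 SS)
  have \<sigma>: "\<bar>\<sigma> j\<bar> = 1" for j by (simp add: \<sigma>_def)
  define a where "a v i = \<sigma> i * (1/3)^i * \<Lambda> i v" for v i
  have ab: "norm (a v i) \<le> (1/3)^i * N' v" if "v \<in> V" for v i
    using \<Lambda>(2)[OF that, of i] by (simp add: a_def abs_mult \<sigma> mult_left_mono)
  have geo: "summable (\<lambda>i. (1/3::real)^i * c)" for c
    by (intro summable_mult2 summable_geometric) auto
  have sa: "summable (a v)" if "v \<in> V" for v
    by (rule summable_comparison_test'[OF geo]) (use ab[OF that] in auto)
  define \<Phi> where "\<Phi> v = suminf (a v)" for v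
  have \<Phi>: "bounded_functional V N \<Phi>"
    unfolding bounded_functional_def
  proof (intro conjI ballI allI exI)
    fix f g assume "f \<in> V" "g \<in> V"
    then show "\<Phi> (\<lambda>x. f x + g x) = \<Phi> f + \<Phi> g"
      unfolding \<Phi>_def suminf_add[OF sa[OF \<open>f \<in> V\<close>] sa[OF \<open>g \<in> V\<close>]]
      by (intro arg_cong[of _ _ suminf]) (auto simp: a_def \<Lambda>add algebra_simps)
  next
    fix f c assume "f \<in> V"
    then show "\<Phi> (\<lambda>x. c *\<^sub>R f x) = c * \<Phi> f"
      unfolding \<Phi>_def suminf_mult[OF sa[OF \<open>f \<in> V\<close>], symmetric]
      by (intro arg_cong[of _ _ suminf]) (auto simp: a_def \<Lambda>scale algebra_simps)
  next
    fix f assume f: "f \<in> V"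
    have "\<bar>\<Phi> f\<bar> \<le> (\<Sum>i. (1/3)^i * N' f)"
      unfolding \<Phi>_def using abs_suminf_le[OF geo] ab[OF f] by simp
    also have "\<dots> = (3/2) * N' f"
      using suminf_geometric[of "1/3::real"] by (simp add: suminf_mult2[symmetric])
    also have "\<dots> \<le> (3/2) * N f" using N'(2)[OF f] by simp
    finally show "\<bar>\<Phi> f\<bar> \<le> (3/2) * N f" .
  qed
  then have "(\<lambda>i. \<Phi> (u i)) \<longlonglongrightarrow> \<Phi> u0" using w by (auto simp: weakly_convergent_to_def)
  then obtain B where B: "\<And>i. \<bar>\<Phi> (u i)\<bar> \<le> B"
    using convergent_imp_Bseq[OF convergentI] by (metis BseqE real_norm_def)
  have low: "2 ^ j / 2 \<le> \<bar>\<Phi> (y j)\<bar>" for j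
  proof -
    have N0: "N' (y j) \<ge> 6 ^ j" using k[of j] by (simp add: y_def)
    have "\<Phi> (y j) = (\<Sum>i. a (y j) (i + Suc j)) + S (Suc j) (y j)"
      using suminf_split_initial_segment[OF sa[OF y], of j "Suc j"]
      unfolding \<Phi>_def S a_def[symmetric] by simp
    moreover have "\<bar>S (Suc j) (y j)\<bar> = \<bar>S j (y j)\<bar> + (1/3)^j * N' (y j)"
    proof -
      have "0 \<le> (1/3)^j * N' (y j)" using N'(1)[OF y] by simp
      then show ?thesis by (auto simp: SS \<Lambda>(3) \<sigma>_def)
    qed
    \<comment> \<open>The weights after the \<open>j\<close>-th add up to half of the
      \<open>j\<close>-th one, so the tail cancels at most half of the term gained at step
      \<open>j\<close>.\<close>
    moreover have "\<bar>\<Sum>i. a (y j) (i + Suc j)\<bar> \<le> (1/3)^j * N' (y j) / 2"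
    proof -
      have "\<bar>\<Sum>i. a (y j) (i + Suc j)\<bar> \<le> (\<Sum>i. (1/3)^i * ((1/3)^Suc j * N' (y j)))"
      proof (rule abs_suminf_le[OF geo])
        show "\<bar>a (y j) (i + Suc j)\<bar> \<le> (1/3)^i * ((1/3)^Suc j * N' (y j))" for i
          using ab[OF y, of j "i + Suc j"] by (simp only: power_add real_norm_def mult.assoc)
      qed
      also have "\<dots> = (3/2) * ((1/3)^Suc j * N' (y j))"
        using suminf_geometric[of "1/3::real"] summable_geometric[of "1/3::real"]
        by (subst suminf_mult2[symmetric]) auto
      finally show ?thesis by (simp add: mult.commute)
    qed
    ultimately have "\<bar>\<Phi> (y j)\<bar> \<ge> (1/3)^j * N' (y j) / 2" by linarith
    moreover have "(1/3)^j * N' (y j) \<ge> (1/3)^j * 6 ^ j" using N0 by (intro mult_left_mono) auto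
    moreover have "(1/3)^j * 6 ^ j = (2::real) ^ j" by (simp flip: power_mult_distrib)
    ultimately show ?thesis by linarith
  qed
  obtain j where "2 * B < 2 ^ j" using real_arch_pow[of 2 "2 * B"] by auto
  then show False using low[of j] B[of "k j"] by (simp add: y_def)
qed

subsection \<open>Affine changes of variables\<close>

lemma affine_measurable_lebesgue:
  fixes x0 :: "'a::euclidean_space"
  assumes "r \<noteq> 0"
  shows "(\<lambda>y. x0 + r *\<^sub>R y) \<in> lebesgue \<rightarrow>\<^sub>M lebesgue"
  using lebesgue_affine_measurable[of "\<lambda>_. r" x0] assms
  unfolding scaleR_scaleR[symmetric] scaleR_sum_right[symmetric] euclidean_representation by simp

lemma lebesgue_affine:
  fixes x0 :: "'a::euclidean_space"
  assumes "r \<noteq> 0"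
  shows "(lebesgue :: 'a measure) =
    density (distr lebesgue lebesgue (\<lambda>y. x0 + r *\<^sub>R y)) (\<lambda>_. ennreal (\<bar>r\<bar> ^ DIM('a)))"
  using lebesgue_affine_euclidean[of "\<lambda>_. r" x0] assms
  unfolding scaleR_scaleR[symmetric] scaleR_sum_right[symmetric] euclidean_representation prod_constant by simp

lemma nn_integral_affine:
  fixes h :: "'a::euclidean_space \<Rightarrow> ennreal"
  assumes "r \<noteq> 0" "h \<in> borel_measurable lebesgue"
  shows "(\<integral>\<^sup>+x. h x \<partial>lebesgue) = ennreal (\<bar>r\<bar> ^ DIM('a)) * (\<integral>\<^sup>+y. h (x0 + r *\<^sub>R y) \<partial>lebesgue)"
proof -
  note [measurable] = affine_measurable_lebesgue[OF assms(1), of x0] assms(2)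
  show ?thesis
    by (subst lebesgue_affine[OF assms(1), of x0])
      (simp add: nn_integral_density nn_integral_distr nn_integral_cmult)
qed

lemma integral_affine:
  fixes h :: "'a::euclidean_space \<Rightarrow> 'b::euclidean_space"
  assumes "r \<noteq> 0" "h \<in> borel_measurable lebesgue"
  shows "integrable lebesgue (\<lambda>y. h (x0 + r *\<^sub>R y)) \<longleftrightarrow> integrable lebesgue h"
    and "(\<integral>x. h x \<partial>lebesgue) = \<bar>r\<bar> ^ DIM('a) *\<^sub>R (\<integral>y. h (x0 + r *\<^sub>R y) \<partial>lebesgue)"
proof -
  note [measurable] = affine_measurable_lebesgue[OF assms(1), of x0] assms(2)
  show "integrable lebesgue (\<lambda>y. h (x0 + r *\<^sub>R y)) \<longleftrightarrow> integrable lebesgue h"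
  proof -
    have "integrable lebesgue h \<longleftrightarrow> integrable lebesgue (\<lambda>y. \<bar>r\<bar> ^ DIM('a) *\<^sub>R h (x0 + r *\<^sub>R y))"
      by (subst lebesgue_affine[OF assms(1), of x0]) (simp add: integrable_density integrable_distr_eq)
    also have "\<dots> \<longleftrightarrow> integrable lebesgue (\<lambda>y. h (x0 + r *\<^sub>R y))"
      using integrable_scaleR_right[of "1 / \<bar>r\<bar> ^ DIM('a)" lebesgue "\<lambda>y. \<bar>r\<bar> ^ DIM('a) *\<^sub>R h (x0 + r *\<^sub>R y)"]
        assms(1) by auto
    finally show ?thesis by simp
  qed
  show "(\<integral>x. h x \<partial>lebesgue) = \<bar>r\<bar> ^ DIM('a) *\<^sub>R (\<integral>y. h (x0 + r *\<^sub>R y) \<partial>lebesgue)"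
    by (subst lebesgue_affine[OF assms(1), of x0])
      (simp add: integral_density integral_distr)
qed

lemma AE_affine:
  fixes x0 :: "'a::euclidean_space"
  assumes "r \<noteq> 0" "AE x in lebesgue. P x"
  shows "AE y in lebesgue. P (x0 + r *\<^sub>R y)"
proof -
  obtain N where N: "N \<in> null_sets lebesgue" "{x. \<not> P x} \<subseteq> N"
    using assms(2) unfolding eventually_ae_filter by auto
  note [measurable] = affine_measurable_lebesgue[OF assms(1), of x0]
  have [measurable]: "N \<in> sets lebesgue" using N by auto
  have "0 = emeasure lebesgue N" using null_setsD1[OF N(1)] by (rule sym)
  also have "\<dots> = (\<integral>\<^sup>+x. indicator N x \<partial>lebesgue)"
    by (rule nn_integral_indicator[symmetric]) measurable
  also have "\<dots> = ennreal (\<bar>r\<bar> ^ DIM('a)) * (\<integral>\<^sup>+y. indicator N (x0 + r *\<^sub>R y) \<partial>lebesgue)"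
    by (rule nn_integral_affine[OF assms(1)]) measurable
  finally have "(\<integral>\<^sup>+y. indicator N (x0 + r *\<^sub>R y) \<partial>lebesgue) = 0"
    using zero_less_power[of "\<bar>r\<bar>" "DIM('a)"] assms(1) by (auto simp: ennreal_eq_0_iff not_le[symmetric])
  moreover have "(\<lambda>y. indicator N (x0 + r *\<^sub>R y) :: ennreal) \<in> borel_measurable lebesgue" by measurable
  ultimately have "AE y in lebesgue. indicator N (x0 + r *\<^sub>R y) = (0::ennreal)"
    by (simp add: nn_integral_0_iff_AE)
  then show ?thesis by eventually_elim (use N(2) in \<open>auto simp: indicator_def split: if_splits\<close>)
qed

lemma Lp_fun_affine:
  fixes f :: "'a::euclidean_space \<Rightarrow> 'b::euclidean_space"
  assumes f: "f \<in> Lp_fun (lebesgue_on \<omega>) p" and r: "r > 0" and "p \<ge> 0"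
    and [measurable]: "\<omega> \<in> sets lebesgue" "\<omega>' \<in> sets lebesgue"
    and sub: "\<And>y. y \<in> \<omega>' \<Longrightarrow> x0 + r *\<^sub>R y \<in> \<omega>"
  shows "(\<lambda>y. f (x0 + r *\<^sub>R y)) \<in> Lp_fun (lebesgue_on \<omega>') p"
    and "Lp_int (lebesgue_on \<omega>') p (\<lambda>y. f (x0 + r *\<^sub>R y)) \<le> Lp_int (lebesgue_on \<omega>) p f / r ^ DIM('a)"
proof -
  have r0: "r \<noteq> 0" using r by simp
  note T = affine_measurable_lebesgue[OF r0, of x0]
  have m: "(\<lambda>y. f (x0 + r *\<^sub>R y)) \<in> borel_measurable (lebesgue_on \<omega>')"
    by (rule measurable_compose[OF measurable_restrict_space3[OF T] Lp_funD(1)[OF f]]) (use sub in auto)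
  define h where "h x = indicator \<omega> x *\<^sub>R norm (f x) powr p" for x
  have ih: "integrable lebesgue h"
    using Lp_funD(2)[OF f] unfolding h_def by (simp add: integrable_restrict_space)
  have iT: "integrable lebesgue (\<lambda>y. h (x0 + r *\<^sub>R y))"
    using integral_affine(1)[OF r0, of h x0] ih by auto
  have le: "indicator \<omega>' y *\<^sub>R norm (f (x0 + r *\<^sub>R y)) powr p \<le> h (x0 + r *\<^sub>R y)" for y
    using sub by (auto simp: h_def indicator_def)
  have nn: "(\<lambda>y. indicator \<omega>' y *\<^sub>R norm (f (x0 + r *\<^sub>R y)) powr p) \<in> borel_measurable lebesgue"
    using m by (subst borel_measurable_restrict_space_iff[symmetric]) auto
  have i': "integrable lebesgue (\<lambda>y. indicator \<omega>' y *\<^sub>R norm (f (x0 + r *\<^sub>R y)) powr p)"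
    by (rule Bochner_Integration.integrable_bound[OF iT nn]) (use le in \<open>auto intro!: AE_I2 simp: h_def indicator_def\<close>)
  then show "(\<lambda>y. f (x0 + r *\<^sub>R y)) \<in> Lp_fun (lebesgue_on \<omega>') p"
    using m by (auto simp: Lp_fun_def integrable_restrict_space)
  have "Lp_int (lebesgue_on \<omega>') p (\<lambda>y. f (x0 + r *\<^sub>R y))
      = (\<integral>y. indicator \<omega>' y *\<^sub>R norm (f (x0 + r *\<^sub>R y)) powr p \<partial>lebesgue)"
    by (simp add: Lp_int_def integral_restrict_space)
  also have "\<dots> \<le> (\<integral>y. h (x0 + r *\<^sub>R y) \<partial>lebesgue)"
    by (rule integral_mono[OF i' iT le])
  also have "\<dots> = (\<integral>x. h x \<partial>lebesgue) / r ^ DIM('a)"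
    using integral_affine(2)[OF r0, of h x0] ih r by simp
  also have "(\<integral>x. h x \<partial>lebesgue) = Lp_int (lebesgue_on \<omega>) p f"
    by (simp add: Lp_int_def h_def integral_restrict_space)
  finally show "Lp_int (lebesgue_on \<omega>') p (\<lambda>y. f (x0 + r *\<^sub>R y)) \<le> Lp_int (lebesgue_on \<omega>) p f / r ^ DIM('a)" .
qed

subsection \<open>Weak convergence tested on a countable family of sets\<close>

lemma tendsto_0_approx:
  fixes f :: "nat \<Rightarrow> 'b::real_normed_vector"
  assumes "\<And>e. e > 0 \<Longrightarrow> \<exists>g. g \<longlonglongrightarrow> 0 \<and> (\<forall>m. norm (f m - g m) \<le> e)"
  shows "f \<longlonglongrightarrow> 0"
proof (rule LIMSEQ_I)
  fix e :: real assume e: "e > 0"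
  then obtain g where g: "g \<longlonglongrightarrow> 0" "\<And>m. norm (f m - g m) \<le> e / 2"
    using assms[of "e / 2"] by auto
  from LIMSEQ_D[OF g(1), of "e / 2"] e obtain N where N: "\<And>n. n \<ge> N \<Longrightarrow> norm (g n) < e / 2"
    by auto
  have "norm (f n - 0) < e" if "n \<ge> N" for n
    using norm_triangle_ineq[of "f n - g n" "g n"] g(2)[of n] N[OF that] by simp
  then show "\<exists>no. \<forall>n\<ge>no. norm (f n - 0) < e" by blast
qed

lemma Lp_fun_integrable:
  fixes f :: "'a \<Rightarrow> 'b::euclidean_space"
  assumes "finite_measure M" "f \<in> Lp_fun M p" "1 < p"
  shows "integrable M f"
proof -
  have pq: "1 < p / (p - 1)" "1 / p + 1 / (p / (p - 1)) = 1" using assms by (auto simp: field_simps)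
  have "integrable M (\<lambda>x. norm (f x) * norm (1::real))"
    by (rule Holder_inequality(1)[OF assms(2) Lp_fun_const[OF assms(1)] assms(3) pq])
  then show ?thesis
    using Lp_funD(1)[OF assms(2)] by (simp add: integrable_norm_iff)
qed

lemma Lp_fun_bounded:
  assumes "finite_measure M" "f \<in> borel_measurable M" "\<And>x. x \<in> space M \<Longrightarrow> norm (f x) \<le> B" "p \<ge> 0"
  shows "f \<in> Lp_fun M p"
  by (rule Lp_fun_bound(1)[OF Lp_fun_const[OF assms(1), of "B::real"] assms(2,4), of 1])
    (use assms(3) norm_ge_zero order_trans in fastforce)

lemma finite_measure_lebesgue_on: "\<omega> \<in> lmeasurable \<Longrightarrow> finite_measure (lebesgue_on \<omega>)"
  by (auto simp: fmeasurable_def intro!: finite_measureI simp: emeasure_restrict_space space_restrict_space)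

lemma Lp_int_tendsto_0:
  fixes g :: "nat \<Rightarrow> 'a \<Rightarrow> 'b::euclidean_space"
  assumes "\<And>i. g i \<in> borel_measurable M" "f \<in> borel_measurable M" "h \<in> Lp_fun M p" "p > 0"
    and lim: "AE x in M. (\<lambda>i. g i x) \<longlonglongrightarrow> f x"
    and dom: "\<And>i. AE x in M. norm (g i x - f x) \<le> norm (h x)"
  shows "(\<lambda>i. Lp_int M p (\<lambda>x. g i x - f x)) \<longlonglongrightarrow> 0"
proof -
  have "(\<lambda>i. \<integral>x. norm (g i x - f x) powr p \<partial>M) \<longlonglongrightarrow> (\<integral>x. 0 \<partial>M)"
  proof (rule integral_dominated_convergence[where w = "\<lambda>x. norm (h x) powr p"])
    show "integrable M (\<lambda>x. norm (h x) powr p)" by (rule Lp_funD(2)[OF assms(3)])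
    show "AE x in M. norm (norm (g i x - f x) powr p) \<le> norm (h x) powr p" for i
      using dom[of i] by eventually_elim (use assms(4) in \<open>auto intro: powr_mono2\<close>)
    show "AE x in M. (\<lambda>i. norm (g i x - f x) powr p) \<longlonglongrightarrow> 0"
      using lim
    proof eventually_elim
      fix x assume "(\<lambda>i. g i x) \<longlonglongrightarrow> f x"
      then have "(\<lambda>i. norm (g i x - f x)) \<longlonglongrightarrow> 0" by (simp add: LIM_zero tendsto_norm_zero)
      then show "(\<lambda>i. norm (g i x - f x) powr p) \<longlonglongrightarrow> 0"
        using tendsto_zero_powrI[OF _ tendsto_const, of "\<lambda>i. norm (g i x - f x)" sequentially p] assms(4) by simp
    qed
  qed (use assms(1,2) in measurable)
  then show ?thesis by (simp add: Lp_int_def)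
qed

text \<open>The test functions against which a bounded sequence tends to 0 form a closed set: by the
  Hoelder inequality the pairings depend on the test function uniformly in \<open>m\<close>.\<close>

lemma pairing_tendsto_0_closed:
  fixes f :: "nat \<Rightarrow> 'a \<Rightarrow> 'b::euclidean_space" and \<psi> :: "'a \<Rightarrow> real"
  assumes pq: "1 < p" "1 < q" "1 / p + 1 / q = 1"
    and f: "\<And>m. f m \<in> Lp_fun M p" "\<And>m. Lp_int M p (f m) \<le> K"
    and \<psi>: "\<And>i. \<psi>' i \<in> Lp_fun M q" "\<psi> \<in> Lp_fun M q"
    and lim: "(\<lambda>i. Lp_int M q (\<lambda>x. \<psi>' i x - \<psi> x)) \<longlonglongrightarrow> 0"
    and \<psi>': "\<And>i. (\<lambda>m. \<integral>x. \<psi>' i x *\<^sub>R f m x \<partial>M) \<longlonglongrightarrow> 0"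
  shows "(\<lambda>m. \<integral>x. \<psi> x *\<^sub>R f m x \<partial>M) \<longlonglongrightarrow> 0"
proof (rule tendsto_0_approx)
  fix e :: real assume e: "e > 0"
  have int: "integrable M (\<lambda>x. \<phi> x *\<^sub>R f m x)" if "\<phi> \<in> Lp_fun M q" for \<phi> :: "'a \<Rightarrow> real" and m
  proof -
    note [measurable] = Lp_funD(1)[OF that] Lp_funD(1)[OF f(1)]
    show ?thesis
      by (rule Bochner_Integration.integrable_bound[OF Holder_inequality(1)[OF that f(1)[of m] pq(2,1)]])
        (use pq in \<open>auto simp: add.commute\<close>)
  qed
  have K: "K \<ge> 0" using order_trans[OF Lp_int_nonneg f(2)[of 0]] .
  have "(\<lambda>i. K powr (1 / p) * Lp_int M q (\<lambda>x. \<psi>' i x - \<psi> x) powr (1 / q)) \<longlonglongrightarrow> K powr (1 / p) * 0"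
    by (intro tendsto_mult_left tendsto_zero_powrI[OF lim tendsto_const]) (use pq in auto)
  then have "\<forall>\<^sub>F i in sequentially. K powr (1 / p) * Lp_int M q (\<lambda>x. \<psi>' i x - \<psi> x) powr (1 / q) < e"
    using e by (intro order_tendstoD(2)) auto
  then obtain i where i: "K powr (1 / p) * Lp_int M q (\<lambda>x. \<psi>' i x - \<psi> x) powr (1 / q) < e"
    by (auto simp: eventually_sequentially)
  have "norm ((\<integral>x. \<psi> x *\<^sub>R f m x \<partial>M) - (\<integral>x. \<psi>' i x *\<^sub>R f m x \<partial>M)) \<le> e" for m
  proof -
    have d: "(\<lambda>x. \<psi> x - \<psi>' i x) \<in> Lp_fun M q" using pq by (intro Lp_fun_diff \<psi>) auto
    have "norm ((\<integral>x. \<psi> x *\<^sub>R f m x \<partial>M) - (\<integral>x. \<psi>' i x *\<^sub>R f m x \<partial>M))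
        = norm (\<integral>x. (\<psi> x - \<psi>' i x) *\<^sub>R f m x \<partial>M)"
      by (subst Bochner_Integration.integral_diff[symmetric]) (auto simp: int \<psi> algebra_simps)
    also have "\<dots> \<le> (\<integral>x. norm ((\<psi> x - \<psi>' i x) *\<^sub>R f m x) \<partial>M)" by (rule integral_norm_bound)
    also have "\<dots> = (\<integral>x. norm (f m x) * norm (\<psi> x - \<psi>' i x) \<partial>M)" by (simp add: mult.commute)
    also have "\<dots> \<le> Lp_int M p (f m) powr (1 / p) * Lp_int M q (\<lambda>x. \<psi> x - \<psi>' i x) powr (1 / q)"
      by (rule Holder_inequality(2)[OF f(1) d pq])
    also have "\<dots> \<le> K powr (1 / p) * Lp_int M q (\<lambda>x. \<psi>' i x - \<psi> x) powr (1 / q)"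
      using pq f(2) by (intro mult_mono powr_mono2) (auto simp: Lp_int_diff_commute[of M q \<psi>])
    finally show ?thesis using i by simp
  qed
  then show "\<exists>g. g \<longlonglongrightarrow> 0 \<and> (\<forall>m. norm ((\<integral>x. \<psi> x *\<^sub>R f m x \<partial>M) - g m) \<le> e)"
    using \<psi>' by blast
qed

text \<open>Countability is what a diagonal choice can cope with. The family consists of the finite
  intersections of a countable base, which makes it stable for the Dynkin argument; the empty
  intersection contributes \<open>UNIV\<close>, which starts the treatment of complements.\<close>

lemma countable_generator_borel:
  obtains G :: "nat \<Rightarrow> 'a::second_countable_topology set"
  where "Int_stable (range G)" "UNIV \<in> range G" "sets borel = sigma_sets UNIV (range G)"
proof -
  obtain B :: "'a set set" where B: "countable B" "topological_basis B"
    using ex_countable_basis by blast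
  define H where "H = Inter ` {F. finite F \<and> F \<subseteq> B}"
  have H: "countable H" unfolding H_def using B(1) by (intro countable_image countable_Collect_finite_subset)
  have U: "UNIV \<in> H" unfolding H_def by (rule image_eqI[of _ _ "{}"]) auto
  have "Int_stable H"
  proof (rule Int_stableI)
    fix a b assume "a \<in> H" "b \<in> H"
    then obtain F F' where "finite F" "F \<subseteq> B" "a = \<Inter>F" "finite F'" "F' \<subseteq> B" "b = \<Inter>F'"
      by (auto simp: H_def)
    then show "a \<inter> b \<in> H" unfolding H_def by (intro image_eqI[of _ _ "F \<union> F'"]) auto
  qed
  moreover have "sets borel = sigma_sets UNIV H"
  proof -
    have "sets borel = sigma_sets UNIV B"
      unfolding borel_eq_countable_basis[OF B] by (rule sets_measure_of) simp
    moreover have "B \<subseteq> H" unfolding H_def by (auto intro!: image_eqI[of _ _ "{_}"])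
    moreover have "H \<subseteq> sigma_sets UNIV B"
    proof
      fix a assume "a \<in> H"
      then obtain F where F: "finite F" "F \<subseteq> B" "a = \<Inter>F" by (auto simp: H_def)
      have "open a" unfolding F(3) using F(1,2) topological_basis_open[OF B(2)] by (intro open_Inter) auto
      then have "a \<in> sets borel" by simp
      then show "a \<in> sigma_sets UNIV B" using \<open>sets borel = sigma_sets UNIV B\<close> by simp
    qed
    ultimately show ?thesis
      by (metis sigma_sets_mono sigma_sets_mono' subset_antisym)
  qed
  ultimately show ?thesis
    using that[of "from_nat_into H"] range_from_nat_into[OF _ H] U by fastforce
qed

text \<open>The class of admissible test functions grows from the generator to Borel sets by a
  Dynkin argument, to Lebesgue sets by null sets, to simple functions by linearity and to all of
  \<open>Lp_fun M q\<close> by density. \<open>pairing_tendsto_0_closed\<close> supplies the limit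
  passages.\<close>

lemma pairing_tendsto_0_generator:
  fixes f :: "nat \<Rightarrow> 'a::euclidean_space \<Rightarrow> 'b::euclidean_space" and \<psi> :: "'a \<Rightarrow> real"
  assumes pq: "1 < p" "1 < q" "1 / p + 1 / q = 1"
    and \<omega>: "\<omega> \<in> lmeasurable" and M: "M = lebesgue_on \<omega>"
    and G: "Int_stable G" "UNIV \<in> G" "sets borel = sigma_sets UNIV G"
    and f: "\<And>m. f m \<in> Lp_fun M p" "\<And>m. Lp_int M p (f m) \<le> K"
    and weak: "\<And>A. A \<in> G \<Longrightarrow> (\<lambda>m. \<integral>x. indicator A x *\<^sub>R f m x \<partial>M) \<longlonglongrightarrow> 0"
    and \<psi>: "\<psi> \<in> Lp_fun M q"
  shows "(\<lambda>m. \<integral>x. \<psi> x *\<^sub>R f m x \<partial>M) \<longlonglongrightarrow> 0"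
proof -
  have fm: "finite_measure M" unfolding M by (rule finite_measure_lebesgue_on[OF \<omega>])
  have spM: "space M = \<omega>" by (simp add: M space_restrict_space)
  have \<omega>s: "\<omega> \<in> sets lebesgue" using \<omega> by (simp add: fmeasurable_def)
  note [measurable] = Lp_funD(1)[OF f(1)] Lp_funD(1)[OF \<psi>]
  have int: "integrable M (f m)" for m by (rule Lp_fun_integrable[OF fm f(1) pq(1)])
  have leb: "(indicator A :: 'a \<Rightarrow> real) \<in> borel_measurable M" if "A \<in> sets lebesgue" for A :: "'a set"
    unfolding M using borel_measurable_indicator[OF that] by (rule measurable_restrict_space1)
  have bl: "A \<in> sets lebesgue" if "A \<in> sets borel" for A :: "'a set" using that by auto
  have inti: "integrable M (\<lambda>x. indicator A x *\<^sub>R f m x)" if "A \<in> sets lebesgue" for A m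
  proof (rule Bochner_Integration.integrable_bound[OF int[of m]])
    show "(\<lambda>x. indicator A x *\<^sub>R f m x) \<in> borel_measurable M"
      by (intro borel_measurable_scaleR leb that Lp_funD(1)[OF f(1)])
  qed (auto simp: indicator_def)
  have indL: "(indicator A :: 'a \<Rightarrow> real) \<in> Lp_fun M q" if "A \<in> sets lebesgue" for A :: "'a set"
    by (rule Lp_fun_bounded[OF fm leb[OF that], of 1]) (use pq in \<open>auto simp: indicator_def\<close>)
  have GP: "G \<subseteq> Pow UNIV" by simp
  have borel: "(\<lambda>m. \<integral>x. indicator A x *\<^sub>R f m x \<partial>M) \<longlonglongrightarrow> 0" if "A \<in> sets borel" for A
    using G(1) GP that[unfolded G(3)]
  proof (induction rule: sigma_sets_induct_disjoint)
    case (basic A) then show ?case by (rule weak)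
  next
    case empty show ?case by simp
  next
    case (compl A)
    have A: "A \<in> sets lebesgue" using compl(1) G(3) bl by blast
    have "(\<integral>x. indicator (UNIV - A) x *\<^sub>R f m x \<partial>M) =
        (\<integral>x. indicator UNIV x *\<^sub>R f m x \<partial>M) - (\<integral>x. indicator A x *\<^sub>R f m x \<partial>M)" for m
    proof -
      have "(\<integral>x. indicator (UNIV - A) x *\<^sub>R f m x \<partial>M) =
          (\<integral>x. indicator UNIV x *\<^sub>R f m x - indicator A x *\<^sub>R f m x \<partial>M)"
        by (intro Bochner_Integration.integral_cong) (auto simp: indicator_def)
      also have "\<dots> = (\<integral>x. indicator UNIV x *\<^sub>R f m x \<partial>M) - (\<integral>x. indicator A x *\<^sub>R f m x \<partial>M)"
        by (intro Bochner_Integration.integral_diff inti A) simp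
      finally show ?thesis .
    qed
    then show ?case using tendsto_diff[OF weak[OF G(2)] compl(2)] by simp
  next
    case (union A)
    have A: "A i \<in> sets lebesgue" for i using union(2) G(3) bl by blast
    \<comment> \<open>Linearity handles the finite unions \<open>B N\<close>; their indicators
      converge to that of the whole union by dominated convergence, so closedness applies.\<close>
    define B where "B N = (\<Union>i<N. A i)" for N
    have B: "B N \<in> sets lebesgue" for N unfolding B_def using A by auto
    have U: "(\<Union>i. A i) \<in> sets lebesgue" using A by auto
    show ?case
    proof (rule pairing_tendsto_0_closed[OF pq f indL[OF B] indL[OF U]])
      show "(\<lambda>i. Lp_int M q (\<lambda>x. indicator (B i) x - indicator (\<Union>i. A i) x :: real)) \<longlonglongrightarrow> 0"
      proof (rule Lp_int_tendsto_0[OF leb[OF B] leb[OF U] Lp_fun_const[OF fm, of "1::real"]])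
        have "(\<lambda>i. indicator (B i) x :: real) \<longlonglongrightarrow> indicator (\<Union>i. A i) x" for x
          unfolding B_def by (rule LIMSEQ_indicator_UN)
        then show "AE x in M. (\<lambda>i. indicator (B i) x :: real) \<longlonglongrightarrow> indicator (\<Union>i. A i) x" by simp
      qed (use pq in \<open>auto simp: indicator_def\<close>)
      show "(\<lambda>m. \<integral>x. indicator (B i) x *\<^sub>R f m x \<partial>M) \<longlonglongrightarrow> 0" for i
      proof -
        have "indicator (B i) x = (\<Sum>j<i. indicator (A j) x :: real)" for x
          unfolding B_def using union(1)
          by (intro indicator_UN_disjoint) (auto simp: disjoint_family_on_def)
        then have "(\<integral>x. indicator (B i) x *\<^sub>R f m x \<partial>M) = (\<integral>x. (\<Sum>j<i. indicator (A j) x *\<^sub>R f m x) \<partial>M)" for m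
          by (simp only: scaleR_sum_left)
        then have "(\<lambda>m. \<integral>x. indicator (B i) x *\<^sub>R f m x \<partial>M) = (\<lambda>m. \<integral>x. (\<Sum>j<i. indicator (A j) x *\<^sub>R f m x) \<partial>M)"
          by (rule ext)
        also have "(\<lambda>m. \<integral>x. (\<Sum>j<i. indicator (A j) x *\<^sub>R f m x) \<partial>M) =
            (\<lambda>m. \<Sum>j<i. \<integral>x. indicator (A j) x *\<^sub>R f m x \<partial>M)"
          by (intro ext Bochner_Integration.integral_sum inti A)
        also have "\<dots> \<longlonglongrightarrow> (\<Sum>j<i. 0)" by (intro tendsto_sum union(3))
        finally show ?thesis by simp
      qed
    qed
  qed
  have lebA: "(\<lambda>m. \<integral>x. indicator A x *\<^sub>R f m x \<partial>M) \<longlonglongrightarrow> 0" if "A \<in> sets lebesgue" for A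
  proof -
    \<comment> \<open>\<open>A\<close> differs from the measurable set \<open>S\<close> of
      \<open>lborel\<close> only inside a null set, which the integrals do not see.\<close>
    obtain S N N' where S: "A = S \<union> N" "S \<in> sets lborel" "N \<subseteq> N'" "N' \<in> null_sets lborel"
      using \<open>A \<in> sets lebesgue\<close> by (rule sets_completionE)
    have "AE x in lebesgue. x \<notin> N'"
      using S(4) by (intro AE_not_in) (auto simp: null_sets_completionI)
    then have "AE x in M. x \<notin> N'" unfolding M using \<omega>s by (simp add: AE_restrict_space_iff eventually_mono)
    then have ae: "AE x in M. indicator A x *\<^sub>R f m x = indicator S x *\<^sub>R f m x" for m
      by eventually_elim (use S in \<open>auto simp: indicator_def\<close>)
    have "(\<integral>x. indicator A x *\<^sub>R f m x \<partial>M) = (\<integral>x. indicator S x *\<^sub>R f m x \<partial>M)" for m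
      using inti[OF that, of m] inti[of S m] S(2) by (intro integral_cong_AE ae) auto
    then show ?thesis using borel[of S] S(2) by simp
  qed
  \<comment> \<open>The domination by \<open>2 * norm (\<psi> x)\<close> bounds the error by
    \<open>3 * norm (\<psi> x)\<close>, so pointwise convergence becomes convergence of
    \<open>Lp_int\<close>.\<close>
  obtain s where s: "\<And>i. simple_function M (s i)" "\<And>x. x \<in> space M \<Longrightarrow> (\<lambda>i. s i x) \<longlonglongrightarrow> \<psi> x"
    "\<And>i x. x \<in> space M \<Longrightarrow> norm (s i x) \<le> 2 * norm (\<psi> x)"
    using borel_measurable_implies_sequence_metric[OF Lp_funD(1)[OF \<psi>], of 0]
    unfolding dist_norm diff_zero by metis
  note [measurable] = borel_measurable_simple_function[OF s(1)]
  have sL: "s i \<in> Lp_fun M q" for i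
    by (rule Lp_fun_bound(1)[OF \<psi> _ _ s(3)]) (use pq in auto)
  show ?thesis
  proof (rule pairing_tendsto_0_closed[OF pq f sL \<psi>])
    show "(\<lambda>i. Lp_int M q (\<lambda>x. s i x - \<psi> x)) \<longlonglongrightarrow> 0"
    proof (rule Lp_int_tendsto_0[where h = "\<lambda>x. 3 *\<^sub>R \<psi> x"])
      show "AE x in M. norm (s i x - \<psi> x) \<le> norm (3 *\<^sub>R \<psi> x)" for i
      proof (intro AE_I2)
        fix x assume "x \<in> space M"
        from s(3)[OF this, of i] show "norm (s i x - \<psi> x) \<le> norm (3 *\<^sub>R \<psi> x)"
          using norm_triangle_ineq4[of "s i x" "\<psi> x"] unfolding norm_scaleR by simp
      qed
    qed (use s(2) pq Lp_fun_scaleR(1)[OF \<psi>] in auto)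
    show "(\<lambda>m. \<integral>x. s i x *\<^sub>R f m x \<partial>M) \<longlonglongrightarrow> 0" for i
    proof -
      define A where "A y = s i -` {y} \<inter> space M" for y
      have A: "A y \<in> sets lebesgue" for y
        using simple_functionD(2)[OF s(1), of i "{y}"] \<omega>s unfolding A_def M
        by (simp add: sets_restrict_space_iff)
      have fin: "finite (s i ` space M)" by (rule simple_functionD(1)[OF s(1)])
      have eq: "s i x = (\<Sum>y\<in>s i ` space M. y * indicator (A y) x)" if "x \<in> space M" for x
      proof -
        have "(\<Sum>y\<in>s i ` space M. y * indicator (A y) x) = (\<Sum>y\<in>s i ` space M. if y = s i x then y else 0)"
          using that by (intro sum.cong) (auto simp: A_def indicator_def)
        then show ?thesis using that fin by simp
      qed
      have "(\<integral>x. s i x *\<^sub>R f m x \<partial>M) = (\<integral>x. (\<Sum>y\<in>s i ` space M. y *\<^sub>R (indicator (A y) x *\<^sub>R f m x)) \<partial>M)" for m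
      proof (intro Bochner_Integration.integral_cong refl)
        fix x assume "x \<in> space M"
        from eq[OF this] show "s i x *\<^sub>R f m x = (\<Sum>y\<in>s i ` space M. y *\<^sub>R (indicator (A y) x *\<^sub>R f m x))"
          by (metis (mono_tags, lifting) scaleR_scaleR scaleR_sum_left sum.cong)
      qed
      then have "(\<lambda>m. \<integral>x. s i x *\<^sub>R f m x \<partial>M) =
          (\<lambda>m. \<integral>x. (\<Sum>y\<in>s i ` space M. y *\<^sub>R (indicator (A y) x *\<^sub>R f m x)) \<partial>M)"
        by (rule ext)
      also have "(\<lambda>m. \<integral>x. (\<Sum>y\<in>s i ` space M. y *\<^sub>R (indicator (A y) x *\<^sub>R f m x)) \<partial>M) =
          (\<lambda>m. \<Sum>y\<in>s i ` space M. y *\<^sub>R (\<integral>x. indicator (A y) x *\<^sub>R f m x \<partial>M))"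
        by (subst integral_scaleR_right[symmetric]) (intro ext Bochner_Integration.integral_sum integrable_scaleR_right inti A)
      also have "\<dots> \<longlonglongrightarrow> (\<Sum>y\<in>s i ` space M. y *\<^sub>R 0)"
        by (intro tendsto_sum tendsto_scaleR tendsto_const lebA A)
      finally show ?thesis by simp
    qed
  qed
qed

text \<open>Scalar test functions suffice: an inner product is the sum over \<open>Basis\<close> of
  components, each of them a component of a pairing with a scalar function.\<close>

lemma inner_pairing_tendsto_0:
  fixes f :: "nat \<Rightarrow> 'a \<Rightarrow> 'b::euclidean_space"
  assumes pq: "1 < p" "1 < q" "1 / p + 1 / q = 1"
    and f: "\<And>m. f m \<in> Lp_fun M p"
    and weak: "\<And>\<psi>::'a \<Rightarrow> real. \<psi> \<in> Lp_fun M q \<Longrightarrow> (\<lambda>m. \<integral>x. \<psi> x *\<^sub>R f m x \<partial>M) \<longlonglongrightarrow> 0"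
    and \<psi>: "\<psi> \<in> Lp_fun M q"
  shows "(\<lambda>m. \<integral>x. \<psi> x \<bullet> f m x \<partial>M) \<longlonglongrightarrow> 0"
proof -
  have comp: "(\<lambda>x. \<psi> x \<bullet> b) \<in> Lp_fun M q" for b
    using pq by (intro Lp_fun_linear[OF \<psi>] bounded_linear_inner_left) auto
  have int: "integrable M (\<lambda>x. (\<psi> x \<bullet> b) *\<^sub>R f m x)" for b m
  proof -
    note [measurable] = Lp_funD(1)[OF comp] Lp_funD(1)[OF f(1)]
    show ?thesis
      by (rule Bochner_Integration.integrable_bound[OF Holder_inequality(1)[OF comp[of b] f(1)[of m] pq(2,1)]])
        (use pq in \<open>auto simp: add.commute\<close>)
  qed
  have "(\<integral>x. \<psi> x \<bullet> f m x \<partial>M) = (\<Sum>b\<in>Basis. (\<integral>x. (\<psi> x \<bullet> b) *\<^sub>R f m x \<partial>M) \<bullet> b)" for m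
  proof -
    have "(\<integral>x. \<psi> x \<bullet> f m x \<partial>M) = (\<integral>x. (\<Sum>b\<in>Basis. ((\<psi> x \<bullet> b) *\<^sub>R f m x) \<bullet> b) \<partial>M)"
      by (intro Bochner_Integration.integral_cong refl) (subst euclidean_inner, simp)
    also have "\<dots> = (\<Sum>b\<in>Basis. \<integral>x. ((\<psi> x \<bullet> b) *\<^sub>R f m x) \<bullet> b \<partial>M)"
      by (intro Bochner_Integration.integral_sum integrable_inner_left int)
    also have "\<dots> = (\<Sum>b\<in>Basis. (\<integral>x. (\<psi> x \<bullet> b) *\<^sub>R f m x \<partial>M) \<bullet> b)"
      by (intro sum.cong refl integral_inner_left int)
    finally show ?thesis .
  qed
  moreover have "(\<lambda>m. \<Sum>b\<in>Basis. (\<integral>x. (\<psi> x \<bullet> b) *\<^sub>R f m x \<partial>M) \<bullet> b) \<longlonglongrightarrow> (\<Sum>b\<in>Basis. 0 \<bullet> (b::'b))"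
    by (intro tendsto_sum tendsto_inner weak comp tendsto_const)
  ultimately show ?thesis by simp
qed

subsection \<open>Density of continuous functions\<close>

text \<open>Measurability yields continuous functions converging almost everywhere, but without
  domination. A continuous truncation of the values provides it: \<open>f\<close> is compared with
  its truncation, and that with the truncated approximants.\<close>

lemma Lp_fun_continuous_approx:
  fixes f :: "'a::euclidean_space \<Rightarrow> 'b::euclidean_space"
  assumes \<omega>: "\<omega> \<in> lmeasurable" and f: "f \<in> Lp_fun (lebesgue_on \<omega>) p" and p: "p > 0" and e: "e > 0"
  obtains g where "continuous_on UNIV g" "g \<in> Lp_fun (lebesgue_on \<omega>) p" "Lp_int (lebesgue_on \<omega>) p (\<lambda>x. g x - f x) < e"
proof -
  let ?M = "lebesgue_on \<omega>"
  have fm: "finite_measure ?M" by (rule finite_measure_lebesgue_on[OF \<omega>])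
  have \<omega>s: "\<omega> \<in> sets lebesgue" using \<omega> by (simp add: fmeasurable_def)
  note [measurable] = Lp_funD(1)[OF f]
  have "f measurable_on \<omega>"
    using measurable_on_iff_borel_measurable[OF \<omega>s] Lp_funD(1)[OF f] by blast
  then obtain N g where N: "negligible N" and g: "\<And>n. continuous_on UNIV (g n)"
    "\<And>x. x \<notin> N \<Longrightarrow> (\<lambda>n. g n x) \<longlonglongrightarrow> (if x \<in> \<omega> then f x else 0)"
    unfolding measurable_on_def by blast
  have "AE x in lebesgue. x \<notin> N" using N by (intro AE_not_in) (simp add: negligible_iff_null_sets)
  then have ae: "AE x in ?M. (\<lambda>n. g n x) \<longlonglongrightarrow> f x"
    using \<omega>s g(2) by (auto simp: AE_restrict_space_iff elim!: eventually_mono) (metis (full_types))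
  \<comment> \<open>Radial retraction onto the ball of radius \<open>k + 1\<close>; the maximum
    keeps the denominator positive and the formula continuous.\<close>
  define c :: "nat \<Rightarrow> 'b \<Rightarrow> 'b" where "c k v = (real (Suc k) / max (real (Suc k)) (norm v)) *\<^sub>R v" for k v
  have c_cont: "continuous_on UNIV (c k)" for k
    unfolding c_def[abs_def] by (intro continuous_intros) (auto simp: max_def)
  have c_norm: "norm (c k v) \<le> real (Suc k)" "norm (c k v) \<le> norm v" for k v
  proof -
    have "norm (c k v) = min (real (Suc k)) (norm v)"
    proof (cases "norm v \<le> real (Suc k)")
      case False
      then have "norm v > 0" by (meson not_le of_nat_0_le_iff order_le_less_trans)
      then show ?thesis using False by (simp add: c_def max_def min_def)
    qed (simp add: c_def)
    then show "norm (c k v) \<le> real (Suc k)" "norm (c k v) \<le> norm v" by auto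
  qed
  have c_lim: "(\<lambda>k. c k v) \<longlonglongrightarrow> v" for v
  proof (rule tendsto_eventually)
    show "\<forall>\<^sub>F k in sequentially. c k v = v"
      using eventually_ge_at_top[of "nat \<lceil>norm v\<rceil>"]
      by eventually_elim (auto simp: c_def max_def; linarith)
  qed
  have c_meas: "(\<lambda>x. c k (h x)) \<in> borel_measurable ?M" if "h \<in> borel_measurable ?M" for k h
    by (rule measurable_compose[OF that borel_measurable_continuous_onI[OF c_cont]])
  have g_meas: "g n \<in> borel_measurable ?M" for n
    by (rule continuous_imp_measurable_on_sets_lebesgue[OF continuous_on_subset[OF g(1)] \<omega>s]) simp
  have lim1: "(\<lambda>k. Lp_int ?M p (\<lambda>x. c k (f x) - f x)) \<longlonglongrightarrow> 0"
  proof (rule Lp_int_tendsto_0[where h = "\<lambda>x. 2 *\<^sub>R f x"])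
    have "norm (c k (f x) - f x) \<le> norm (2 *\<^sub>R f x)" for k x
      using norm_triangle_ineq4[of "c k (f x)" "f x"] c_norm(2)[of k "f x"] by simp
    then show "AE x in ?M. norm (c k (f x) - f x) \<le> norm (2 *\<^sub>R f x)" for k by simp
  qed (use c_meas c_lim f p in \<open>auto intro: Lp_fun_scaleR\<close>)
  \<comment> \<open>Two errors of this size, combined with the factor \<open>2 powr p\<close> of the
    triangle inequality for \<open>Lp_int\<close>, amount to \<open>e\<close>.\<close>
  define \<epsilon> where "\<epsilon> = e / (2 * 2 powr p)"
  have \<epsilon>: "\<epsilon> > 0" using e by (simp add: \<epsilon>_def)
  obtain k where k: "Lp_int ?M p (\<lambda>x. c k (f x) - f x) < \<epsilon>"
    using order_tendstoD(2)[OF lim1 \<epsilon>] by (auto simp: eventually_sequentially)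
  have lim2: "(\<lambda>n. Lp_int ?M p (\<lambda>x. c k (g n x) - c k (f x))) \<longlonglongrightarrow> 0"
  proof (rule Lp_int_tendsto_0[where h = "\<lambda>x. 2 * real (Suc k)"])
    have "norm (c k (g n x) - c k (f x)) \<le> norm (2 * real (Suc k))" for n x
      using norm_triangle_ineq4[of "c k (g n x)" "c k (f x)"] c_norm(1)[of k "f x"] c_norm(1)[of k "g n x"] by simp
    then show "AE x in ?M. norm (c k (g n x) - c k (f x)) \<le> norm (2 * real (Suc k))" for n by simp
    show "AE x in ?M. (\<lambda>n. c k (g n x)) \<longlonglongrightarrow> c k (f x)"
      using ae by eventually_elim (rule continuous_on_tendsto_compose[OF c_cont], auto)
  qed (use c_meas g_meas fm p in \<open>auto intro: Lp_fun_const\<close>)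
  obtain n where n: "Lp_int ?M p (\<lambda>x. c k (g n x) - c k (f x)) < \<epsilon>"
    using order_tendstoD(2)[OF lim2 \<epsilon>] by (auto simp: eventually_sequentially)
  have L: "(\<lambda>x. c k (h x)) \<in> Lp_fun ?M p" if "h \<in> borel_measurable ?M" for h
    by (rule Lp_fun_bounded[OF fm c_meas[OF that] c_norm(1)]) (use p in auto)
  show ?thesis
  proof (rule that[of "\<lambda>x. c k (g n x)"])
    show "continuous_on UNIV (\<lambda>x. c k (g n x))"
      by (rule continuous_on_compose2[OF c_cont g(1)]) auto
    show "(\<lambda>x. c k (g n x)) \<in> Lp_fun ?M p" by (rule L[OF g_meas])
    have "Lp_int ?M p (\<lambda>x. c k (g n x) - f x) =
        Lp_int ?M p (\<lambda>x. (c k (g n x) - c k (f x)) + (c k (f x) - f x))" by simp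
    also have "\<dots> \<le> 2 powr p * (Lp_int ?M p (\<lambda>x. c k (g n x) - c k (f x)) + Lp_int ?M p (\<lambda>x. c k (f x) - f x))"
      using p by (intro Lp_fun_add(2) Lp_fun_diff L g_meas f) auto
    also have "\<dots> < 2 powr p * (\<epsilon> + \<epsilon>)" using k n by (intro mult_strict_left_mono) auto
    also have "\<dots> = e" by (simp add: \<epsilon>_def)
    finally show "Lp_int ?M p (\<lambda>x. c k (g n x) - f x) < e" .
  qed
qed

subsection \<open>Test functions\<close>

lemma smooth_times_differentiable: "smooth f \<Longrightarrow> times_differentiable m f"
  by (simp add: smooth_def)

lemma smooth_partial:
  assumes "smooth f" shows "smooth (partial k f)"
  unfolding smooth_def using smooth_times_differentiable[OF assms, of "Suc _"] by auto

lemma smooth_continuous: "smooth f \<Longrightarrow> continuous_on UNIV f"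
  using smooth_times_differentiable[of f 0] by simp

lemma smooth_has_derivative:
  assumes "smooth f"
  shows "(f has_derivative (\<lambda>h. grad f x \<bullet> h)) (at x)"
proof -
  have d: "(f has_derivative frechet_derivative f (at x)) (at x)"
    using smooth_times_differentiable[OF assms, of "Suc 0"] frechet_derivative_works by auto
  have "frechet_derivative f (at x) h = grad f x \<bullet> h" for h
  proof -
    have l: "linear (frechet_derivative f (at x))" using d has_derivative_linear by blast
    have "frechet_derivative f (at x) h = frechet_derivative f (at x) (\<Sum>k\<in>UNIV. h $ k *\<^sub>R axis k 1)"
      using basis_expansion[of h] by (simp add: scalar_mult_eq_scaleR)
    also have "\<dots> = (\<Sum>k\<in>UNIV. h $ k * partial k f x)"
      by (simp add: linear_sum[OF l] linear_scale[OF l] partial_def)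
    finally show ?thesis by (simp add: inner_vec_def grad_def mult.commute)
  qed
  then have "frechet_derivative f (at x) = (\<lambda>h. grad f x \<bullet> h)" by (rule ext)
  then show ?thesis using d by simp
qed

lemma grad_eqI:
  assumes "(f has_derivative (\<lambda>h. v \<bullet> h)) (at x)"
  shows "grad f x = v"
proof -
  have "frechet_derivative f (at x) = (\<lambda>h. v \<bullet> h)"
    using frechet_derivative_at[OF assms] by simp
  then show ?thesis by (simp add: vec_eq_iff grad_def partial_def inner_axis)
qed

lemma partial_eq_grad: "partial k f x = grad f x $ k"
  by (simp add: grad_def)

lemma continuous_grad: "smooth f \<Longrightarrow> continuous_on UNIV (grad f)"
  unfolding grad_def[abs_def] by (intro continuous_on_vec_lambda smooth_continuous smooth_partial)

lemma test_functionsD: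
  assumes "\<phi> \<in> test_functions \<omega>"
  shows "smooth \<phi>" "compact (closure {x. \<phi> x \<noteq> 0})" "closure {x. \<phi> x \<noteq> 0} \<subseteq> \<omega>"
  using assms by (auto simp: test_functions_def)

lemma test_function_outside_support:
  assumes "\<phi> \<in> test_functions \<omega>" "x \<notin> closure {x. \<phi> x \<noteq> 0}"
  shows "\<phi> x = 0" "grad \<phi> x = 0"
proof -
  have z: "\<phi> y = 0" if "y \<notin> closure {x. \<phi> x \<noteq> 0}" for y
    using closure_subset[of "{x. \<phi> x \<noteq> 0}"] that by blast
  show "\<phi> x = 0" by (rule z[OF assms(2)])
  have "((\<lambda>_. 0) has_derivative (\<lambda>h. 0 \<bullet> h)) (at x)" by simp
  then have "(\<phi> has_derivative (\<lambda>h. 0 \<bullet> h)) (at x)"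
  proof (rule has_derivative_transform_within_open)
    show "open (- closure {x. \<phi> x \<noteq> 0})" by (intro open_Compl closed_closure)
    show "x \<in> - closure {x. \<phi> x \<noteq> 0}" using assms(2) by (rule iffD2[OF Compl_iff])
    show "0 = \<phi> y" if "y \<in> - closure {x. \<phi> x \<noteq> 0}" for y
      by (rule z[symmetric]) (rule ComplD[OF that])
  qed
  then show "grad \<phi> x = 0" by (rule grad_eqI)
qed

lemma test_function_outside:
  assumes "\<phi> \<in> test_functions \<omega>" "x \<notin> \<omega>"
  shows "\<phi> x = 0" "grad \<phi> x = 0"
  using test_function_outside_support[OF assms(1)] test_functionsD(3)[OF assms(1)] assms(2) by blast+

lemma bounded_range_compact_support:
  fixes f :: "'a::euclidean_space \<Rightarrow> 'b::real_normed_vector"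
  assumes "continuous_on UNIV f" "compact K" "\<And>x. x \<notin> K \<Longrightarrow> f x = 0"
  obtains B where "B \<ge> 0" "\<And>x. norm (f x) \<le> B"
proof -
  have "compact (f ` K)"
    by (rule compact_continuous_image[OF continuous_on_subset[OF assms(1)] assms(2)]) simp
  then obtain B where B: "B > 0" "\<And>x. x \<in> K \<Longrightarrow> norm (f x) \<le> B"
    using compact_imp_bounded bounded_pos by (metis image_eqI)
  have "norm (f x) \<le> B" for x using B assms(3)[of x] by (cases "x \<in> K") auto
  with B(1) show ?thesis using that[of B] by simp
qed

lemma test_function_Lp:
  assumes \<phi>: "\<phi> \<in> test_functions \<omega>" and \<omega>: "\<omega>' \<in> lmeasurable" and "q > 0"
  shows "\<phi> \<in> Lp_fun (lebesgue_on \<omega>') q" "grad \<phi> \<in> Lp_fun (lebesgue_on \<omega>') q"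
proof -
  have s: "\<omega>' \<in> sets lebesgue" using \<omega> by (simp add: fmeasurable_def)
  note fm = finite_measure_lebesgue_on[OF \<omega>]
  note c = smooth_continuous[OF test_functionsD(1)[OF \<phi>]] continuous_grad[OF test_functionsD(1)[OF \<phi>]]
  have m: "\<phi> \<in> borel_measurable (lebesgue_on \<omega>')" "grad \<phi> \<in> borel_measurable (lebesgue_on \<omega>')"
    by (rule continuous_imp_measurable_on_sets_lebesgue[OF continuous_on_subset[OF c(1)] s], simp)
      (rule continuous_imp_measurable_on_sets_lebesgue[OF continuous_on_subset[OF c(2)] s], simp)
  obtain B where "\<And>x. norm (\<phi> x) \<le> B"
    using bounded_range_compact_support[OF c(1) test_functionsD(2)[OF \<phi>] test_function_outside_support(1)[OF \<phi>]]
    by blast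
  then show "\<phi> \<in> Lp_fun (lebesgue_on \<omega>') q" using assms(3) by (intro Lp_fun_bounded[OF fm m(1)]) auto
  obtain B where "\<And>x. norm (grad \<phi> x) \<le> B"
    using bounded_range_compact_support[OF c(2) test_functionsD(2)[OF \<phi>] test_function_outside_support(2)[OF \<phi>]]
    by blast
  then show "grad \<phi> \<in> Lp_fun (lebesgue_on \<omega>') q" using assms(3) by (intro Lp_fun_bounded[OF fm m(2)]) auto
qed

lemma times_differentiable_zero: "times_differentiable m (\<lambda>_ :: real ^ 'n. 0)"
proof (induction m)
  case (Suc m)
  have "partial k (\<lambda>_ :: real ^ 'n. 0) = (\<lambda>_. 0)" for k
    by (auto simp: partial_def frechet_derivative_const)
  then show ?case using Suc by simp
qed simp

text \<open>The factor \<open>c\<close> is carried through the induction because each derivative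
  contributes a further factor \<open>s\<close>.\<close>

lemma times_differentiable_affine:
  "times_differentiable m f \<Longrightarrow> times_differentiable m (\<lambda>x. c * f (a + s *\<^sub>R x))"
proof (induction m arbitrary: f c)
  case 0
  then have "continuous_on UNIV f" by simp
  then have "continuous_on UNIV (\<lambda>x. f (a + s *\<^sub>R x))"
    by (rule continuous_on_compose2) (auto intro!: continuous_intros)
  then show ?case by (simp add: continuous_on_mult_left)
next
  case (Suc m)
  have d: "((\<lambda>x. c * f (a + s *\<^sub>R x)) has_derivative
      (\<lambda>h. c * frechet_derivative f (at (a + s *\<^sub>R x)) (s *\<^sub>R h))) (at x)" for x
  proof -
    have "(f has_derivative frechet_derivative f (at (a + s *\<^sub>R x))) (at (a + s *\<^sub>R x))"
      using Suc.prems frechet_derivative_works by auto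
    moreover have "((\<lambda>x. a + s *\<^sub>R x) has_derivative (\<lambda>h. s *\<^sub>R h)) (at x)"
      by (auto intro!: derivative_eq_intros)
    ultimately have "((\<lambda>x. f (a + s *\<^sub>R x)) has_derivative
        (\<lambda>h. frechet_derivative f (at (a + s *\<^sub>R x)) (s *\<^sub>R h))) (at x)"
      using has_derivative_compose by blast
    then show ?thesis by (rule has_derivative_mult_right)
  qed
  have "partial k (\<lambda>x. c * f (a + s *\<^sub>R x)) = (\<lambda>x. (c * s) * partial k f (a + s *\<^sub>R x))" for k
  proof
    fix x
    have l: "linear (frechet_derivative f (at (a + s *\<^sub>R x)))"
      using Suc.prems linear_frechet_derivative by auto
    show "partial k (\<lambda>x. c * f (a + s *\<^sub>R x)) x = (c * s) * partial k f (a + s *\<^sub>R x)"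
      using frechet_derivative_at[OF d, of x, symmetric]
      by (simp add: partial_def linear_scale[OF l])
  qed
  then show ?case
    using Suc.IH[of "partial _ f" "c * s"] Suc.prems differentiableI[OF d]
    unfolding times_differentiable.simps by simp
qed

lemma grad_affine:
  assumes "smooth f"
  shows "grad (\<lambda>x. c * f (a + s *\<^sub>R x)) x = (c * s) *\<^sub>R grad f (a + s *\<^sub>R x)"
proof (rule grad_eqI)
  have "((\<lambda>x. a + s *\<^sub>R x) has_derivative (\<lambda>h. s *\<^sub>R h)) (at x)"
    by (auto intro!: derivative_eq_intros)
  from has_derivative_compose[OF this smooth_has_derivative[OF assms]]
  have "((\<lambda>x. c * f (a + s *\<^sub>R x)) has_derivative (\<lambda>h. c * (grad f (a + s *\<^sub>R x) \<bullet> (s *\<^sub>R h)))) (at x)"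
    by (rule has_derivative_mult_right)
  then show "((\<lambda>x. c * f (a + s *\<^sub>R x)) has_derivative (\<lambda>h. ((c * s) *\<^sub>R grad f (a + s *\<^sub>R x)) \<bullet> h)) (at x)"
    by (simp add: mult.assoc)
qed

text \<open>The argument of \<open>\<phi>\<close> is the inverse of
  \<open>y \<mapsto> x0 + r y\<close>. The support of the new function lies in the image of the old
  support under the forward map, a compact subset of \<omega>.\<close>

lemma test_function_affine:
  assumes \<phi>: "\<phi> \<in> test_functions \<omega>'" and r: "r \<noteq> 0"
    and sub: "\<And>y. y \<in> \<omega>' \<Longrightarrow> x0 + r *\<^sub>R y \<in> \<omega>"
  shows "(\<lambda>x. c * \<phi> (- (1 / r) *\<^sub>R x0 + (1 / r) *\<^sub>R x)) \<in> test_functions \<omega>"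
proof -
  let ?f = "\<lambda>x. c * \<phi> (- (1 / r) *\<^sub>R x0 + (1 / r) *\<^sub>R x)"
  let ?K = "(\<lambda>y. x0 + r *\<^sub>R y) ` closure {x. \<phi> x \<noteq> 0}"
  have K: "compact ?K"
    by (rule compact_continuous_image[OF _ test_functionsD(2)[OF \<phi>]]) (auto intro!: continuous_intros)
  have "x \<in> ?K" if fx: "?f x \<noteq> 0" for x
  proof (rule image_eqI)
    define z where "z = - (1 / r) *\<^sub>R x0 + (1 / r) *\<^sub>R x"
    show "x = x0 + r *\<^sub>R z" unfolding z_def scaleR_add_right scaleR_scaleR using r by simp
    have "\<phi> z \<noteq> 0" using fx unfolding z_def[symmetric] by (metis mult_zero_right)
    then have "z \<in> {x. \<phi> x \<noteq> 0}" by (rule CollectI)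
    then show "z \<in> closure {x. \<phi> x \<noteq> 0}" by (rule subsetD[OF closure_subset])
  qed
  then have "{x. ?f x \<noteq> 0} \<subseteq> ?K" by blast
  then have cl: "closure {x. ?f x \<noteq> 0} \<subseteq> ?K"
    by (rule closure_minimal[OF _ compact_imp_closed[OF K]])
  have comp: "compact (closure {x. ?f x \<noteq> 0})"
    using compact_Int_closed[OF K closed_closure, of "{x. ?f x \<noteq> 0}"] unfolding Int_absorb1[OF cl] .
  have "?K \<subseteq> \<omega>" using test_functionsD(3)[OF \<phi>] sub by blast
  with cl have supp: "closure {x. ?f x \<noteq> 0} \<subseteq> \<omega>" by (rule order_trans)
  have "smooth ?f"
    unfolding smooth_def
    by (rule allI) (rule times_differentiable_affine[of _ \<phi> c "- (1 / r) *\<^sub>R x0" "1 / r",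
      OF smooth_times_differentiable[OF test_functionsD(1)[OF \<phi>]]])
  with comp supp show ?thesis unfolding test_functions_def by (intro CollectI conjI)
qed

lemma test_function_scale:
  assumes "\<phi> \<in> test_functions \<omega>"
  shows "(\<lambda>x. c * \<phi> x) \<in> test_functions \<omega>" "grad (\<lambda>x. c * \<phi> x) x = c *\<^sub>R grad \<phi> x"
  using test_function_affine[OF assms, of 1 0 \<omega> c] grad_affine[OF test_functionsD(1)[OF assms], of c 0 1 x]
  by auto

text \<open>The difference quotients of \<open>h\<close> have integral 0 by translation invariance.\<close>

lemma integral_derivative_eq_0:
  fixes h :: "'a::euclidean_space \<Rightarrow> real"
  assumes h: "\<And>x. (h has_derivative (\<lambda>v. g x \<bullet> v)) (at x)"
    and g: "continuous_on UNIV g"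
    and K: "compact K" "\<And>x. x \<notin> K \<Longrightarrow> h x = 0" "\<And>x. x \<notin> K \<Longrightarrow> g x = 0"
  shows "(\<integral>x. g x \<bullet> e \<partial>lebesgue) = 0"
proof -
  have hc: "continuous_on UNIV h"
    by (intro continuous_at_imp_continuous_on ballI has_derivative_continuous[OF h])
  have hm[measurable]: "h \<in> borel_measurable lebesgue"
    using continuous_imp_measurable_on_sets_lebesgue[OF hc] by simp
  have gm[measurable]: "(\<lambda>x. g x \<bullet> e) \<in> borel_measurable lebesgue"
    using continuous_imp_measurable_on_sets_lebesgue[of UNIV "\<lambda>x. g x \<bullet> e"] g
    by (simp add: continuous_on_inner continuous_on_const)
  obtain B where B: "B \<ge> 0" "\<And>x. norm (g x) \<le> B"
    using bounded_range_compact_support[OF g K(1,3)] by blast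
  obtain A where A: "A \<ge> 0" "\<And>x. norm (h x) \<le> A"
    using bounded_range_compact_support[OF hc K(1,2)] by blast
  obtain R where R: "\<And>x. x \<in> K \<Longrightarrow> norm x \<le> R"
    using compact_imp_bounded[OF K(1)] by (auto simp: bounded_iff)
  \<comment> \<open>Enlarging the radius by \<open>norm e\<close> makes one ball contain the
    supports of all difference quotients, whose shifts are at most \<open>norm e\<close>
    long.\<close>
  define Q where "Q = cball (0::'a) (R + norm e)"
  have iQ: "integrable lebesgue (\<lambda>x. indicator Q x * c)" for c :: real
  proof -
    have "Q \<in> lmeasurable" unfolding Q_def by (rule lmeasurable_cball)
    then show ?thesis by (intro integrable_mult_left integrable_real_indicator) (auto simp: fmeasurable_def)
  qed
  have ih: "integrable lebesgue h"
  proof (rule Bochner_Integration.integrable_bound[OF iQ[of A]])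
    show "AE x in lebesgue. norm (h x) \<le> norm (indicator Q x * A)"
    proof (intro AE_I2)
      fix x show "norm (h x) \<le> norm (indicator Q x * A)"
      proof (cases "x \<in> K")
        case True
        then have "x \<in> Q" using R[of x] norm_ge_zero[of e] by (simp add: Q_def add_increasing2)
        then show ?thesis using A by simp
      qed (simp add: K(2))
    qed
  qed (rule hm)
  \<comment> \<open>The redundant factor 1 gives the shifted argument the shape of
    \<open>integral_affine\<close> with ratio 1.\<close>
  define D where "D n x = real (Suc n) * (h ((1 / real (Suc n)) *\<^sub>R e + 1 *\<^sub>R x) - h x)" for n x
  note tr = integral_affine[of 1 h, OF _ hm]
  have iT: "integrable lebesgue (\<lambda>x. h (a + 1 *\<^sub>R x))" for a using tr(1) ih by simp
  have D0: "(\<integral>x. D n x \<partial>lebesgue) = 0" for n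
  proof -
    have "(\<integral>x. h ((1 / real (Suc n)) *\<^sub>R e + 1 *\<^sub>R x) \<partial>lebesgue) = (\<integral>x. h x \<partial>lebesgue)"
      using tr(2)[of "(1 / real (Suc n)) *\<^sub>R e"] by simp
    then show ?thesis unfolding D_def using ih iT[of "(1 / real (Suc n)) *\<^sub>R e"] by simp
  qed
  have Dm: "D n \<in> borel_measurable lebesgue" for n
    unfolding D_def using borel_measurable_integrable[OF iT] by measurable
  have "(\<lambda>n. \<integral>x. D n x \<partial>lebesgue) \<longlonglongrightarrow> (\<integral>x. g x \<bullet> e \<partial>lebesgue)"
  proof (rule integral_dominated_convergence[OF gm Dm iQ[of "B * norm e"]])
    show "AE x in lebesgue. (\<lambda>n. D n x) \<longlonglongrightarrow> g x \<bullet> e"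
    proof (intro AE_I2)
      fix x
      have "((\<lambda>t. x + t *\<^sub>R e) has_derivative (\<lambda>t. t *\<^sub>R e)) (at 0)"
        by (auto intro!: derivative_eq_intros)
      moreover have "(h has_derivative (\<lambda>v. g x \<bullet> v)) (at (x + 0 *\<^sub>R e))" using h[of x] by simp
      ultimately have "((\<lambda>t. h (x + t *\<^sub>R e)) has_derivative (\<lambda>t. g x \<bullet> (t *\<^sub>R e))) (at 0)"
        by (rule has_derivative_compose)
      moreover have "(\<lambda>t. g x \<bullet> (t *\<^sub>R e)) = (*) (g x \<bullet> e)" by auto
      ultimately have "((\<lambda>t. h (x + t *\<^sub>R e)) has_field_derivative g x \<bullet> e) (at 0)"
        by (simp only: has_field_derivative_def)
      then have "(\<lambda>t. (h (x + t *\<^sub>R e) - h x) / t) \<midarrow>0\<rightarrow> g x \<bullet> e"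
        by (simp add: has_field_derivative_iff)
      moreover have "(\<lambda>n. 1 / real (Suc n)) \<longlonglongrightarrow> 0"
        using LIMSEQ_inverse_real_of_nat by (simp add: inverse_eq_divide)
      ultimately have "(\<lambda>n. (h (x + (1 / real (Suc n)) *\<^sub>R e) - h x) / (1 / real (Suc n))) \<longlonglongrightarrow> g x \<bullet> e"
        using LIMSEQ_SEQ_conv[of 0 "\<lambda>t. (h (x + t *\<^sub>R e) - h x) / t" "g x \<bullet> e"]
        by (auto dest!: spec[of _ "\<lambda>n. 1 / real (Suc n)"] simp del: of_nat_Suc)
      then show "(\<lambda>n. D n x) \<longlonglongrightarrow> g x \<bullet> e"
        by (simp add: D_def add.commute mult.commute)
    qed
    fix n
    show "AE x in lebesgue. norm (D n x) \<le> indicator Q x * (B * norm e)"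
    proof (intro AE_I2)
      fix x
      define t where "t = 1 / real (Suc n)"
      have t: "0 < t" "t \<le> 1" by (auto simp: t_def)
      have te: "norm (t *\<^sub>R e) \<le> norm e" using t by (simp add: mult_left_le_one_le)
      show "norm (D n x) \<le> indicator Q x * (B * norm e)"
      proof (cases "x \<in> Q")
        case True
        have "norm (h (t *\<^sub>R e + x) - h x) \<le> B * norm (t *\<^sub>R e + x - x)"
        proof (rule differentiable_bound[of UNIV h "\<lambda>x v. g x \<bullet> v"])
          show "onorm (\<lambda>v. g x \<bullet> v) \<le> B" for x
            using B(2)[of x] by (intro onorm_le) (metis Cauchy_Schwarz_ineq2 mult_right_mono norm_ge_zero order_trans real_norm_def)
        qed (use h in auto)
        then have "norm (h (t *\<^sub>R e + x) - h x) \<le> B * (t * norm e)" using t by simp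
        then have "real (Suc n) * norm (h (t *\<^sub>R e + x) - h x) \<le> real (Suc n) * (B * (t * norm e))"
          by (intro mult_left_mono) auto
        also have "\<dots> = B * norm e" by (simp add: t_def)
        finally show ?thesis using True by (simp add: D_def t_def abs_mult)
      next
        case False
        then have n: "norm x > R + norm e" by (simp add: Q_def)
        then have "x \<notin> K" using R[of x] norm_ge_zero[of e] by linarith
        moreover have "t *\<^sub>R e + x \<notin> K"
        proof
          assume "t *\<^sub>R e + x \<in> K"
          then have "norm (t *\<^sub>R e + x) \<le> R" by (rule R)
          then show False using n te norm_triangle_ineq4[of "t *\<^sub>R e + x" "t *\<^sub>R e"] by simp
        qed
        ultimately show ?thesis using False K(2) by (simp add: D_def t_def)
      qed
    qed
  qed
  then show ?thesis using D0 LIMSEQ_unique[OF _ tendsto_const] by simp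
qed

text \<open>This identifies the classical gradient of a test function with its weak gradient. It
  comes from integrating the gradient of the product, which vanishes outside \<omega> and may hence
  be integrated over the whole space.\<close>

lemma test_function_integration_by_parts:
  assumes \<phi>: "\<phi> \<in> test_functions \<omega>" and \<psi>: "\<psi> \<in> test_functions \<omega>" and \<omega>: "\<omega> \<in> lmeasurable"
  shows "(\<integral>x. \<phi> x * partial k \<psi> x \<partial>lebesgue_on \<omega>) = - (\<integral>x. partial k \<phi> x * \<psi> x \<partial>lebesgue_on \<omega>)"
proof -
  let ?g = "\<lambda>x. \<phi> x *\<^sub>R grad \<psi> x + \<psi> x *\<^sub>R grad \<phi> x"
  have s: "\<omega> \<in> sets lebesgue" using \<omega> by (simp add: fmeasurable_def)
  note sm = test_functionsD(1)[OF \<phi>] test_functionsD(1)[OF \<psi>]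
  have "(\<integral>x. ?g x \<bullet> axis k 1 \<partial>lebesgue) = 0"
  proof (rule integral_derivative_eq_0[where h = "\<lambda>x. \<phi> x * \<psi> x" and g = ?g and e = "axis k 1" and K = "closure {x. \<phi> x \<noteq> 0}"])
    fix x show "((\<lambda>x. \<phi> x * \<psi> x) has_derivative (\<lambda>v. ?g x \<bullet> v)) (at x)"
    proof -
      have "(\<lambda>v. ?g x \<bullet> v) = (\<lambda>v. \<phi> x * (grad \<psi> x \<bullet> v) + (grad \<phi> x \<bullet> v) * \<psi> x)"
        by (auto simp: inner_add_left)
      then show ?thesis
        using has_derivative_mult[OF smooth_has_derivative[OF sm(1), of x] smooth_has_derivative[OF sm(2), of x]]
        by (simp only:)
    qed
  next
    show "continuous_on UNIV ?g"
      by (intro continuous_on_add continuous_on_scaleR smooth_continuous continuous_grad sm)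
  next
    show "compact (closure {x. \<phi> x \<noteq> 0})" by (rule test_functionsD(2)[OF \<phi>])
  next
    fix x assume "x \<notin> closure {x. \<phi> x \<noteq> 0}"
    from test_function_outside_support[OF \<phi> this] show "\<phi> x * \<psi> x = 0" "?g x = 0" by simp_all
  qed
  also have "(\<integral>x. ?g x \<bullet> axis k 1 \<partial>lebesgue) = (\<integral>x. ?g x \<bullet> axis k 1 \<partial>lebesgue_on \<omega>)"
  proof -
    have "indicator \<omega> x *\<^sub>R (?g x \<bullet> axis k 1) = ?g x \<bullet> axis k 1" for x
      using test_function_outside[OF \<phi>, of x] by (cases "x \<in> \<omega>") auto
    then show ?thesis by (subst integral_restrict_space) (use s in \<open>simp_all only: sets.Int_space_eq2\<close>)
  qed
  also have "\<dots> = (\<integral>x. \<phi> x * partial k \<psi> x + partial k \<phi> x * \<psi> x \<partial>lebesgue_on \<omega>)"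
    by (intro Bochner_Integration.integral_cong refl) (simp add: inner_add_left inner_axis partial_eq_grad)
  also have "\<dots> = (\<integral>x. \<phi> x * partial k \<psi> x \<partial>lebesgue_on \<omega>) + (\<integral>x. partial k \<phi> x * \<psi> x \<partial>lebesgue_on \<omega>)"
  proof -
    have 2: "(1::real) < 2" "1 / 2 + 1 / 2 = (1::real)" by auto
    have *: "integrable (lebesgue_on \<omega>) (\<lambda>x. \<phi> x * partial k \<psi> x)"
      if "\<phi> \<in> test_functions \<omega>" "\<psi> \<in> test_functions \<omega>" for \<phi> \<psi>
    proof -
      have "(\<lambda>x. grad \<psi> x $ k) \<in> Lp_fun (lebesgue_on \<omega>) 2"
        by (rule Lp_fun_linear[OF test_function_Lp(2)[OF that(2) \<omega>] bounded_linear_vec_nth]) auto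
      from Holder_inner(1)[OF test_function_Lp(1)[OF that(1) \<omega>] this 2(1) 2(1) 2(2)] show ?thesis
        by (simp add: partial_eq_grad)
    qed
    show ?thesis
      using *[OF \<phi> \<psi>] *[OF \<psi> \<phi>] by (intro Bochner_Integration.integral_add) (auto simp: mult.commute)
  qed
  finally show ?thesis by simp
qed

subsection \<open>Negative Sobolev norms\<close>

text \<open>The constant comes from taking the p-th root of the crude inequality for
  \<open>Lp_int\<close>: it is \<open>2 * 2 powr (1 / p)\<close>, at most 4.\<close>

lemma Lp_norm_add_le:
  assumes "f \<in> Lp_space p \<omega>" "g \<in> Lp_space p \<omega>" "1 < p"
  shows "Lp_norm p \<omega> (\<lambda>x. f x + g x) \<le> 4 * (Lp_norm p \<omega> f + Lp_norm p \<omega> g)"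
proof -
  let ?M = "lebesgue_on \<omega>"
  define A where "A = max (Lp_int ?M p f) (Lp_int ?M p g)"
  have A: "A \<ge> 0" by (simp add: A_def max_def)
  have "Lp_int ?M p (\<lambda>x. f x + g x) \<le> 2 powr p * (Lp_int ?M p f + Lp_int ?M p g)"
    using Lp_fun_add(2)[of f ?M p g] assms by (simp add: Lp_space_eq)
  also have "\<dots> \<le> 2 powr p * (2 * A)" by (intro mult_left_mono) (auto simp: A_def)
  finally have "Lp_int ?M p (\<lambda>x. f x + g x) powr (1 / p) \<le> (2 powr p * (2 * A)) powr (1 / p)"
    using assms(3) by (intro powr_mono2) auto
  also have "\<dots> = 2 * (2 powr (1 / p) * A powr (1 / p))"
    using assms(3) A by (simp add: powr_mult powr_powr)
  also have "2 powr (1 / p) \<le> (2::real) powr 1" using assms(3) by (intro powr_mono) auto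
  then have "2 * (2 powr (1 / p) * A powr (1 / p)) \<le> 2 * (2 * A powr (1 / p))"
    by (intro mult_left_mono mult_right_mono) auto
  also have "A powr (1 / p) \<le> Lp_norm p \<omega> f + Lp_norm p \<omega> g"
    by (simp add: A_def max_def Lp_norm_eq)
  then have "2 * (2 * A powr (1 / p)) \<le> 4 * (Lp_norm p \<omega> f + Lp_norm p \<omega> g)" by simp
  finally show ?thesis by (simp add: Lp_norm_eq)
qed

lemma Lp_norm_scaleR:
  assumes "f \<in> Lp_space p \<omega>" "p > 0"
  shows "Lp_norm p \<omega> (\<lambda>x. c *\<^sub>R f x) = \<bar>c\<bar> * Lp_norm p \<omega> f"
  using Lp_fun_scaleR(2)[of f "lebesgue_on \<omega>" p c] assms
  by (simp add: Lp_norm_eq Lp_space_eq powr_mult powr_powr)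

lemma Lp_norm_zero [simp]: "Lp_norm p \<omega> (\<lambda>x. 0) = 0"
  by (simp add: Lp_norm_def)

lemma W1_norm_nonneg [simp]: "W1_norm q \<omega> U \<ge> 0"
  by (simp add: W1_norm_def)

lemma with_grad_in_W10:
  assumes \<phi>: "\<phi> \<in> test_functions \<omega>" and \<omega>: "\<omega> \<in> lmeasurable" and q: "1 < q"
  shows "with_grad \<phi> \<in> W10_space q \<omega>"
proof -
  have "dist_partial \<omega> k \<phi> \<psi> = (\<integral>x. grad \<phi> x $ k * \<psi> x \<partial>lebesgue_on \<omega>)" if "\<psi> \<in> test_functions \<omega>" for \<psi> k
    using test_function_integration_by_parts[OF \<phi> that \<omega>, of k] by (simp add: dist_partial_def partial_eq_grad)
  then have "with_grad \<phi> \<in> W1_space q \<omega>"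
    using test_function_Lp[OF \<phi> \<omega>, of q] q by (simp add: W1_space_def with_grad_def Lp_space_eq)
  moreover have "W1_norm q \<omega> (\<lambda>x. with_grad \<phi> x - with_grad \<phi> x) = 0"
    by (simp add: W1_norm_def)
  ultimately show ?thesis
    unfolding W10_space_def using \<phi> by (auto intro!: exI[of _ "\<lambda>_. \<phi>"])
qed

lemma W1_norm_with_grad_scale:
  assumes "\<phi> \<in> test_functions \<omega>" "\<omega> \<in> lmeasurable" "1 < q"
  shows "W1_norm q \<omega> (with_grad (\<lambda>x. c * \<phi> x)) = \<bar>c\<bar> * W1_norm q \<omega> (with_grad \<phi>)"
    and "with_grad (\<lambda>x. c * \<phi> x) = (\<lambda>x. c *\<^sub>R with_grad \<phi> x)"
proof -
  show "with_grad (\<lambda>x. c * \<phi> x) = (\<lambda>x. c *\<^sub>R with_grad \<phi> x)"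
    by (auto simp: with_grad_def test_function_scale(2)[OF assms(1)])
  show "W1_norm q \<omega> (with_grad (\<lambda>x. c * \<phi> x)) = \<bar>c\<bar> * W1_norm q \<omega> (with_grad \<phi>)"
    using Lp_norm_scaleR[of \<phi> q \<omega> c] Lp_norm_scaleR[of "grad \<phi>" q \<omega> c] test_function_Lp[OF assms(1,2), of q] assms(3)
    by (simp add: W1_norm_def with_grad_def test_function_scale(2)[OF assms(1)] Lp_space_eq distrib_left)
qed

lemma bounded_functional_diff:
  assumes "bounded_functional V N L" "bounded_functional V N L'"
  shows "bounded_functional V N (\<lambda>U. L U - L' U)"
proof -
  obtain C C' where C: "\<forall>f\<in>V. \<bar>L f\<bar> \<le> C * N f" "\<forall>f\<in>V. \<bar>L' f\<bar> \<le> C' * N f"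
    using assms unfolding bounded_functional_def by blast
  have "\<forall>f\<in>V. \<bar>L f - L' f\<bar> \<le> (C + C') * N f"
  proof
    fix f assume "f \<in> V"
    then have "\<bar>L f\<bar> \<le> C * N f" "\<bar>L' f\<bar> \<le> C' * N f" using C by auto
    then show "\<bar>L f - L' f\<bar> \<le> (C + C') * N f" unfolding distrib_right by linarith
  qed
  moreover have "\<forall>f\<in>V. \<forall>g\<in>V. L (\<lambda>x. f x + g x) - L' (\<lambda>x. f x + g x) = (L f - L' f) + (L g - L' g)"
    using assms by (simp add: bounded_functional_def)
  moreover have "\<forall>f\<in>V. \<forall>c. L (\<lambda>x. c *\<^sub>R f x) - L' (\<lambda>x. c *\<^sub>R f x) = c * (L f - L' f)"
    using assms by (simp add: bounded_functional_def right_diff_distrib)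
  ultimately show ?thesis unfolding bounded_functional_def by blast
qed

lemma dual_norm_bdd_above:
  assumes "bounded_functional V N L" "\<And>f. N f \<ge> 0"
  shows "bdd_above ((\<lambda>f. \<bar>L f\<bar>) ` {f \<in> V. N f \<le> 1})"
proof -
  obtain C where C: "\<forall>f\<in>V. \<bar>L f\<bar> \<le> C * N f"
    using assms unfolding bounded_functional_def by blast
  have "\<bar>L f\<bar> \<le> \<bar>C\<bar>" if "f \<in> V" "N f \<le> 1" for f
  proof -
    have "\<bar>L f\<bar> \<le> C * N f" using C that by blast
    also have "\<dots> \<le> \<bar>C\<bar> * 1" using that assms(2) by (intro mult_mono) auto
    finally show ?thesis by simp
  qed
  then show ?thesis by (intro bdd_aboveI2[of _ _ "\<bar>C\<bar>"]) auto
qed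

text \<open>By homogeneity a test function can be rescaled to norm 1, where the dual norm controls
  the difference of the representing functionals. The dual norms themselves serve as the null
  sequence.\<close>

lemma Wm1_convergent_imp_test_bound:
  assumes pq: "1 < p" "1 < q" "1 / p + 1 / q = 1" and \<omega>: "\<omega> \<in> lmeasurable"
    and conv: "Wm1_convergent_to p \<omega> T T0"
  shows "\<exists>\<epsilon>. \<epsilon> \<longlonglongrightarrow> 0 \<and> (\<forall>m. \<forall>\<phi>\<in>test_functions \<omega>.
      \<bar>T m \<phi> - T0 \<phi>\<bar> \<le> \<epsilon> m * W1_norm q \<omega> (with_grad \<phi>))"
proof -
  let ?V = "W10_space q \<omega>" and ?N = "W1_norm q \<omega>"
  obtain L L0 where L: "\<And>m. represents_Wm1 p \<omega> (L m) (T m)" "represents_Wm1 p \<omega> L0 T0"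
    and lim: "(\<lambda>m. Wm1_norm p \<omega> (\<lambda>U. L m U - L0 U)) \<longlonglongrightarrow> 0"
    using conv by (auto simp: Wm1_convergent_to_def)
  note ce = conj_exponentsD(2)[OF pq]
  have "\<bar>T m \<phi> - T0 \<phi>\<bar> \<le> Wm1_norm p \<omega> (\<lambda>U. L m U - L0 U) * ?N (with_grad \<phi>)"
    if \<phi>: "\<phi> \<in> test_functions \<omega>" for m \<phi>
  proof -
    define D where "D = (\<lambda>U. L m U - L0 U)"
    have b: "bounded_functional ?V ?N D"
      unfolding D_def using L by (intro bounded_functional_diff) (auto simp: represents_Wm1_def ce)
    have T: "T m \<phi> - T0 \<phi> = D (with_grad \<phi>)" using L \<phi> by (simp add: D_def represents_Wm1_def)
    note V = with_grad_in_W10[OF \<phi> \<omega> pq(2)]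
    show ?thesis
    \<comment> \<open>Normalisation fails at norm 0, but there the boundedness of \<open>D\<close>
      forces the value 0.\<close>
    proof (cases "?N (with_grad \<phi>) = 0")
      case True
      obtain C where "\<forall>f\<in>?V. \<bar>D f\<bar> \<le> C * ?N f"
        using b unfolding bounded_functional_def by blast
      then have "\<bar>D (with_grad \<phi>)\<bar> \<le> C * ?N (with_grad \<phi>)" using V by blast
      then show ?thesis using T True by simp
    next
      case False
      then have pos: "?N (with_grad \<phi>) > 0" using W1_norm_nonneg[of q \<omega> "with_grad \<phi>"] by linarith
      define c where "c = 1 / ?N (with_grad \<phi>)"
      define \<psi> where "\<psi> = (\<lambda>x. c * \<phi> x)"
      have \<psi>: "\<psi> \<in> test_functions \<omega>" unfolding \<psi>_def by (rule test_function_scale[OF \<phi>])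
      have "?N (with_grad \<psi>) = 1"
        unfolding \<psi>_def using W1_norm_with_grad_scale(1)[OF \<phi> \<omega> pq(2), of c] pos by (simp add: c_def)
      then have "\<bar>D (with_grad \<psi>)\<bar> \<le> dual_norm ?V ?N D"
        unfolding dual_norm_def using with_grad_in_W10[OF \<psi> \<omega> pq(2)]
        by (intro cSUP_upper dual_norm_bdd_above[OF b W1_norm_nonneg]) auto
      moreover have "D (with_grad \<psi>) = c * D (with_grad \<phi>)"
        using b V unfolding \<psi>_def W1_norm_with_grad_scale(2)[OF \<phi> \<omega> pq(2)] bounded_functional_def by blast
      ultimately have "\<bar>D (with_grad \<phi>)\<bar> \<le> dual_norm ?V ?N D * ?N (with_grad \<phi>)"
        using pos by (simp add: c_def abs_mult field_simps)
      then show ?thesis using T by (simp add: Wm1_norm_def ce D_def)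
    qed
  qed
  then show ?thesis using lim by blast
qed

text \<open>Integration against \<open>f m\<close> extends the distribution to all of
  \<open>W10_space\<close> by the Hoelder inequality. The bound, known on test functions only,
  extends by density with a factor 4 from \<open>Lp_norm_add_le\<close>.\<close>

lemma test_bound_imp_Wm1_convergent:
  fixes f :: "nat \<Rightarrow> real ^ 'n \<Rightarrow> real ^ 'n"
  assumes pq: "1 < p" "1 < q" "1 / p + 1 / q = 1" and \<omega>: "\<omega> \<in> lmeasurable"
    and f: "\<And>m. f m \<in> Lp_fun (lebesgue_on \<omega>) p" "f0 \<in> Lp_fun (lebesgue_on \<omega>) p"
    and T: "\<And>m \<phi>. \<phi> \<in> test_functions \<omega> \<Longrightarrow> T m \<phi> = - (\<integral>x. f m x \<bullet> grad \<phi> x \<partial>lebesgue_on \<omega>)"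
      "\<And>\<phi>. \<phi> \<in> test_functions \<omega> \<Longrightarrow> T0 \<phi> = - (\<integral>x. f0 x \<bullet> grad \<phi> x \<partial>lebesgue_on \<omega>)"
    and \<epsilon>: "\<epsilon> \<longlonglongrightarrow> 0"
    and bound: "\<And>m \<phi>. \<phi> \<in> test_functions \<omega> \<Longrightarrow> \<bar>T m \<phi> - T0 \<phi>\<bar> \<le> \<epsilon> m * W1_norm q \<omega> (with_grad \<phi>)"
  shows "Wm1_convergent_to p \<omega> T T0"
proof -
  let ?M = "lebesgue_on \<omega>"
  let ?V = "W10_space q \<omega>" and ?N = "W1_norm q \<omega>"
  note ce = conj_exponentsD(2)[OF pq]
  have q0: "q \<ge> 0" using pq by simp
  define P where "P g U = - (\<integral>x. g x \<bullet> snd (U x) \<partial>?M)" for g :: "real ^ 'n \<Rightarrow> real ^ 'n" and U :: "real ^ 'n \<Rightarrow> real \<times> (real ^ 'n)"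
  have VD: "(\<lambda>x. fst (U x)) \<in> Lp_fun ?M q" "(\<lambda>x. snd (U x)) \<in> Lp_fun ?M q" if "U \<in> ?V" for U
    using that by (auto simp: W10_space_def W1_space_def Lp_space_eq)
  have int: "integrable ?M (\<lambda>x. g x \<bullet> snd (U x))"
    if "g \<in> Lp_fun ?M p" "(\<lambda>x. snd (U x)) \<in> Lp_fun ?M q" for g U
    using Holder_inner(1)[OF that pq] .
  have Pbound: "\<bar>P g U\<bar> \<le> Lp_norm p \<omega> g * ?N U"
    if "g \<in> Lp_fun ?M p" "(\<lambda>x. snd (U x)) \<in> Lp_fun ?M q" for g U
  proof -
    have "\<bar>P g U\<bar> \<le> Lp_norm p \<omega> g * Lp_norm q \<omega> (\<lambda>x. snd (U x))"
      using Holder_inner(2)[OF that pq] by (simp add: P_def Lp_norm_eq)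
    also have "\<dots> \<le> Lp_norm p \<omega> g * ?N U"
      by (intro mult_left_mono) (auto simp: W1_norm_def)
    finally show ?thesis .
  qed
  have Pb: "bounded_functional ?V ?N (P g)" if g: "g \<in> Lp_fun ?M p" for g
    unfolding bounded_functional_def
  proof (intro conjI ballI allI exI)
    fix U W assume "U \<in> ?V" "W \<in> ?V"
    then show "P g (\<lambda>x. U x + W x) = P g U + P g W"
      by (simp add: P_def inner_add_right int[OF g VD(2)])
  next
    fix U c assume "U \<in> ?V"
    then show "P g (\<lambda>x. c *\<^sub>R U x) = c * P g U" by (simp add: P_def)
  next
    fix U assume "U \<in> ?V"
    then show "\<bar>P g U\<bar> \<le> Lp_norm p \<omega> g * ?N U" by (intro Pbound g VD)
  qed
  have rep: "represents_Wm1 p \<omega> (P (f m)) (T m)" "represents_Wm1 p \<omega> (P f0) T0" for m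
    unfolding represents_Wm1_def ce using Pb f T by (auto simp: P_def with_grad_def)
  have est: "\<bar>P (f m) U - P f0 U\<bar> \<le> 4 * \<bar>\<epsilon> m\<bar> * ?N U" if U: "U \<in> ?V" for m U
  proof -
    obtain \<phi> where \<phi>: "\<And>i. \<phi> i \<in> test_functions \<omega>"
      and lim: "(\<lambda>i. ?N (\<lambda>x. with_grad (\<phi> i) x - U x)) \<longlonglongrightarrow> 0"
      using U unfolding W10_space_def by blast
    define d where "d i = ?N (\<lambda>x. with_grad (\<phi> i) x - U x)" for i
    define g where "g = (\<lambda>x. f m x - f0 x)"
    have g: "g \<in> Lp_fun ?M p" unfolding g_def using f pq by (intro Lp_fun_diff) auto
    have Pg: "P g W = P (f m) W - P f0 W" if "(\<lambda>x. snd (W x)) \<in> Lp_fun ?M q" for W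
      unfolding P_def g_def by (simp add: inner_diff_left int f that)
    have diffV: "(\<lambda>x. fst (with_grad (\<phi> i) x - U x)) \<in> Lp_fun ?M q"
      "(\<lambda>x. snd (with_grad (\<phi> i) x - U x)) \<in> Lp_fun ?M q" for i
      using Lp_fun_diff(1)[OF test_function_Lp(1)[OF \<phi> \<omega>] VD(1)[OF U] q0, of i]
        Lp_fun_diff(1)[OF test_function_Lp(2)[OF \<phi> \<omega>] VD(2)[OF U] q0, of i] pq
      by (auto simp: with_grad_def)
    \<comment> \<open>\<open>d i\<close> is the distance of \<open>U\<close> from its approximating
      test function and disappears as \<open>i\<close> grows. The absolute value of
      \<open>\<epsilon> m\<close> allows the monotonicity steps, since the sign of
      \<open>\<epsilon> m\<close> is not prescribed.\<close>
    have "\<bar>P g U\<bar> \<le> \<bar>\<epsilon> m\<bar> * (4 * (d i + ?N U)) + Lp_norm p \<omega> g * d i" for i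
    proof -
      have "P g (with_grad (\<phi> i)) = P g U + P g (\<lambda>x. with_grad (\<phi> i) x - U x)"
      proof -
        have "(\<lambda>x. snd (with_grad (\<phi> i) x)) \<in> Lp_fun ?M q"
          using test_function_Lp(2)[OF \<phi> \<omega>, of q i] pq by (simp add: with_grad_def)
        from int[OF g this] int[OF g VD(2)[OF U]] show ?thesis
          by (simp add: P_def inner_diff_right)
      qed
      then have "\<bar>P g U\<bar> \<le> \<bar>P g (with_grad (\<phi> i))\<bar> + \<bar>P g (\<lambda>x. with_grad (\<phi> i) x - U x)\<bar>" by linarith
      also have "\<bar>P g (\<lambda>x. with_grad (\<phi> i) x - U x)\<bar> \<le> Lp_norm p \<omega> g * d i"
        unfolding d_def by (rule Pbound[OF g diffV(2)])
      also have "\<bar>P g (with_grad (\<phi> i))\<bar> \<le> \<bar>\<epsilon> m\<bar> * (4 * (d i + ?N U))"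
      proof -
        have "P g (with_grad (\<phi> i)) = T m (\<phi> i) - T0 (\<phi> i)"
          using Pg[of "with_grad (\<phi> i)"] test_function_Lp(2)[OF \<phi> \<omega>, of q i] pq
          by (simp add: T[OF \<phi>] P_def with_grad_def)
        then have "\<bar>P g (with_grad (\<phi> i))\<bar> \<le> \<epsilon> m * ?N (with_grad (\<phi> i))" using bound[OF \<phi>] by simp
        also have "\<dots> \<le> \<bar>\<epsilon> m\<bar> * ?N (with_grad (\<phi> i))" by (intro mult_right_mono) auto
        also have "?N (with_grad (\<phi> i)) \<le> 4 * (d i + ?N U)"
          using Lp_norm_add_le[of "\<lambda>x. fst (with_grad (\<phi> i) x - U x)" q \<omega> "\<lambda>x. fst (U x)"]
            Lp_norm_add_le[of "\<lambda>x. snd (with_grad (\<phi> i) x - U x)" q \<omega> "\<lambda>x. snd (U x)"]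
            diffV[of i] VD[OF U] pq
          by (simp add: W1_norm_def d_def Lp_space_eq)
        then have "\<bar>\<epsilon> m\<bar> * ?N (with_grad (\<phi> i)) \<le> \<bar>\<epsilon> m\<bar> * (4 * (d i + ?N U))" by (intro mult_left_mono) auto
        finally show ?thesis .
      qed
      finally show ?thesis by simp
    qed
    moreover have "(\<lambda>i. \<bar>\<epsilon> m\<bar> * (4 * (d i + ?N U)) + Lp_norm p \<omega> g * d i)
        \<longlonglongrightarrow> \<bar>\<epsilon> m\<bar> * (4 * (0 + ?N U)) + Lp_norm p \<omega> g * 0"
      using lim unfolding d_def by (intro tendsto_intros)
    ultimately have "\<bar>P g U\<bar> \<le> \<bar>\<epsilon> m\<bar> * (4 * (0 + ?N U)) + Lp_norm p \<omega> g * 0"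
      by (intro LIMSEQ_le_const) auto
    then show ?thesis using Pg[OF VD(2)[OF U]] by simp
  qed
  \<comment> \<open>The zero function shows that the set in the supremum of the dual norm is
    nonempty, which both estimates of that supremum require.\<close>
  have z: "(\<lambda>_. 0) \<in> test_functions \<omega>"
    by (simp add: test_functions_def smooth_def times_differentiable_zero)
  have zV: "with_grad (\<lambda>_. 0) \<in> ?V" by (rule with_grad_in_W10[OF z \<omega> pq(2)])
  have zN: "?N (with_grad (\<lambda>_. 0)) = 0"
    using W1_norm_with_grad_scale(1)[OF z \<omega> pq(2), of 0] by simp
  have Db: "bounded_functional ?V ?N (\<lambda>U. P (f m) U - P f0 U)" for m
    by (intro bounded_functional_diff Pb f)
  have up: "Wm1_norm p \<omega> (\<lambda>U. P (f m) U - P f0 U) \<le> 4 * \<bar>\<epsilon> m\<bar>" for m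
    unfolding Wm1_norm_def dual_norm_def ce
  proof (rule cSUP_least)
    show "{U \<in> ?V. ?N U \<le> 1} \<noteq> {}" using zV zN by force
    fix U assume "U \<in> {U \<in> ?V. ?N U \<le> 1}"
    then have "\<bar>P (f m) U - P f0 U\<bar> \<le> 4 * \<bar>\<epsilon> m\<bar> * ?N U" "?N U \<le> 1" using est by auto
    then show "\<bar>P (f m) U - P f0 U\<bar> \<le> 4 * \<bar>\<epsilon> m\<bar>"
      using mult_left_mono[of "?N U" 1 "4 * \<bar>\<epsilon> m\<bar>"] by simp
  qed
  have lo: "0 \<le> Wm1_norm p \<omega> (\<lambda>U. P (f m) U - P f0 U)" for m
    unfolding Wm1_norm_def dual_norm_def ce
    by (rule cSUP_upper2[OF dual_norm_bdd_above[OF Db W1_norm_nonneg], of "with_grad (\<lambda>_. 0)"]) (use zV zN in auto)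
  have "(\<lambda>m. Wm1_norm p \<omega> (\<lambda>U. P (f m) U - P f0 U)) \<longlonglongrightarrow> 0"
  proof (rule tendsto_sandwich[of "\<lambda>_. 0" _ _ "\<lambda>m. 4 * \<bar>\<epsilon> m\<bar>"])
    show "(\<lambda>m. 4 * \<bar>\<epsilon> m\<bar>) \<longlonglongrightarrow> 0" using tendsto_mult_right_zero[OF tendsto_rabs_zero[OF \<epsilon>]] .
  qed (use up lo in auto)
  then show ?thesis unfolding Wm1_convergent_to_def using rep
    by (intro exI[of _ "\<lambda>m. P (f m)"] exI[of _ "P f0"] conjI allI) auto
qed

subsection \<open>Div-curl convergence tested on smooth functions\<close>

text \<open>The \<open>(i, j, k)\<close> entry of the curl is the divergence of this vector field.
  Curl and divergence can thus be handled by the same statements about divergences of vector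
  fields.\<close>

definition curl_field :: "'n \<Rightarrow> 'n \<Rightarrow> 'n \<Rightarrow> real ^ 'n ^ 'n \<Rightarrow> real ^ 'n" where
  "curl_field i j k A = (A $ i $ j) *\<^sub>R axis k 1 - (A $ i $ k) *\<^sub>R axis j 1"

lemma linear_curl_field: "bounded_linear (curl_field i j k)"
  unfolding curl_field_def[abs_def]
  by (intro bounded_linear_sub bounded_linear_scaleR_const
      bounded_linear_compose[OF bounded_linear_vec_nth bounded_linear_vec_nth])

text \<open>Convergence of the divergence of \<open>f m\<close> in the dual of the Sobolev space
  with exponent \<open>q\<close>, expressed with an explicit null sequence instead of a supremum. In
  this form it is stable under rescaling and diagonal choices.\<close>

definition test_convergent ::
    "real \<Rightarrow> (real ^ 'n) set \<Rightarrow> (nat \<Rightarrow> real ^ 'n \<Rightarrow> real ^ 'n) \<Rightarrow> (real ^ 'n \<Rightarrow> real ^ 'n) \<Rightarrow> bool" where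
  "test_convergent q \<omega> f f0 \<longleftrightarrow> (\<exists>\<epsilon>. \<epsilon> \<longlonglongrightarrow> 0 \<and> (\<forall>m. \<forall>\<phi>\<in>test_functions \<omega>.
     \<bar>\<integral>x. (f m x - f0 x) \<bullet> grad \<phi> x \<partial>lebesgue_on \<omega>\<bar> \<le> \<epsilon> m * W1_norm q \<omega> (with_grad \<phi>)))"

lemma Wm1_convergent_iff_test_convergent:
  fixes f :: "nat \<Rightarrow> real ^ 'n \<Rightarrow> real ^ 'n"
  assumes pq: "1 < p" "1 < q" "1 / p + 1 / q = 1" and \<omega>: "\<omega> \<in> lmeasurable"
    and f: "\<And>m. f m \<in> Lp_fun (lebesgue_on \<omega>) p" "f0 \<in> Lp_fun (lebesgue_on \<omega>) p"
    and T: "\<And>m \<phi>. \<phi> \<in> test_functions \<omega> \<Longrightarrow> T m \<phi> = - (\<integral>x. f m x \<bullet> grad \<phi> x \<partial>lebesgue_on \<omega>)"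
      "\<And>\<phi>. \<phi> \<in> test_functions \<omega> \<Longrightarrow> T0 \<phi> = - (\<integral>x. f0 x \<bullet> grad \<phi> x \<partial>lebesgue_on \<omega>)"
  shows "Wm1_convergent_to p \<omega> T T0 \<longleftrightarrow> test_convergent q \<omega> f f0"
proof -
  have eq: "\<bar>T m \<phi> - T0 \<phi>\<bar> = \<bar>\<integral>x. (f m x - f0 x) \<bullet> grad \<phi> x \<partial>lebesgue_on \<omega>\<bar>"
    if "\<phi> \<in> test_functions \<omega>" for m \<phi>
  proof -
    have g: "grad \<phi> \<in> Lp_fun (lebesgue_on \<omega>) q"
      using test_function_Lp(2)[OF that \<omega>] pq by simp
    show ?thesis
      using Holder_inner(1)[OF f(1)[of m] g pq] Holder_inner(1)[OF f(2) g pq]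
      by (simp add: T that inner_diff_left)
  qed
  show ?thesis
  proof
    assume "Wm1_convergent_to p \<omega> T T0"
    from Wm1_convergent_imp_test_bound[OF pq \<omega> this]
    show "test_convergent q \<omega> f f0" unfolding test_convergent_def by (simp add: eq cong: ball_cong)
  next
    assume "test_convergent q \<omega> f f0"
    then obtain \<epsilon> where "\<epsilon> \<longlonglongrightarrow> 0" "\<And>m \<phi>. \<phi> \<in> test_functions \<omega> \<Longrightarrow>
        \<bar>\<integral>x. (f m x - f0 x) \<bullet> grad \<phi> x \<partial>lebesgue_on \<omega>\<bar> \<le> \<epsilon> m * W1_norm q \<omega> (with_grad \<phi>)"
      unfolding test_convergent_def by blast
    then show "Wm1_convergent_to p \<omega> T T0"
      using test_bound_imp_Wm1_convergent[OF pq \<omega> f T, of \<epsilon>] eq by simp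
  qed
qed

lemma integrable_times_partial:
  fixes F :: "real ^ 'n \<Rightarrow> 'b::euclidean_space"
  assumes pq: "1 < p" "1 < q" "1 / p + 1 / q = 1" and \<omega>: "\<omega> \<in> lmeasurable"
    and F: "F \<in> Lp_fun (lebesgue_on \<omega>) p" and \<phi>: "\<phi> \<in> test_functions \<omega>" and T: "bounded_linear T"
  shows "integrable (lebesgue_on \<omega>) (\<lambda>x. (T (F x) :: real) * partial k \<phi> x)"
proof -
  have "grad \<phi> \<in> Lp_fun (lebesgue_on \<omega>) q" using test_function_Lp(2)[OF \<phi> \<omega>] pq by simp
  then have "(\<lambda>x. grad \<phi> x $ k) \<in> Lp_fun (lebesgue_on \<omega>) q"
    by (rule Lp_fun_linear[OF _ bounded_linear_vec_nth]) (use pq in simp)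
  moreover have "(\<lambda>x. T (F x)) \<in> Lp_fun (lebesgue_on \<omega>) p"
    by (rule Lp_fun_linear[OF F T]) (use pq in simp)
  ultimately show ?thesis using Holder_inner(1)[OF _ _ pq] by (force simp: partial_eq_grad)
qed

lemma dist_curl_eq:
  fixes F :: "real ^ 'n \<Rightarrow> real ^ 'n ^ 'n"
  assumes pq: "1 < p" "1 < q" "1 / p + 1 / q = 1" and \<omega>: "\<omega> \<in> lmeasurable"
    and F: "F \<in> Lp_fun (lebesgue_on \<omega>) p" and \<phi>: "\<phi> \<in> test_functions \<omega>"
  shows "dist_curl \<omega> F i j k \<phi> = - (\<integral>x. curl_field i j k (F x) \<bullet> grad \<phi> x \<partial>lebesgue_on \<omega>)"
proof -
  have b: "bounded_linear (\<lambda>A :: real ^ 'n ^ 'n. A $ i $ j)" for i j :: 'n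
    by (rule bounded_linear_compose[OF bounded_linear_vec_nth bounded_linear_vec_nth])
  note int = integrable_times_partial[OF pq \<omega> F \<phi> b]
  have "(\<integral>x. curl_field i j k (F x) \<bullet> grad \<phi> x \<partial>lebesgue_on \<omega>)
      = (\<integral>x. F x $ i $ j * partial k \<phi> x - F x $ i $ k * partial j \<phi> x \<partial>lebesgue_on \<omega>)"
    by (simp add: curl_field_def inner_diff_left inner_axis' partial_eq_grad)
  also have "\<dots> = (\<integral>x. F x $ i $ j * partial k \<phi> x \<partial>lebesgue_on \<omega>) - (\<integral>x. F x $ i $ k * partial j \<phi> x \<partial>lebesgue_on \<omega>)"
    by (rule Bochner_Integration.integral_diff[OF int int])
  finally show ?thesis by (simp add: dist_curl_def dist_partial_def)
qed

lemma dist_div_eq: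
  fixes P :: "real ^ 'n \<Rightarrow> real ^ 'n ^ 'n"
  assumes pq: "1 < p" "1 < q" "1 / p + 1 / q = 1" and \<omega>: "\<omega> \<in> lmeasurable"
    and P: "P \<in> Lp_fun (lebesgue_on \<omega>) p" and \<phi>: "\<phi> \<in> test_functions \<omega>"
  shows "dist_div \<omega> P i \<phi> = - (\<integral>x. (P x $ i) \<bullet> grad \<phi> x \<partial>lebesgue_on \<omega>)"
proof -
  have b: "bounded_linear (\<lambda>A :: real ^ 'n ^ 'n. A $ i $ j)" for i j :: 'n
    by (rule bounded_linear_compose[OF bounded_linear_vec_nth bounded_linear_vec_nth])
  note int = integrable_times_partial[OF pq \<omega> P \<phi> b]
  have "(\<integral>x. (P x $ i) \<bullet> grad \<phi> x \<partial>lebesgue_on \<omega>)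
      = (\<integral>x. (\<Sum>j\<in>UNIV. P x $ i $ j * partial j \<phi> x) \<partial>lebesgue_on \<omega>)"
    by (simp add: inner_vec_def partial_eq_grad)
  also have "\<dots> = (\<Sum>j\<in>UNIV. \<integral>x. P x $ i $ j * partial j \<phi> x \<partial>lebesgue_on \<omega>)"
    by (rule Bochner_Integration.integral_sum[OF int])
  finally show ?thesis by (simp add: dist_div_def dist_partial_def sum_negf)
qed

lemma X_spaceD:
  assumes "u \<in> X_space p q \<omega>"
  shows "(\<lambda>x. fst (u x)) \<in> Lp_fun (lebesgue_on \<omega>) p" "(\<lambda>x. snd (u x)) \<in> Lp_fun (lebesgue_on \<omega>) q"
  using assms by (auto simp: X_space_def Lp_space_eq)

lemma X_spaceI:
  assumes "(\<lambda>x. fst (u x)) \<in> Lp_fun (lebesgue_on \<omega>) p" "(\<lambda>x. snd (u x)) \<in> Lp_fun (lebesgue_on \<omega>) q"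
  shows "u \<in> X_space p q \<omega>"
  using assms by (auto simp: X_space_def Lp_space_eq)

lemma weakly_convergent_X_spaceD:
  assumes "weakly_convergent_to (X_space p q \<omega>) (X_norm p q \<omega>) u u0"
  shows "u m \<in> X_space p q \<omega>" "u0 \<in> X_space p q \<omega>"
  using assms by (auto simp: weakly_convergent_to_def)

text \<open>Integration by parts is built into the distributional derivatives, so each component is
  of the form treated above. The exponents trade places in the divergence part, because there the
  field has exponent \<open>q\<close> and the test functions have exponent \<open>p\<close>.\<close>

lemma div_curl_convergent_iff:
  assumes pq: "1 < p" "1 < q" "1 / p + 1 / q = 1" and \<omega>: "\<omega> \<in> lmeasurable"
  shows "div_curl_convergent_to p q \<omega> u u0 \<longleftrightarrow>
    weakly_convergent_to (X_space p q \<omega>) (X_norm p q \<omega>) u u0 \<and>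
    (\<forall>i j k. test_convergent q \<omega> (\<lambda>m x. curl_field i j k (fst (u m x))) (\<lambda>x. curl_field i j k (fst (u0 x)))) \<and>
    (\<forall>i. test_convergent p \<omega> (\<lambda>m x. snd (u m x) $ i) (\<lambda>x. snd (u0 x) $ i))"
proof (cases "weakly_convergent_to (X_space p q \<omega>) (X_norm p q \<omega>) u u0")
  case True
  note X = X_spaceD[OF weakly_convergent_X_spaceD(1)[OF True]] X_spaceD[OF weakly_convergent_X_spaceD(2)[OF True]]
  have qp: "1 / q + 1 / p = 1" using pq(3) by simp
  have "Wm1_convergent_to p \<omega> (\<lambda>m. dist_curl \<omega> (\<lambda>x. fst (u m x)) i j k) (dist_curl \<omega> (\<lambda>x. fst (u0 x)) i j k) \<longleftrightarrow>
    test_convergent q \<omega> (\<lambda>m x. curl_field i j k (fst (u m x))) (\<lambda>x. curl_field i j k (fst (u0 x)))" for i j k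
    by (rule Wm1_convergent_iff_test_convergent[OF pq \<omega>])
      (use pq in \<open>auto intro!: Lp_fun_linear(1)[OF _ linear_curl_field] X dist_curl_eq[OF pq \<omega>]\<close>)
  moreover have "Wm1_convergent_to q \<omega> (\<lambda>m. dist_div \<omega> (\<lambda>x. snd (u m x)) i) (dist_div \<omega> (\<lambda>x. snd (u0 x)) i) \<longleftrightarrow>
    test_convergent p \<omega> (\<lambda>m x. snd (u m x) $ i) (\<lambda>x. snd (u0 x) $ i)" for i
    by (rule Wm1_convergent_iff_test_convergent[OF pq(2,1) qp \<omega>])
      (use pq in \<open>auto intro!: Lp_fun_linear(1)[OF _ bounded_linear_vec_nth] X dist_div_eq[OF pq(2,1) qp \<omega>]\<close>)
  ultimately show ?thesis by (simp add: div_curl_convergent_to_def True)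
qed (simp add: div_curl_convergent_to_def)

subsection \<open>Rescaling of div-curl-convergent sequences\<close>

lemma Lp_norm_affine:
  assumes "f \<in> Lp_fun (lebesgue_on \<omega>) p" "r > 0" "1 < p"
    and "\<omega> \<in> sets lebesgue" "\<omega>' \<in> sets lebesgue" "\<And>y. y \<in> \<omega>' \<Longrightarrow> x0 + r *\<^sub>R y \<in> \<omega>"
  shows "Lp_norm p \<omega>' (\<lambda>y. f (x0 + r *\<^sub>R y)) \<le> (1 / r ^ CARD('n)) powr (1 / p) * Lp_norm p \<omega> (f :: real ^ 'n \<Rightarrow> 'b::euclidean_space)"
proof -
  have "Lp_int (lebesgue_on \<omega>') p (\<lambda>y. f (x0 + r *\<^sub>R y)) \<le> Lp_int (lebesgue_on \<omega>) p f / r ^ CARD('n)"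
    using Lp_fun_affine(2)[OF assms(1,2) _ assms(4-6)] assms(3) by simp
  then have "Lp_int (lebesgue_on \<omega>') p (\<lambda>y. f (x0 + r *\<^sub>R y)) powr (1 / p)
      \<le> ((1 / r ^ CARD('n)) * Lp_int (lebesgue_on \<omega>) p f) powr (1 / p)"
    using assms(3) by (intro powr_mono2) auto
  then show ?thesis using assms(2) by (simp add: Lp_norm_eq flip: powr_mult)
qed

lemma X_space_affine:
  assumes "u \<in> X_space p q \<omega>" "r > 0" "1 < p" "1 < q"
    and "\<omega> \<in> sets lebesgue" "\<omega>' \<in> sets lebesgue" "\<And>y. y \<in> \<omega>' \<Longrightarrow> x0 + r *\<^sub>R y \<in> \<omega>"
  shows "(\<lambda>y. u (x0 + r *\<^sub>R y)) \<in> X_space p q \<omega>'"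
  using Lp_fun_affine(1)[OF X_spaceD(1)[OF assms(1)] assms(2) _ assms(5-7)]
    Lp_fun_affine(1)[OF X_spaceD(2)[OF assms(1)] assms(2) _ assms(5-7)] assms(3,4)
  by (intro X_spaceI) auto

lemma bounded_functionalD:
  assumes "bounded_functional V N L"
  shows "f \<in> V \<Longrightarrow> g \<in> V \<Longrightarrow> L (\<lambda>x. f x + g x) = L f + L g"
    and "f \<in> V \<Longrightarrow> L (\<lambda>x. c *\<^sub>R f x) = c * L f"
  using assms by (auto simp: bounded_functional_def)

text \<open>Rescaling is linear and bounded from the fields on \<omega> to those on
  \<open>\<omega>'\<close>; a functional composed with it is a functional on the original
  space.\<close>

lemma weakly_convergent_affine:
  fixes u :: "nat \<Rightarrow> ('n::finite) fields"
  assumes w: "weakly_convergent_to (X_space p q \<omega>) (X_norm p q \<omega>) u u0"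
    and a: "r > 0" "1 < p" "1 < q" "\<omega> \<in> sets lebesgue" "\<omega>' \<in> sets lebesgue"
    and sub: "\<And>y. y \<in> \<omega>' \<Longrightarrow> x0 + r *\<^sub>R y \<in> \<omega>"
  shows "weakly_convergent_to (X_space p q \<omega>') (X_norm p q \<omega>') (\<lambda>m y. u m (x0 + r *\<^sub>R y)) (\<lambda>y. u0 (x0 + r *\<^sub>R y))"
  unfolding weakly_convergent_to_def
proof (intro conjI allI impI)
  have X: "(\<lambda>y. v (x0 + r *\<^sub>R y)) \<in> X_space p q \<omega>'" if "v \<in> X_space p q \<omega>" for v
    by (rule X_space_affine[OF that a sub])
  show "(\<lambda>y. u m (x0 + r *\<^sub>R y)) \<in> X_space p q \<omega>'" for m
    by (rule X[OF weakly_convergent_X_spaceD(1)[OF w]])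
  show "(\<lambda>y. u0 (x0 + r *\<^sub>R y)) \<in> X_space p q \<omega>'"
    by (rule X[OF weakly_convergent_X_spaceD(2)[OF w]])
  fix L assume L: "bounded_functional (X_space p q \<omega>') (X_norm p q \<omega>') L"
  obtain C where C: "\<And>v. v \<in> X_space p q \<omega>' \<Longrightarrow> \<bar>L v\<bar> \<le> C * X_norm p q \<omega>' v"
    using L unfolding bounded_functional_def by blast
  define c where "c = max ((1 / r ^ CARD('n)) powr (1 / p)) ((1 / r ^ CARD('n)) powr (1 / q))"
  define L' where "L' u = L (\<lambda>y. u (x0 + r *\<^sub>R y))" for u
  have "bounded_functional (X_space p q \<omega>) (X_norm p q \<omega>) L'"
    unfolding bounded_functional_def
  proof (intro conjI ballI allI exI)
    fix f g assume "f \<in> X_space p q \<omega>" "g \<in> X_space p q \<omega>"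
    from bounded_functionalD(1)[OF L X[OF this(1)] X[OF this(2)]]
    show "L' (\<lambda>x. f x + g x) = L' f + L' g" by (simp add: L'_def)
  next
    fix f and b :: real assume "f \<in> X_space p q \<omega>"
    from bounded_functionalD(2)[OF L X[OF this]]
    show "L' (\<lambda>x. b *\<^sub>R f x) = b * L' f" by (simp add: L'_def)
  next
    fix f assume f: "f \<in> X_space p q \<omega>"
    have c: "Lp_norm p \<omega>' (\<lambda>y. fst (f (x0 + r *\<^sub>R y))) \<le> c * Lp_norm p \<omega> (\<lambda>x. fst (f x))"
      "Lp_norm q \<omega>' (\<lambda>y. snd (f (x0 + r *\<^sub>R y))) \<le> c * Lp_norm q \<omega> (\<lambda>x. snd (f x))"
      using Lp_norm_affine[OF X_spaceD(1)[OF f] a(1,2,4,5) sub] Lp_norm_affine[OF X_spaceD(2)[OF f] a(1,3,4,5) sub]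
      by (auto simp: c_def intro: order_trans[OF _ mult_right_mono])
    have "\<bar>L' f\<bar> \<le> C * X_norm p q \<omega>' (\<lambda>y. f (x0 + r *\<^sub>R y))"
      unfolding L'_def by (rule C[OF X[OF f]])
    also have "\<dots> \<le> \<bar>C\<bar> * X_norm p q \<omega>' (\<lambda>y. f (x0 + r *\<^sub>R y))"
      by (intro mult_right_mono) (auto simp: X_norm_def)
    also have "\<dots> \<le> \<bar>C\<bar> * (c * X_norm p q \<omega> f)"
      using c by (intro mult_left_mono) (auto simp: X_norm_def distrib_left)
    finally show "\<bar>L' f\<bar> \<le> (\<bar>C\<bar> * c) * X_norm p q \<omega> f" by (simp only: mult.assoc)
  qed
  then have "(\<lambda>k. L' (u k)) \<longlonglongrightarrow> L' u0" using w by (simp add: weakly_convergent_to_def)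
  then show "(\<lambda>k. L (\<lambda>y. u k (x0 + r *\<^sub>R y))) \<longlonglongrightarrow> L (\<lambda>y. u0 (x0 + r *\<^sub>R y))"
    by (simp add: L'_def)
qed

text \<open>The map need not send \<omega> into \<open>\<omega>'\<close>. Since \<open>g\<close>
  vanishes outside \<open>\<omega>'\<close>, it is regarded as a function on the whole space, with
  the same integral.\<close>

lemma test_function_pullback_Lp_norm:
  fixes g :: "real ^ 'n \<Rightarrow> 'b::euclidean_space"
  assumes g: "g \<in> Lp_fun (lebesgue_on \<omega>') q" "\<And>x. x \<notin> \<omega>' \<Longrightarrow> g x = 0"
    and "r > 0" "1 < q" "\<omega> \<in> sets lebesgue" "\<omega>' \<in> sets lebesgue"
  shows "Lp_norm q \<omega> (\<lambda>x. g (a + r *\<^sub>R x)) \<le> (1 / r ^ CARD('n)) powr (1 / q) * Lp_norm q \<omega>' g"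
proof -
  have ind: "indicator \<omega>' x *\<^sub>R norm (g x) powr q = norm (g x) powr q" "indicator \<omega>' x *\<^sub>R g x = g x" for x
    using g(2)[of x] by (cases "x \<in> \<omega>'"; simp)+
  have s: "\<omega>' \<inter> space lebesgue \<in> sets lebesgue" using assms(6) by simp
  have m: "g \<in> borel_measurable lebesgue"
    using Lp_funD(1)[OF g(1)] unfolding borel_measurable_restrict_space_iff[OF s] ind .
  have eq: "Lp_int (lebesgue_on UNIV) q g = Lp_int (lebesgue_on \<omega>') q g"
    unfolding Lp_int_def integral_restrict_space[OF s] ind lebesgue_on_UNIV_eq ..
  have "integrable (lebesgue_on UNIV) (\<lambda>x. norm (g x) powr q)"
    using Lp_funD(2)[OF g(1)] unfolding integrable_restrict_space[OF s] ind lebesgue_on_UNIV_eq .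
  then have gU: "g \<in> Lp_fun (lebesgue_on UNIV) q" using m by (simp add: Lp_fun_def lebesgue_on_UNIV_eq)
  have "Lp_norm q \<omega> (\<lambda>x. g (a + r *\<^sub>R x)) \<le> (1 / r ^ CARD('n)) powr (1 / q) * Lp_norm q UNIV g"
    by (rule Lp_norm_affine[OF gU assms(3,4) _ assms(5)]) auto
  then show ?thesis by (simp add: Lp_norm_eq eq)
qed

text \<open>Each test function on \<open>\<omega>'\<close> is transported to \<omega> by the inverse
  map, and the change of variables moves the integral along. All factors depend on \<open>r\<close>
  but not on \<open>m\<close>, so the null sequence survives.\<close>

lemma test_convergent_affine:
  fixes f :: "nat \<Rightarrow> real ^ 'n \<Rightarrow> real ^ 'n"
  assumes conv: "test_convergent q \<omega> f f0" and q: "1 < q"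
    and f: "\<And>m. f m \<in> borel_measurable (lebesgue_on \<omega>)" "f0 \<in> borel_measurable (lebesgue_on \<omega>)"
    and r: "r > 0" and \<omega>: "\<omega> \<in> lmeasurable" "\<omega>' \<in> lmeasurable"
    and sub: "\<And>y. y \<in> \<omega>' \<Longrightarrow> x0 + r *\<^sub>R y \<in> \<omega>"
  shows "test_convergent q \<omega>' (\<lambda>m y. f m (x0 + r *\<^sub>R y)) (\<lambda>y. f0 (x0 + r *\<^sub>R y))"
proof -
  have s: "\<omega> \<in> sets lebesgue" "\<omega>' \<in> sets lebesgue" using \<omega> by (auto simp: fmeasurable_def)
  have r0: "r \<noteq> 0" using r by simp
  obtain \<epsilon> where \<epsilon>: "\<epsilon> \<longlonglongrightarrow> 0" "\<And>m \<phi>. \<phi> \<in> test_functions \<omega> \<Longrightarrow>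
      \<bar>\<integral>x. (f m x - f0 x) \<bullet> grad \<phi> x \<partial>lebesgue_on \<omega>\<bar> \<le> \<epsilon> m * W1_norm q \<omega> (with_grad \<phi>)"
    using conv unfolding test_convergent_def by blast
  define R where "R = r ^ CARD('n)"
  \<comment> \<open>\<open>b\<close> compares the Lebesgue norms of the transported functions.
    \<open>K\<close> combines it with the Jacobian \<open>1 / R\<close>, the factor \<open>r\<close>
    from the gradient under the integral and the factor \<open>1 / r\<close> in the gradient part of
    the Sobolev norm.\<close>
  define b where "b = (1 / (1 / r) ^ CARD('n)) powr (1 / q)"
  define K where "K = r / R * (b * max 1 (1 / r))"
  have R: "R > 0" using r by (simp add: R_def)
  have K: "K \<ge> 0" using r R by (simp add: K_def b_def)
  have "\<bar>\<integral>y. (f m (x0 + r *\<^sub>R y) - f0 (x0 + r *\<^sub>R y)) \<bullet> grad \<phi> y \<partial>lebesgue_on \<omega>'\<bar>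
      \<le> (K * \<bar>\<epsilon> m\<bar>) * W1_norm q \<omega>' (with_grad \<phi>)" if \<phi>: "\<phi> \<in> test_functions \<omega>'" for m \<phi>
  proof -
    define a where "a = - (1 / r) *\<^sub>R x0"
    \<comment> \<open>The factor 1 matches the form of \<open>test_function_affine\<close> and
      \<open>grad_affine\<close>.\<close>
    define \<Phi> where "\<Phi> x = 1 * \<phi> (a + (1 / r) *\<^sub>R x)" for x
    have \<Phi>: "\<Phi> \<in> test_functions \<omega>"
      unfolding \<Phi>_def a_def by (rule test_function_affine[OF \<phi> r0 sub])
    have g\<Phi>: "grad \<Phi> x = (1 / r) *\<^sub>R grad \<phi> (a + (1 / r) *\<^sub>R x)" for x
      using grad_affine[OF test_functionsD(1)[OF \<phi>], of 1 a "1 / r" x] by (simp add: \<Phi>_def[abs_def])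
    have inv: "a + (1 / r) *\<^sub>R (x0 + r *\<^sub>R y) = y" for y
      unfolding a_def scaleR_add_right scaleR_scaleR using r by simp
    define g where "g x = indicator \<omega> x *\<^sub>R ((f m x - f0 x) \<bullet> grad \<Phi> x)" for x
    have "grad \<Phi> \<in> borel_measurable (lebesgue_on \<omega>)"
      using Lp_funD(1)[OF test_function_Lp(2)[OF \<Phi> \<omega>(1) q[THEN less_trans[OF zero_less_one]]]] .
    then have "(\<lambda>x. (f m x - f0 x) \<bullet> grad \<Phi> x) \<in> borel_measurable (lebesgue_on \<omega>)"
      using f by (intro borel_measurable_inner borel_measurable_diff) auto
    then have gm: "g \<in> borel_measurable lebesgue"
      unfolding g_def using s by (subst borel_measurable_restrict_space_iff[symmetric]) auto
    have pt: "indicator \<omega>' y *\<^sub>R ((f m (x0 + r *\<^sub>R y) - f0 (x0 + r *\<^sub>R y)) \<bullet> grad \<phi> y) = r *\<^sub>R g (x0 + r *\<^sub>R y)" for y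
    proof (cases "y \<in> \<omega>'")
      case True
      then show ?thesis using sub[OF True] r0 by (simp add: g_def g\<Phi> inv)
    next
      case False
      then have "grad \<phi> y = 0" by (rule test_function_outside(2)[OF \<phi>])
      then show ?thesis using False by (simp add: g_def g\<Phi> inv)
    qed
    have "(\<integral>y. (f m (x0 + r *\<^sub>R y) - f0 (x0 + r *\<^sub>R y)) \<bullet> grad \<phi> y \<partial>lebesgue_on \<omega>')
        = (\<integral>y. r *\<^sub>R g (x0 + r *\<^sub>R y) \<partial>lebesgue)"
      unfolding pt[symmetric] using s by (subst integral_restrict_space) (auto simp only: sets.Int_space_eq2)
    also have "\<dots> = r / R * (\<integral>x. g x \<partial>lebesgue)"
      using integral_affine(2)[OF r0 gm, of x0] r R by (simp add: R_def)
    also have "(\<integral>x. g x \<partial>lebesgue) = (\<integral>x. (f m x - f0 x) \<bullet> grad \<Phi> x \<partial>lebesgue_on \<omega>)"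
      unfolding g_def using s by (subst integral_restrict_space) (auto simp only: sets.Int_space_eq2)
    finally have 1: "\<bar>\<integral>y. (f m (x0 + r *\<^sub>R y) - f0 (x0 + r *\<^sub>R y)) \<bullet> grad \<phi> y \<partial>lebesgue_on \<omega>'\<bar>
        = r / R * \<bar>\<integral>x. (f m x - f0 x) \<bullet> grad \<Phi> x \<partial>lebesgue_on \<omega>\<bar>"
      using r R by (simp add: abs_mult)
    have "\<bar>\<integral>x. (f m x - f0 x) \<bullet> grad \<Phi> x \<partial>lebesgue_on \<omega>\<bar> \<le> \<epsilon> m * W1_norm q \<omega> (with_grad \<Phi>)"
      by (rule \<epsilon>(2)[OF \<Phi>])
    also have "\<dots> \<le> \<bar>\<epsilon> m\<bar> * W1_norm q \<omega> (with_grad \<Phi>)" by (intro mult_right_mono) auto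
    finally have 2: "\<bar>\<integral>x. (f m x - f0 x) \<bullet> grad \<Phi> x \<partial>lebesgue_on \<omega>\<bar> \<le> \<bar>\<epsilon> m\<bar> * W1_norm q \<omega> (with_grad \<Phi>)" .
    have q0: "q > 0" and ir: "1 / r > 0" using q r by auto
    note L = test_function_Lp[OF \<phi> \<omega>(2) q0]
    have n1: "Lp_norm q \<omega> \<Phi> \<le> b * Lp_norm q \<omega>' \<phi>"
      using test_function_pullback_Lp_norm[OF L(1) test_function_outside(1)[OF \<phi>] ir q s, of a]
      by (simp add: b_def \<Phi>_def[abs_def])
    have "(\<lambda>x. grad \<phi> (a + (1 / r) *\<^sub>R x)) \<in> Lp_fun (lebesgue_on \<omega>) q"
    proof -
      have "(\<lambda>x. r *\<^sub>R grad \<Phi> x) \<in> Lp_fun (lebesgue_on \<omega>) q"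
        by (rule Lp_fun_scaleR(1)[OF test_function_Lp(2)[OF \<Phi> \<omega>(1) q0]])
      then show ?thesis using r0 by (simp add: g\<Phi>)
    qed
    then have "Lp_norm q \<omega> (grad \<Phi>) = (1 / r) * Lp_norm q \<omega> (\<lambda>x. grad \<phi> (a + (1 / r) *\<^sub>R x))"
      using Lp_norm_scaleR[of _ q \<omega> "1 / r"] q0 r by (simp add: g\<Phi>[abs_def] Lp_space_eq)
    also have "\<dots> \<le> (1 / r) * (b * Lp_norm q \<omega>' (grad \<phi>))"
      using test_function_pullback_Lp_norm[OF L(2) test_function_outside(2)[OF \<phi>] ir q s, of a] r
      unfolding b_def by (intro mult_left_mono) auto
    finally have n2: "Lp_norm q \<omega> (grad \<Phi>) \<le> (1 / r) * (b * Lp_norm q \<omega>' (grad \<phi>))" .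
    have b0: "b \<ge> 0" by (simp add: b_def)
    have "b * Lp_norm q \<omega>' \<phi> \<le> max 1 (1 / r) * (b * Lp_norm q \<omega>' \<phi>)"
      "(1 / r) * (b * Lp_norm q \<omega>' (grad \<phi>)) \<le> max 1 (1 / r) * (b * Lp_norm q \<omega>' (grad \<phi>))"
      using b0 mult_right_mono[of 1 "max 1 (1 / r)" "b * Lp_norm q \<omega>' \<phi>"]
        mult_right_mono[of "1 / r" "max 1 (1 / r)" "b * Lp_norm q \<omega>' (grad \<phi>)"] by simp_all
    then have 3: "W1_norm q \<omega> (with_grad \<Phi>) \<le> b * max 1 (1 / r) * W1_norm q \<omega>' (with_grad \<phi>)"
      using n1 n2 by (simp add: W1_norm_def with_grad_def distrib_left mult_ac)
    have "r / R * \<bar>\<integral>x. (f m x - f0 x) \<bullet> grad \<Phi> x \<partial>lebesgue_on \<omega>\<bar>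
        \<le> r / R * (\<bar>\<epsilon> m\<bar> * (b * max 1 (1 / r) * W1_norm q \<omega>' (with_grad \<phi>)))"
      using 2 3 r R by (intro mult_left_mono order_trans[OF 2]) auto
    also have "\<dots> = (K * \<bar>\<epsilon> m\<bar>) * W1_norm q \<omega>' (with_grad \<phi>)" by (simp add: K_def)
    finally show ?thesis using 1 by simp
  qed
  moreover have "(\<lambda>m. K * \<bar>\<epsilon> m\<bar>) \<longlonglongrightarrow> 0" using tendsto_mult_right_zero[OF tendsto_rabs_zero[OF \<epsilon>(1)]] .
  ultimately show ?thesis unfolding test_convergent_def by blast
qed

lemma div_curl_convergent_affine:
  assumes conv: "div_curl_convergent_to p q \<omega> u u0" and pq: "1 < p" "1 < q" "1 / p + 1 / q = 1"
    and r: "r > 0" and \<omega>: "\<omega> \<in> lmeasurable" "\<omega>' \<in> lmeasurable"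
    and sub: "\<And>y. y \<in> \<omega>' \<Longrightarrow> x0 + r *\<^sub>R y \<in> \<omega>"
  shows "div_curl_convergent_to p q \<omega>' (\<lambda>m y. u m (x0 + r *\<^sub>R y)) (\<lambda>y. u0 (x0 + r *\<^sub>R y))"
proof -
  have s: "\<omega> \<in> sets lebesgue" "\<omega>' \<in> sets lebesgue" using \<omega> by (auto simp: fmeasurable_def)
  note D = conv[unfolded div_curl_convergent_iff[OF pq \<omega>(1)]]
  have w: "weakly_convergent_to (X_space p q \<omega>) (X_norm p q \<omega>) u u0" using D by blast
  note X = X_spaceD[OF weakly_convergent_X_spaceD(1)[OF w]] X_spaceD[OF weakly_convergent_X_spaceD(2)[OF w]]
  have p0: "p \<ge> 0" "q \<ge> 0" using pq by auto
  note lin = Lp_fun_linear(1)[OF _ linear_curl_field p0(1)] Lp_fun_linear(1)[OF _ bounded_linear_vec_nth p0(2)]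
  have "test_convergent q \<omega>' (\<lambda>m y. curl_field i j k (fst (u m (x0 + r *\<^sub>R y)))) (\<lambda>y. curl_field i j k (fst (u0 (x0 + r *\<^sub>R y))))" for i j k
    by (rule test_convergent_affine[OF _ pq(2) Lp_funD(1)[OF lin(1)[OF X(1)]] Lp_funD(1)[OF lin(1)[OF X(3)]] r \<omega> sub])
      (use D in auto)
  moreover have "test_convergent p \<omega>' (\<lambda>m y. snd (u m (x0 + r *\<^sub>R y)) $ i) (\<lambda>y. snd (u0 (x0 + r *\<^sub>R y)) $ i)" for i
    by (rule test_convergent_affine[OF _ pq(1) Lp_funD(1)[OF lin(2)[OF X(2)]] Lp_funD(1)[OF lin(2)[OF X(4)]] r \<omega> sub])
      (use D in auto)
  ultimately show ?thesis
    unfolding div_curl_convergent_iff[OF pq \<omega>(2)]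
    using weakly_convergent_affine[OF w r pq(1,2) s sub] by blast
qed

section \<open>From closedness on the given domain to local closedness\<close>

lemma AE_lebesgue_on_affine:
  fixes x0 :: "'a::euclidean_space"
  assumes "AE x in lebesgue_on \<omega>. P x" "r \<noteq> 0" and s: "\<omega> \<in> sets lebesgue" "\<omega>' \<in> sets lebesgue"
    and sub: "\<And>y. y \<in> \<omega>' \<Longrightarrow> x0 + r *\<^sub>R y \<in> \<omega>"
  shows "AE y in lebesgue_on \<omega>'. P (x0 + r *\<^sub>R y)"
proof -
  have "AE x in lebesgue. x \<in> \<omega> \<longrightarrow> P x" using assms(1) s by (simp add: AE_restrict_space_iff)
  from AE_affine[OF assms(2) this, of x0] have "AE y in lebesgue. y \<in> \<omega>' \<longrightarrow> P (x0 + r *\<^sub>R y)"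
    by eventually_elim (use sub in blast)
  then show ?thesis using s by (simp add: AE_restrict_space_iff)
qed

lemma div_curl_closed_imp_locally:
  fixes \<Omega> :: "(real ^ 'n) set"
  assumes \<Omega>: "bounded \<Omega>" "open \<Omega>" "\<Omega> \<noteq> {}" and pq: "1 < p" "1 < q" "1 / p + 1 / q = 1"
    and closed: "div_curl_closed p q \<Omega> {u \<in> X_space p q \<Omega>. AE x in lebesgue_on \<Omega>. u x \<in> Dloc}"
  shows "locally_div_curl_closed p q Dloc"
  unfolding locally_div_curl_closed_def
proof (intro allI impI, elim conjE exE)
  fix \<omega> :: "(real ^ 'n) set" and F P u
  assume \<omega>: "bounded \<omega>" "\<omega> \<noteq> {}" "open \<omega>" and conv: "div_curl_convergent_to p q \<omega> u (\<lambda>_. (F, P))"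
    and D: "\<forall>m. AE x in lebesgue_on \<omega>. u m x \<in> Dloc"
  have lm: "\<omega> \<in> lmeasurable" "\<Omega> \<in> lmeasurable" using \<omega> \<Omega> by (auto intro: lmeasurable_open)
  have s: "\<omega> \<in> sets lebesgue" "\<Omega> \<in> sets lebesgue" using lm by (auto simp: fmeasurable_def)
  obtain x0 d where d: "d > 0" "ball x0 d \<subseteq> \<omega>" using \<omega> open_contains_ball by blast
  obtain R where R: "R > 0" "\<And>y. y \<in> \<Omega> \<Longrightarrow> norm y \<le> R" using \<Omega>(1) bounded_pos by blast
  \<comment> \<open>With \<open>R\<close> bounding the domain, the halved ratio places the rescaled
    points strictly inside the ball of radius \<open>d\<close>.\<close>
  define r where "r = d / (2 * R)"
  have r: "r > 0" "r \<noteq> 0" using d R by (auto simp: r_def)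
  have sub: "x0 + r *\<^sub>R y \<in> \<omega>" if "y \<in> \<Omega>" for y
  proof -
    have "norm (r *\<^sub>R y) \<le> r * R" using R(2)[OF that] r by simp
    also have "\<dots> < d" using d R by (simp add: r_def)
    finally show ?thesis using d(2) by (auto simp: dist_norm)
  qed
  let ?v = "\<lambda>m y. u m (x0 + r *\<^sub>R y)"
  have cv: "div_curl_convergent_to p q \<Omega> ?v (\<lambda>_. (F, P))"
    by (rule div_curl_convergent_affine[OF conv pq r(1) lm sub])
  have "?v m \<in> {u \<in> X_space p q \<Omega>. AE x in lebesgue_on \<Omega>. u x \<in> Dloc}" for m
  proof -
    have "?v m \<in> X_space p q \<Omega>"
      using cv by (auto simp: div_curl_convergent_to_def weakly_convergent_to_def)
    moreover have "AE y in lebesgue_on \<Omega>. ?v m y \<in> Dloc"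
      by (rule AE_lebesgue_on_affine[OF _ r(2) s sub]) (use D in auto)
    ultimately show ?thesis by blast
  qed
  with cv have "(\<lambda>_. (F, P)) \<in> {u \<in> X_space p q \<Omega>. AE x in lebesgue_on \<Omega>. u x \<in> Dloc}"
    by (intro closed[unfolded div_curl_closed_def, rule_format, of ?v]) simp
  then have "AE x in lebesgue_on \<Omega>. (F, P) \<in> Dloc" by simp
  then have ae: "AE x in lebesgue. x \<in> \<Omega> \<longrightarrow> (F, P) \<in> Dloc" using s by (simp add: AE_restrict_space_iff)
  \<comment> \<open>The condition under the almost-everywhere quantifier is constant; its failure
    would make the nonempty open set \<Omega> a null set.\<close>
  show "(F, P) \<in> Dloc"
  proof (rule ccontr)
    assume "(F, P) \<notin> Dloc"
    with ae have "AE x in lebesgue. x \<notin> \<Omega>" by simp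
    then have "\<Omega> \<in> null_sets lebesgue" using s by (simp add: AE_iff_null_sets)
    then show False using open_not_negligible[OF \<Omega>(2,3)] by (simp add: negligible_iff_null_sets)
  qed
qed

subsection \<open>Averages over small balls\<close>

lemma ennreal_Lp_int:
  "f \<in> Lp_fun M p \<Longrightarrow> ennreal (Lp_int M p f) = (\<integral>\<^sup>+x. ennreal (norm (f x) powr p) \<partial>M)"
  unfolding Lp_int_def by (intro nn_integral_eq_integral[symmetric] Lp_funD) auto

text \<open>Written over the unit ball, the domain of the blown-up fields, and not normalised: the
  measure of that ball stays as a finite constant.\<close>

definition ball_average :: "real \<Rightarrow> ('a::euclidean_space \<Rightarrow> ennreal) \<Rightarrow> 'a \<Rightarrow> ennreal" where
  "ball_average r f x = (\<integral>\<^sup>+y. f (x + r *\<^sub>R y) * indicator (ball 0 1) y \<partial>lebesgue)"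

text \<open>Exchanging the integrals leaves a translate of \<open>f\<close> for each fixed
  \<open>y\<close>, whose integral is independent of \<open>r\<close> and \<open>y\<close>. This
  uniformity in the radius drives both uses of averages.\<close>

lemma ball_average_measurable_integral:
  fixes f :: "'a::euclidean_space \<Rightarrow> ennreal"
  assumes f: "f \<in> borel_measurable lebesgue" and r: "r \<noteq> 0"
  shows "ball_average r f \<in> borel_measurable lebesgue"
    and "(\<integral>\<^sup>+x. ball_average r f x \<partial>lebesgue) = emeasure lebesgue (ball (0::'a) 1) * (\<integral>\<^sup>+x. f x \<partial>lebesgue)"
proof -
  \<comment> \<open>Joint measurability of the integrand on the product needs a Borel
    representative; \<open>AE_affine\<close> shows that the averages do not notice the
    replacement.\<close>
  obtain g where [measurable]: "g \<in> borel_measurable lborel" and ae: "AE x in lborel. f x = g x"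
    using completion_ex_borel_measurable[OF f] by blast
  have ae': "AE x in lebesgue. f x = g x" by (rule AE_completion[OF ae])
  have avg: "ball_average r f x = (\<integral>\<^sup>+y. g (x + r *\<^sub>R y) * indicator (ball 0 1) y \<partial>lborel)" for x
  proof -
    have "ball_average r f x = (\<integral>\<^sup>+y. g (x + r *\<^sub>R y) * indicator (ball 0 1) y \<partial>lebesgue)"
      unfolding ball_average_def
      by (intro nn_integral_cong_AE) (use AE_affine[OF r ae', of x] in eventually_elim, simp)
    then show ?thesis by (simp add: nn_integral_completion)
  qed
  have [measurable]: "(\<lambda>(x, y). g (x + r *\<^sub>R y) * indicator (ball 0 1) y) \<in> borel_measurable (lborel \<Otimes>\<^sub>M lborel)"
  proof -
    have "(\<lambda>z. g (fst z + r *\<^sub>R snd z)) \<in> borel_measurable (lborel \<Otimes>\<^sub>M lborel)"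
      by measurable
    moreover have "(\<lambda>z. indicator (ball 0 1) (snd z) :: ennreal) \<in> borel_measurable (lborel \<Otimes>\<^sub>M lborel)"
      by (rule measurable_compose[OF measurable_snd]) (auto intro!: borel_measurable_indicator)
    ultimately show ?thesis unfolding split_beta by (rule borel_measurable_times_ennreal)
  qed
  have "(\<lambda>x. \<integral>\<^sup>+y. g (x + r *\<^sub>R y) * indicator (ball 0 1) y \<partial>lborel) \<in> borel_measurable lborel"
    by measurable
  then show "ball_average r f \<in> borel_measurable lebesgue"
    unfolding avg[abs_def] by (rule measurable_completion)
  have "(\<integral>\<^sup>+x. ball_average r f x \<partial>lebesgue) =
      (\<integral>\<^sup>+x. (\<integral>\<^sup>+y. g (x + r *\<^sub>R y) * indicator (ball 0 1) y \<partial>lborel) \<partial>lborel)"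
    unfolding avg by (rule nn_integral_completion)
  also have "\<dots> = (\<integral>\<^sup>+y. (\<integral>\<^sup>+x. g (x + r *\<^sub>R y) * indicator (ball 0 1) y \<partial>lborel) \<partial>lborel)"
    by (rule lborel_pair.Fubini'[symmetric]) measurable
  also have "\<dots> = (\<integral>\<^sup>+y. (\<integral>\<^sup>+x. f x \<partial>lebesgue) * indicator (ball (0::'a) 1) y \<partial>lborel)"
  proof (intro nn_integral_cong)
    fix y :: 'a
    have "(\<integral>\<^sup>+x. g (x + r *\<^sub>R y) \<partial>lborel) = (\<integral>\<^sup>+x. g (r *\<^sub>R y + 1 *\<^sub>R x) \<partial>lebesgue)"
      by (simp add: nn_integral_completion add.commute)
    also have "\<dots> = (\<integral>\<^sup>+x. g x \<partial>lebesgue)"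
      using nn_integral_affine[of 1 g "r *\<^sub>R y"] by (simp add: measurable_completion)
    also have "\<dots> = (\<integral>\<^sup>+x. f x \<partial>lebesgue)"
      by (rule nn_integral_cong_AE) (use ae' in eventually_elim, simp)
    finally show "(\<integral>\<^sup>+x. g (x + r *\<^sub>R y) * indicator (ball 0 1) y \<partial>lborel)
        = (\<integral>\<^sup>+x. f x \<partial>lebesgue) * indicator (ball (0::'a) 1) y"
      by (simp add: nn_integral_multc)
  qed
  also have "\<dots> = emeasure lebesgue (ball (0::'a) 1) * (\<integral>\<^sup>+x. f x \<partial>lebesgue)"
    by (subst nn_integral_cmult_indicator) (auto simp: mult.commute)
  finally show "(\<integral>\<^sup>+x. ball_average r f x \<partial>lebesgue) = emeasure lebesgue (ball (0::'a) 1) * (\<integral>\<^sup>+x. f x \<partial>lebesgue)" .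
qed

lemma emeasure_ball_lt_top: "emeasure lebesgue (ball (0::'a::euclidean_space) 1) < top"
  using lmeasurable_ball[of "0::'a" 1] by (auto simp: fmeasurable_def)

lemma liminf_less_imp_frequently:
  fixes a :: "nat \<Rightarrow> ennreal"
  assumes "liminf a < K"
  shows "\<exists>i\<ge>N. a i < K"
proof (rule ccontr)
  assume "\<not> ?thesis"
  then have "\<forall>\<^sub>F i in sequentially. K \<le> a i" by (auto simp: eventually_sequentially not_less)
  then have "K \<le> liminf a" by (rule Liminf_bounded)
  with assms show False by simp
qed

text \<open>Fatou's lemma, applied once in \<open>k\<close> and once in \<open>i\<close>, replaces the differentiation of the weak
  limit of the measures \<open>f k\<close>.\<close>

lemma AE_frequently_bounded_ball_average:
  fixes f :: "nat \<Rightarrow> 'a::euclidean_space \<Rightarrow> ennreal" and r :: "nat \<Rightarrow> real"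
  assumes f: "\<And>k. f k \<in> borel_measurable lebesgue" "\<And>k. (\<integral>\<^sup>+x. f k x \<partial>lebesgue) \<le> C"
    and C: "C < top" and r: "\<And>i. r i \<noteq> 0"
  shows "AE x in lebesgue. \<exists>K<top. \<forall>N. \<exists>i\<ge>N. \<forall>N'. \<exists>k\<ge>N'. ball_average (r i) (f k) x < K"
proof -
  let ?B = "emeasure lebesgue (ball (0::'a) 1)"
  note [measurable] = ball_average_measurable_integral(1)[OF f(1) r]
  define H where "H i x = liminf (\<lambda>k. ball_average (r i) (f k) x)" for i x
  have [measurable]: "H i \<in> borel_measurable lebesgue" for i unfolding H_def by measurable
  have "(\<integral>\<^sup>+x. H i x \<partial>lebesgue) \<le> ?B * C" for i
  proof -
    have "(\<integral>\<^sup>+x. H i x \<partial>lebesgue) \<le> liminf (\<lambda>k. \<integral>\<^sup>+x. ball_average (r i) (f k) x \<partial>lebesgue)"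
      unfolding H_def by (rule nn_integral_liminf) measurable
    also have "\<dots> \<le> liminf (\<lambda>k::nat. ?B * C)"
      using f(2) by (intro Liminf_mono always_eventually allI)
        (simp add: ball_average_measurable_integral(2)[OF f(1) r] mult_left_mono)
    finally show ?thesis by (simp add: Liminf_const)
  qed
  then have "liminf (\<lambda>i. \<integral>\<^sup>+x. H i x \<partial>lebesgue) \<le> liminf (\<lambda>i::nat. ?B * C)"
    by (intro Liminf_mono always_eventually allI)
  moreover have "(\<integral>\<^sup>+x. liminf (\<lambda>i. H i x) \<partial>lebesgue) \<le> liminf (\<lambda>i. \<integral>\<^sup>+x. H i x \<partial>lebesgue)"
    by (rule nn_integral_liminf) measurable
  ultimately have "(\<integral>\<^sup>+x. liminf (\<lambda>i. H i x) \<partial>lebesgue) \<le> ?B * C"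
    by (simp add: Liminf_const)
  moreover have "?B * C < top" using emeasure_ball_lt_top[where 'a = 'a] C by (simp add: ennreal_mult_less_top)
  ultimately have "(\<integral>\<^sup>+x. liminf (\<lambda>i. H i x) \<partial>lebesgue) \<noteq> \<infinity>" by (auto simp: top_unique)
  then have "AE x in lebesgue. liminf (\<lambda>i. H i x) \<noteq> \<infinity>"
    by (intro nn_integral_PInf_AE) measurable
  then show ?thesis
  proof eventually_elim
    fix x assume "liminf (\<lambda>i. H i x) \<noteq> \<infinity>"
    then have "liminf (\<lambda>i. H i x) < top" by (simp add: less_top)
    \<comment> \<open>A value strictly between makes both lower limits strictly smaller than the
      same \<open>K\<close>, hence the terms infinitely often smaller.\<close>
    then obtain K where K: "liminf (\<lambda>i. H i x) < K" "K < top" using dense by blast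
    have "\<exists>i\<ge>N. \<forall>N'. \<exists>k\<ge>N'. ball_average (r i) (f k) x < K" for N
      using liminf_less_imp_frequently[OF K(1), of N] liminf_less_imp_frequently unfolding H_def by blast
    with K(2) show "\<exists>K<top. \<forall>N. \<exists>i\<ge>N. \<forall>N'. \<exists>k\<ge>N'. ball_average (r i) (f k) x < K" by blast
  qed
qed

lemma ennreal_suminf_tendsto_0:
  fixes a :: "nat \<Rightarrow> ennreal"
  assumes "(\<Sum>i. a i) \<noteq> top"
  shows "a \<longlonglongrightarrow> 0"
proof -
  have "a i \<noteq> top" for i using ennreal_suminf_lessD[of a top i] assms by (auto simp: less_top)
  then have a: "a = (\<lambda>i. ennreal (enn2real (a i)))" by (simp add: fun_eq_iff less_top)
  have "summable (\<lambda>i. enn2real (a i))"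
    by (rule summable_suminf_not_top) (use assms a in auto)
  then have "(\<lambda>i. ennreal (enn2real (a i))) \<longlonglongrightarrow> ennreal 0"
    by (intro tendsto_ennrealI summable_LIMSEQ_zero)
  then show ?thesis using a by simp
qed

text \<open>Approximate \<open>f\<close> by continuous \<open>g i\<close> with summable errors; averaging preserves integrals, so the
  averaged errors are summable at almost every \<open>x\<close>, while \<open>\<rho> i\<close> controls the oscillation of \<open>g i\<close>.\<close>

lemma Lp_Lebesgue_points:
  fixes f :: "'a::euclidean_space \<Rightarrow> 'b::euclidean_space"
  assumes \<omega>: "bounded \<omega>" "open \<omega>" and f: "f \<in> Lp_fun (lebesgue_on \<omega>) p" and p: "p > 0"
  obtains \<rho> :: "nat \<Rightarrow> real" where "\<And>i. \<rho> i > 0"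
    "\<And>r. (\<And>i. 0 < r i \<and> r i \<le> \<rho> i) \<Longrightarrow> r \<longlonglongrightarrow> 0 \<Longrightarrow> AE x in lebesgue. x \<in> \<omega> \<longrightarrow>
       (\<lambda>i. Lp_int (lebesgue_on (ball 0 1)) p (\<lambda>y. f (x + r i *\<^sub>R y) - f x)) \<longlonglongrightarrow> 0"
proof -
  have lm: "\<omega> \<in> lmeasurable" using \<omega> by (rule lmeasurable_open)
  have s: "\<omega> \<in> sets lebesgue" using lm by (auto simp: fmeasurable_def)
  obtain R where R: "\<And>x. x \<in> \<omega> \<Longrightarrow> norm x \<le> R" using \<omega>(1) by (auto simp: bounded_iff)
  have "\<exists>g. continuous_on UNIV g \<and> g \<in> Lp_fun (lebesgue_on \<omega>) p \<and>
      Lp_int (lebesgue_on \<omega>) p (\<lambda>x. g x - f x) < (1/2) ^ i" for i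
  proof -
    have "(1/2::real) ^ i > 0" by simp
    from Lp_fun_continuous_approx[OF lm f p this] show ?thesis by blast
  qed
  then obtain g where g: "\<And>i. continuous_on UNIV (g i)" "\<And>i. g i \<in> Lp_fun (lebesgue_on \<omega>) p"
    "\<And>i. Lp_int (lebesgue_on \<omega>) p (\<lambda>x. g i x - f x) < (1/2) ^ i" by metis
  \<comment> \<open>The points of \<omega> have norm at most \<open>R\<close> and the radii will be
    at most 1, so one compact ball contains all points to be compared.\<close>
  have "\<exists>d>0. \<forall>x\<in>cball 0 (R + 1). \<forall>x'\<in>cball 0 (R + 1). dist x' x < d \<longrightarrow> dist (g i x') (g i x) < (1/2) ^ i" for i
  proof -
    have "uniformly_continuous_on (cball 0 (R + 1)) (g i)"
      by (rule compact_uniformly_continuous[OF continuous_on_subset[OF g(1)]]) auto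
    moreover have "(1/2::real) ^ i > 0" by simp
    ultimately show ?thesis unfolding uniformly_continuous_on_def by blast
  qed
  then obtain d where d: "\<And>i. d i > 0" "\<And>i x x'. x \<in> cball 0 (R + 1) \<Longrightarrow> x' \<in> cball 0 (R + 1) \<Longrightarrow>
      dist x' x < d i \<Longrightarrow> dist (g i x') (g i x) < (1/2) ^ i" by metis
  \<comment> \<open>The error is cut off outside \<omega>, where the values of \<open>f\<close> are
    arbitrary; averages near the boundary then remain harmless.\<close>
  define e where "e i x = ennreal (norm (g i x - f x) powr p) * indicator \<omega> x" for i x
  have e_Lp: "(\<lambda>x. g i x - f x) \<in> Lp_fun (lebesgue_on \<omega>) p" for i
    using p by (intro Lp_fun_diff g f) auto
  have em[measurable]: "e i \<in> borel_measurable lebesgue" for i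
  proof -
    have "(\<lambda>x. ennreal (norm (g i x - f x) powr p)) \<in> borel_measurable (lebesgue_on \<omega>)"
      using Lp_funD(1)[OF e_Lp[of i]] by measurable
    then show ?thesis unfolding e_def using s by (subst (asm) borel_measurable_restrict_space_iff_ennreal) auto
  qed
  have e_int: "(\<integral>\<^sup>+x. e i x \<partial>lebesgue) \<le> ennreal ((1/2) ^ i)" for i
  proof -
    have "(\<integral>\<^sup>+x. e i x \<partial>lebesgue) = ennreal (Lp_int (lebesgue_on \<omega>) p (\<lambda>x. g i x - f x))"
      unfolding ennreal_Lp_int[OF e_Lp] e_def using s by (subst nn_integral_restrict_space) auto
    also have "\<dots> \<le> ennreal ((1/2) ^ i)" using g(3)[of i] by (intro ennreal_leI) simp
    finally show ?thesis .
  qed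
  let ?B = "emeasure lebesgue (ball (0::'a) 1)"
  show ?thesis
  proof (rule that[of "\<lambda>i. min 1 (d i)"])
    show "min 1 (d i) > 0" for i using d(1)[of i] by simp
    fix r :: "nat \<Rightarrow> real" assume r: "\<And>i. 0 < r i \<and> r i \<le> min 1 (d i)" and r0: "r \<longlonglongrightarrow> 0"
    have rn: "r i \<noteq> 0" for i using r[of i] by simp
    note bm[measurable] = ball_average_measurable_integral(1)[OF \<open>e _ \<in> borel_measurable lebesgue\<close> rn]
    \<comment> \<open>The averaged error controls \<open>f - g i\<close> at the shifted points, the
      plain error controls it at the centre. Summing both yields a single exceptional null set for
      all \<open>i\<close>.\<close>
    have "(\<integral>\<^sup>+x. (\<Sum>i. ball_average (r i) (e i) x + e i x) \<partial>lebesgue)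
        = (\<Sum>i. \<integral>\<^sup>+x. ball_average (r i) (e i) x + e i x \<partial>lebesgue)"
      by (rule nn_integral_suminf) measurable
    also have "\<dots> = (\<Sum>i. (?B + 1) * (\<integral>\<^sup>+x. e i x \<partial>lebesgue))"
      by (simp add: nn_integral_add ball_average_measurable_integral(2)[OF _ rn] distrib_right)
    also have "\<dots> \<le> (\<Sum>i. (?B + 1) * ennreal ((1/2) ^ i))"
      by (intro suminf_le mult_left_mono e_int) auto
    also have "\<dots> = (?B + 1) * ennreal (\<Sum>i. (1/2) ^ i)"
      by (simp add: suminf_ennreal2 summable_geometric)
    also have "\<dots> < top" using emeasure_ball_lt_top[where 'a = 'a] by (simp add: ennreal_mult_less_top)
    finally have "(\<integral>\<^sup>+x. (\<Sum>i. ball_average (r i) (e i) x + e i x) \<partial>lebesgue) \<noteq> \<infinity>" by simp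
    then have "AE x in lebesgue. (\<Sum>i. ball_average (r i) (e i) x + e i x) \<noteq> \<infinity>"
      by (intro nn_integral_PInf_AE) measurable
    then show "AE x in lebesgue. x \<in> \<omega> \<longrightarrow>
       (\<lambda>i. Lp_int (lebesgue_on (ball 0 1)) p (\<lambda>y. f (x + r i *\<^sub>R y) - f x)) \<longlonglongrightarrow> 0"
    proof (eventually_elim, intro impI)
      fix x assume "(\<Sum>i. ball_average (r i) (e i) x + e i x) \<noteq> \<infinity>" and x: "x \<in> \<omega>"
      then have lim: "(\<lambda>i. ball_average (r i) (e i) x + e i x) \<longlonglongrightarrow> 0"
        by (intro ennreal_suminf_tendsto_0) simp
      have lim1: "(\<lambda>i. ball_average (r i) (e i) x) \<longlonglongrightarrow> 0"
        by (rule tendsto_sandwich[OF _ _ tendsto_const lim]) auto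
      have lim2: "(\<lambda>i. e i x) \<longlonglongrightarrow> 0"
        by (rule tendsto_sandwich[OF _ _ tendsto_const lim]) auto
      obtain \<delta> where \<delta>: "\<delta> > 0" "ball x \<delta> \<subseteq> \<omega>" using \<omega>(2) x open_contains_ball by blast
      \<comment> \<open>The three terms stand for the error at the shifted point, the oscillation of
        \<open>g i\<close>, and the error at the centre; \<open>4 powr p\<close> results from using
        \<open>norm_add_powr_le\<close> twice.\<close>
      define h where "h i = ennreal (4 powr p) * (ball_average (r i) (e i) x + ennreal (((1/2) ^ i) powr p) * ?B + e i x * ?B)" for i
      have "\<forall>\<^sub>F i in sequentially. r i < \<delta>" by (rule order_tendstoD(2)[OF r0 \<delta>(1)])
      then have "\<forall>\<^sub>F i in sequentially.
          ennreal (Lp_int (lebesgue_on (ball 0 1)) p (\<lambda>y. f (x + r i *\<^sub>R y) - f x)) \<le> h i"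
      proof eventually_elim
        fix i assume i: "r i < \<delta>"
        have sub: "x + r i *\<^sub>R y \<in> \<omega>" if "y \<in> ball 0 1" for y
        proof -
          have "norm (r i *\<^sub>R y) \<le> r i" using that r[of i] by (simp add: mult_left_le)
          then have "norm (r i *\<^sub>R y) < \<delta>" using i by linarith
          then show ?thesis using \<delta>(2) by (auto simp: dist_norm)
        qed
        have fL: "(\<lambda>y. f (x + r i *\<^sub>R y) - f x) \<in> Lp_fun (lebesgue_on (ball 0 1)) p"
          using p r[of i] s
          by (intro Lp_fun_diff Lp_fun_affine(1)[OF f _ _ s _ sub] Lp_fun_const finite_measure_lebesgue_on lmeasurable_ball) auto
        have pt: "ennreal (norm (f (x + r i *\<^sub>R y) - f x) powr p)
            \<le> ennreal (4 powr p) * (e i (x + r i *\<^sub>R y) + ennreal (((1/2) ^ i) powr p) + e i x)"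
          if y: "y \<in> ball 0 1" for y
        proof -
          let ?a = "f (x + r i *\<^sub>R y) - g i (x + r i *\<^sub>R y)"
          let ?b = "g i (x + r i *\<^sub>R y) - g i x" and ?c = "g i x - f x"
          have n: "norm (r i *\<^sub>R y) < r i" using y r[of i] by simp
          have nR: "norm (x + r i *\<^sub>R y) \<le> R + 1"
            using norm_triangle_ineq[of x "r i *\<^sub>R y"] R[OF x] n r[of i] by linarith
          have "dist (g i (x + r i *\<^sub>R y)) (g i x) < (1/2) ^ i"
          proof (intro d(2))
            show "x \<in> cball 0 (R + 1)" using R[OF x] by simp
            show "x + r i *\<^sub>R y \<in> cball 0 (R + 1)"
              using nR unfolding mem_cball_0 .
            show "dist (x + r i *\<^sub>R y) x < d i"
              using n r[of i] unfolding dist_norm add_diff_cancel_left' by linarith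
          qed
          then have b: "norm ?b powr p \<le> ((1/2) ^ i) powr p"
            using p by (intro powr_mono2) (auto simp: dist_norm)
          have "norm (f (x + r i *\<^sub>R y) - f x) powr p = norm (?a + (?b + ?c)) powr p" by simp
          also have "\<dots> \<le> 2 powr p * (norm ?a powr p + norm (?b + ?c) powr p)"
            using p by (intro norm_add_powr_le) auto
          also have "\<dots> \<le> 2 powr p * (norm ?a powr p + 2 powr p * (norm ?b powr p + norm ?c powr p))"
            using p by (intro mult_left_mono add_left_mono norm_add_powr_le) auto
          also have "\<dots> \<le> 2 powr p * (2 powr p * norm ?a powr p + 2 powr p * (((1/2) ^ i) powr p + norm ?c powr p))"
          proof -
            have "1 \<le> (2::real) powr p" using p by (simp add: ge_one_powr_ge_zero)
            then have "norm ?a powr p \<le> 2 powr p * norm ?a powr p"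
              using mult_right_mono[of 1 "2 powr p" "norm ?a powr p"] by simp
            then show ?thesis using b by (intro mult_left_mono add_mono) auto
          qed
          also have "\<dots> = 4 powr p * (norm ?a powr p + ((1/2) ^ i) powr p + norm ?c powr p)"
          proof -
            have "(4::real) powr p = 2 powr p * 2 powr p" by (simp flip: powr_mult)
            then show ?thesis by (simp add: algebra_simps)
          qed
          finally have "ennreal (norm (f (x + r i *\<^sub>R y) - f x) powr p) \<le>
              ennreal (4 powr p * (norm ?a powr p + ((1/2) ^ i) powr p + norm ?c powr p))"
            by (rule ennreal_leI)
          also have "\<dots> = ennreal (4 powr p) * (e i (x + r i *\<^sub>R y) + ennreal (((1/2) ^ i) powr p) + e i x)"
          proof -
            have "e i (x + r i *\<^sub>R y) = ennreal (norm ?a powr p)"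
              using sub[OF y] norm_minus_commute[of "f (x + r i *\<^sub>R y)"] by (simp only: e_def indicator_simps mult_1_right)
            moreover have "e i x = ennreal (norm ?c powr p)" using x by (simp only: e_def indicator_simps mult_1_right)
            ultimately show ?thesis by (simp add: ennreal_mult)
          qed
          finally show ?thesis .
        qed
        note T[measurable] = affine_measurable_lebesgue[OF rn, of x i]
        have "ennreal (Lp_int (lebesgue_on (ball 0 1)) p (\<lambda>y. f (x + r i *\<^sub>R y) - f x))
            = (\<integral>\<^sup>+y. ennreal (norm (f (x + r i *\<^sub>R y) - f x) powr p) * indicator (ball 0 1) y \<partial>lebesgue)"
          unfolding ennreal_Lp_int[OF fL] by (subst nn_integral_restrict_space) auto
        also have "\<dots> \<le> (\<integral>\<^sup>+y. ennreal (4 powr p) * (e i (x + r i *\<^sub>R y) * indicator (ball 0 1) y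
            + ennreal (((1/2) ^ i) powr p) * indicator (ball 0 1) y + e i x * indicator (ball 0 1) y) \<partial>lebesgue)"
        proof (intro nn_integral_mono)
          fix y
          show "ennreal (norm (f (x + r i *\<^sub>R y) - f x) powr p) * indicator (ball 0 1) y \<le>
            ennreal (4 powr p) * (e i (x + r i *\<^sub>R y) * indicator (ball 0 1) y
            + ennreal (((1/2) ^ i) powr p) * indicator (ball 0 1) y + e i x * indicator (ball 0 1) y)"
          proof (cases "y \<in> ball 0 1")
            case True
            from pt[OF this] show ?thesis by (simp only: indicator_simps(1)[OF True] mult_1_right)
          next
            case False
            then show ?thesis by (simp only: indicator_simps(2)[OF False] mult_zero_right zero_le)
          qed
        qed
        also have "\<dots> = h i"
        proof -
          have m1: "(\<lambda>y. e i (x + r i *\<^sub>R y) * indicator (ball 0 1) y) \<in> borel_measurable lebesgue"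
            by (intro borel_measurable_times_ennreal borel_measurable_indicator measurable_compose[OF T em]) simp
          have m2: "(\<lambda>y. c * indicator (ball (0::'a) 1) y) \<in> borel_measurable lebesgue" for c :: ennreal
            by (intro borel_measurable_times_ennreal borel_measurable_indicator borel_measurable_const) simp
          have i2: "(\<integral>\<^sup>+y. c * indicator (ball (0::'a) 1) y \<partial>lebesgue) = c * ?B" for c :: ennreal
            by (rule nn_integral_cmult_indicator) simp
          show ?thesis
            by (simp only: h_def ball_average_def
                nn_integral_cmult[OF borel_measurable_add[OF borel_measurable_add[OF m1 m2] m2]]
                nn_integral_add[OF borel_measurable_add[OF m1 m2] m2] nn_integral_add[OF m1 m2] i2)
        qed
        finally show "ennreal (Lp_int (lebesgue_on (ball 0 1)) p (\<lambda>y. f (x + r i *\<^sub>R y) - f x)) \<le> h i" .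
      qed
      moreover have "h \<longlonglongrightarrow> 0"
      proof -
        have "(\<lambda>i. (1/2::real) ^ i) \<longlonglongrightarrow> 0" by (rule LIMSEQ_realpow_zero) auto
        from tendsto_zero_powrI[OF this tendsto_const[of p]] p
        have "(\<lambda>i. ((1/2) ^ i) powr p) \<longlonglongrightarrow> (0::real)" by simp
        then have "(\<lambda>i. ennreal (((1/2) ^ i) powr p)) \<longlonglongrightarrow> ennreal 0" by (rule tendsto_ennrealI)
        from ennreal_tendsto_cmult[OF emeasure_ball_lt_top this]
        have 1: "(\<lambda>i. ennreal (((1/2) ^ i) powr p) * ?B) \<longlonglongrightarrow> 0" by (simp add: mult.commute)
        have 2: "(\<lambda>i. e i x * ?B) \<longlonglongrightarrow> 0"
          using ennreal_tendsto_cmult[OF emeasure_ball_lt_top lim2] by (simp add: mult.commute)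
        have "(\<lambda>i. ball_average (r i) (e i) x + ennreal (((1/2) ^ i) powr p) * ?B + e i x * ?B) \<longlonglongrightarrow> 0 + 0 + 0"
          by (intro tendsto_add lim1 1 2)
        from ennreal_tendsto_cmult[OF _ this, of "ennreal (4 powr p)"] show ?thesis
          unfolding h_def[abs_def] by simp
      qed
      ultimately have "(\<lambda>i. ennreal (Lp_int (lebesgue_on (ball 0 1)) p (\<lambda>y. f (x + r i *\<^sub>R y) - f x))) \<longlonglongrightarrow> 0"
        by (rule tendsto_sandwich[OF _ _ tendsto_const, rotated]) simp
      then show "(\<lambda>i. Lp_int (lebesgue_on (ball 0 1)) p (\<lambda>y. f (x + r i *\<^sub>R y) - f x)) \<longlonglongrightarrow> 0"
        by (simp add: ennreal_tendsto_0_iff)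
    qed
  qed
qed

subsection \<open>Diagonal sequences\<close>

text \<open>On each fixed set of the generator, \<open>g m\<close> eventually tracks
  \<open>h m\<close>, which tends strongly to \<open>c\<close>. The bound \<open>K\<close> upgrades
  this to all test functions, and \<open>bounded_functional_tendsto_0\<close> to all
  functionals.\<close>

lemma bounded_functional_diagonal:
  fixes g h :: "nat \<Rightarrow> 'a::euclidean_space \<Rightarrow> 'b::euclidean_space"
  assumes pq: "1 < p" "1 < q" "1 / p + 1 / q = 1" and \<omega>: "\<omega> \<in> lmeasurable" and M: "M = lebesgue_on \<omega>"
    and G: "Int_stable (range G)" "UNIV \<in> range G" "sets borel = sigma_sets UNIV (range G)"
    and g: "\<And>m. g m \<in> Lp_fun M p" "\<And>m. Lp_int M p (g m) \<le> K"
    and h: "\<And>m. h m \<in> Lp_fun M p" "c \<in> Lp_fun M p" "(\<lambda>m. Lp_int M p (\<lambda>x. h m x - c x)) \<longlonglongrightarrow> 0"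
    and close: "\<And>m n. n \<le> m \<Longrightarrow> norm (\<integral>x. indicator (G n) x *\<^sub>R (g m x - h m x) \<partial>M) \<le> 1 / real (Suc m)"
    and L: "bounded_functional (Lp_fun M p) (\<lambda>f. Lp_int M p f powr (1 / p)) L"
  shows "(\<lambda>m. L (\<lambda>x. g m x - c x)) \<longlonglongrightarrow> 0"
proof -
  have fm: "finite_measure M" unfolding M by (rule finite_measure_lebesgue_on[OF \<omega>])
  have p0: "p \<ge> 0" using pq by simp
  have gc: "(\<lambda>x. g m x - c x) \<in> Lp_fun M p" "Lp_int M p (\<lambda>x. g m x - c x) \<le> 2 powr p * (K + Lp_int M p c)" for m
  proof -
    show "(\<lambda>x. g m x - c x) \<in> Lp_fun M p" by (rule Lp_fun_diff(1)[OF g(1) h(2) p0])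
    have "Lp_int M p (\<lambda>x. g m x - c x) \<le> 2 powr p * (Lp_int M p (g m) + Lp_int M p c)"
      by (rule Lp_fun_diff(2)[OF g(1) h(2) p0])
    also have "\<dots> \<le> 2 powr p * (K + Lp_int M p c)" using g(2) by (intro mult_left_mono) auto
    finally show "Lp_int M p (\<lambda>x. g m x - c x) \<le> 2 powr p * (K + Lp_int M p c)" .
  qed
  have weak: "(\<lambda>m. \<integral>x. indicator A x *\<^sub>R (g m x - c x) \<partial>M) \<longlonglongrightarrow> 0" if "A \<in> range G" for A
  proof -
    obtain n where A: "A = G n" using \<open>A \<in> range G\<close> by (rule rangeE)
    have Ab: "A \<in> sets borel" using that G(3) by auto
    then have "A \<in> sets lebesgue" by auto
    then have Am: "(indicator A :: 'a \<Rightarrow> real) \<in> borel_measurable M"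
      unfolding M by (intro measurable_restrict_space1 borel_measurable_indicator)
    have AL: "(indicator A :: 'a \<Rightarrow> real) \<in> Lp_fun M q"
      by (rule Lp_fun_bounded[OF fm Am, of 1]) (use pq in \<open>auto simp: indicator_def\<close>)
    have int: "integrable M (\<lambda>x. indicator A x *\<^sub>R f x)" if "f \<in> Lp_fun M p" for f :: "'a \<Rightarrow> 'b"
    proof (rule Bochner_Integration.integrable_bound[OF Lp_fun_integrable[OF fm that pq(1)]])
      show "(\<lambda>x. indicator A x *\<^sub>R f x) \<in> borel_measurable M"
        by (intro borel_measurable_scaleR Am Lp_funD(1)[OF that])
    qed (auto simp: indicator_def)
    note gh = Lp_fun_diff(1)[OF g(1) h(1) p0] and hc = Lp_fun_diff(1)[OF h(1,2) p0]
    have 1: "(\<lambda>m. \<integral>x. indicator A x *\<^sub>R (g m x - h m x) \<partial>M) \<longlonglongrightarrow> 0"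
    proof (rule Lim_null_comparison)
      show "\<forall>\<^sub>F m in sequentially. norm (\<integral>x. indicator A x *\<^sub>R (g m x - h m x) \<partial>M) \<le> 1 / real (Suc m)"
        using eventually_ge_at_top[of n] by eventually_elim (simp add: A close del: of_nat_Suc)
      show "(\<lambda>m. 1 / real (Suc m)) \<longlonglongrightarrow> 0"
        using LIMSEQ_inverse_real_of_nat by (simp add: inverse_eq_divide)
    qed
    have 2: "(\<lambda>m. \<integral>x. indicator A x *\<^sub>R (h m x - c x) \<partial>M) \<longlonglongrightarrow> 0"
    proof (rule Lim_null_comparison)
      show "\<forall>\<^sub>F m in sequentially. norm (\<integral>x. indicator A x *\<^sub>R (h m x - c x) \<partial>M)
          \<le> Lp_int M p (\<lambda>x. h m x - c x) powr (1 / p) * Lp_int M q (indicator A :: 'a \<Rightarrow> real) powr (1 / q)"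
      proof (intro always_eventually allI)
        fix m
        have "norm (\<integral>x. indicator A x *\<^sub>R (h m x - c x) \<partial>M) \<le> (\<integral>x. norm (indicator A x *\<^sub>R (h m x - c x)) \<partial>M)"
          by (rule integral_norm_bound)
        also have "\<dots> = (\<integral>x. norm (h m x - c x) * norm (indicator A x :: real) \<partial>M)"
          by (simp add: mult.commute)
        also have "\<dots> \<le> Lp_int M p (\<lambda>x. h m x - c x) powr (1 / p) * Lp_int M q (indicator A :: 'a \<Rightarrow> real) powr (1 / q)"
          by (rule Holder_inequality(2)[OF hc AL pq])
        finally show "norm (\<integral>x. indicator A x *\<^sub>R (h m x - c x) \<partial>M)
          \<le> Lp_int M p (\<lambda>x. h m x - c x) powr (1 / p) * Lp_int M q (indicator A :: 'a \<Rightarrow> real) powr (1 / q)" .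
      qed
      have "(\<lambda>m. Lp_int M p (\<lambda>x. h m x - c x) powr (1 / p)) \<longlonglongrightarrow> 0"
        by (rule tendsto_zero_powrI[OF h(3) tendsto_const]) (use pq in auto)
      then show "(\<lambda>m. Lp_int M p (\<lambda>x. h m x - c x) powr (1 / p) * Lp_int M q (indicator A :: 'a \<Rightarrow> real) powr (1 / q)) \<longlonglongrightarrow> 0"
        by (rule tendsto_mult_left_zero)
    qed
    have "(\<integral>x. indicator A x *\<^sub>R (g m x - c x) \<partial>M)
        = (\<integral>x. indicator A x *\<^sub>R (g m x - h m x) \<partial>M) + (\<integral>x. indicator A x *\<^sub>R (h m x - c x) \<partial>M)" for m
      by (subst Bochner_Integration.integral_add[OF int[OF gh] int[OF hc], symmetric])
        (simp flip: scaleR_add_right)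
    then show ?thesis using tendsto_add[OF 1 2] by simp
  qed
  show ?thesis
  proof (rule bounded_functional_tendsto_0[OF pq L gc])
    fix \<psi> :: "'a \<Rightarrow> 'b" assume "\<psi> \<in> Lp_fun M q"
    from inner_pairing_tendsto_0[OF pq gc(1) pairing_tendsto_0_generator[OF pq \<omega> M G gc weak] this]
    show "(\<lambda>m. \<integral>x. \<psi> x \<bullet> (g m x - c x) \<partial>M) \<longlonglongrightarrow> 0" .
  qed
qed

text \<open>The difference to \<open>c\<close> splits at \<open>h m\<close>: the first part is
  assumed small in the dual norm, the second is small because strong convergence of a field implies
  convergence of its divergence, by the Hoelder inequality.\<close>

lemma test_convergent_diagonal:
  fixes g h :: "nat \<Rightarrow> real ^ 'n \<Rightarrow> real ^ 'n"
  assumes pq: "1 < p" "1 < q" "1 / p + 1 / q = 1" and \<omega>: "\<omega> \<in> lmeasurable"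
    and g: "\<And>m. g m \<in> Lp_fun (lebesgue_on \<omega>) p" and h: "\<And>m. h m \<in> Lp_fun (lebesgue_on \<omega>) p"
    and c: "c \<in> Lp_fun (lebesgue_on \<omega>) p" "(\<lambda>m. Lp_int (lebesgue_on \<omega>) p (\<lambda>x. h m x - c x)) \<longlonglongrightarrow> 0"
    and close: "\<And>m \<phi>. \<phi> \<in> test_functions \<omega> \<Longrightarrow> \<bar>\<integral>x. (g m x - h m x) \<bullet> grad \<phi> x \<partial>lebesgue_on \<omega>\<bar>
        \<le> 1 / real (Suc m) * W1_norm q \<omega> (with_grad \<phi>)"
  shows "test_convergent q \<omega> g c"
proof -
  let ?M = "lebesgue_on \<omega>"
  have p0: "p \<ge> 0" using pq by simp
  define \<epsilon> where "\<epsilon> m = 1 / real (Suc m) + Lp_norm p \<omega> (\<lambda>x. h m x - c x)" for m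
  have "\<epsilon> \<longlonglongrightarrow> 0 + 0"
    unfolding \<epsilon>_def
  proof (rule tendsto_add)
    show "(\<lambda>m. 1 / real (Suc m)) \<longlonglongrightarrow> 0"
      using LIMSEQ_inverse_real_of_nat by (simp add: inverse_eq_divide)
    show "(\<lambda>m. Lp_norm p \<omega> (\<lambda>x. h m x - c x)) \<longlonglongrightarrow> 0"
      unfolding Lp_norm_eq by (rule tendsto_zero_powrI[OF c(2) tendsto_const]) (use pq in auto)
  qed
  moreover have "\<bar>\<integral>x. (g m x - c x) \<bullet> grad \<phi> x \<partial>?M\<bar> \<le> \<epsilon> m * W1_norm q \<omega> (with_grad \<phi>)"
    if \<phi>: "\<phi> \<in> test_functions \<omega>" for m \<phi>
  proof -
    have gr: "grad \<phi> \<in> Lp_fun ?M q" using test_function_Lp(2)[OF \<phi> \<omega>] pq by simp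
    note gh = Lp_fun_diff(1)[OF g h p0] and hc = Lp_fun_diff(1)[OF h c(1) p0]
    have "(\<integral>x. (g m x - c x) \<bullet> grad \<phi> x \<partial>?M)
        = (\<integral>x. (g m x - h m x) \<bullet> grad \<phi> x \<partial>?M) + (\<integral>x. (h m x - c x) \<bullet> grad \<phi> x \<partial>?M)"
      by (subst Bochner_Integration.integral_add[OF Holder_inner(1)[OF gh gr pq] Holder_inner(1)[OF hc gr pq], symmetric])
        (simp flip: inner_add_left)
    moreover have "\<bar>\<integral>x. (h m x - c x) \<bullet> grad \<phi> x \<partial>?M\<bar> \<le> Lp_norm p \<omega> (\<lambda>x. h m x - c x) * Lp_norm q \<omega> (grad \<phi>)"
      using Holder_inner(2)[OF hc gr pq] by (simp add: Lp_norm_eq)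
    moreover have "Lp_norm p \<omega> (\<lambda>x. h m x - c x) * Lp_norm q \<omega> (grad \<phi>)
        \<le> Lp_norm p \<omega> (\<lambda>x. h m x - c x) * W1_norm q \<omega> (with_grad \<phi>)"
      by (intro mult_left_mono) (auto simp: W1_norm_def with_grad_def)
    ultimately show ?thesis using close[OF \<phi>, of m] unfolding \<epsilon>_def distrib_right by linarith
  qed
  ultimately show ?thesis unfolding test_convergent_def by auto
qed

text \<open>Exchanging the two fields together with their exponents is a symmetry of
  \<open>X_space\<close>. Statements proved for the first component thereby become available for the
  second.\<close>

lemma bounded_functional_swap:
  fixes L :: "('n::finite) fields \<Rightarrow> real"
  assumes L: "bounded_functional (X_space p q \<omega>) (X_norm p q \<omega>) L"
  shows "bounded_functional (X_space q p \<omega>) (X_norm q p \<omega>) (\<lambda>v. L (\<lambda>x. prod.swap (v x)))"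
proof -
  have X: "(\<lambda>x. prod.swap (v x)) \<in> X_space p q \<omega>" if "v \<in> X_space q p \<omega>" for v :: "'n fields"
    using X_spaceD[OF that] by (intro X_spaceI) auto
  obtain C where C: "\<And>v. v \<in> X_space p q \<omega> \<Longrightarrow> \<bar>L v\<bar> \<le> C * X_norm p q \<omega> v"
    using L unfolding bounded_functional_def by blast
  have swap: "prod.swap (a + b) = prod.swap a + prod.swap b" "prod.swap (c *\<^sub>R a) = c *\<^sub>R prod.swap a"
    for a b :: "(real ^ 'n ^ 'n) \<times> (real ^ 'n ^ 'n)" and c :: real
    by (auto simp: prod_eq_iff)
  show ?thesis
    unfolding bounded_functional_def swap
  proof (intro conjI ballI allI exI)
    fix v assume "v \<in> X_space q p \<omega>"
    from C[OF X[OF this]] show "\<bar>L (\<lambda>x. prod.swap (v x))\<bar> \<le> C * X_norm q p \<omega> v"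
      by (simp add: X_norm_def add.commute)
  qed (simp_all add: bounded_functionalD[OF L] X)
qed

lemma weakly_convergent_swap:
  assumes w: "weakly_convergent_to (X_space p q \<omega>) (X_norm p q \<omega>) u u0"
  shows "weakly_convergent_to (X_space q p \<omega>) (X_norm q p \<omega>) (\<lambda>k x. prod.swap (u k x)) (\<lambda>x. prod.swap (u0 x))"
  unfolding weakly_convergent_to_def
proof (intro conjI allI impI)
  note X = weakly_convergent_X_spaceD[OF w]
  show "(\<lambda>x. prod.swap (u k x)) \<in> X_space q p \<omega>" for k
    using X_spaceD[OF X(1)] by (intro X_spaceI) auto
  show "(\<lambda>x. prod.swap (u0 x)) \<in> X_space q p \<omega>"
    using X_spaceD[OF X(2)] by (intro X_spaceI) auto
  fix L assume "bounded_functional (X_space q p \<omega>) (X_norm q p \<omega>) L"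
  from w[unfolded weakly_convergent_to_def, THEN conjunct2, THEN conjunct2, rule_format,
      OF bounded_functional_swap[OF this]]
  show "(\<lambda>k. L (\<lambda>x. prod.swap (u k x))) \<longlonglongrightarrow> L (\<lambda>x. prod.swap (u0 x))" .
qed

lemma bounded_functional_pairing:
  fixes \<psi> :: "real ^ 'n \<Rightarrow> real ^ 'n ^ 'n"
  assumes pq: "1 < p" "1 < q" "1 / p + 1 / q = 1" and \<psi>: "\<psi> \<in> Lp_fun (lebesgue_on \<omega>) q"
  shows "bounded_functional (X_space p q \<omega>) (X_norm p q \<omega>) (\<lambda>v. \<integral>x. \<psi> x \<bullet> fst (v x) \<partial>lebesgue_on \<omega>)"
  unfolding bounded_functional_def
proof (intro conjI ballI allI exI)
  have qp: "1 / q + 1 / p = 1" using pq by simp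
  note H = Holder_inner[OF \<psi> X_spaceD(1) pq(2,1) qp]
  fix f :: "'n fields" assume f: "f \<in> X_space p q \<omega>"
  {
    fix g assume "g \<in> X_space p q \<omega>"
    with f show "(\<integral>x. \<psi> x \<bullet> fst (f x + g x) \<partial>lebesgue_on \<omega>)
        = (\<integral>x. \<psi> x \<bullet> fst (f x) \<partial>lebesgue_on \<omega>) + (\<integral>x. \<psi> x \<bullet> fst (g x) \<partial>lebesgue_on \<omega>)"
      using H(1) by (simp add: inner_add_right)
  }
  show "(\<integral>x. \<psi> x \<bullet> fst (c *\<^sub>R f x) \<partial>lebesgue_on \<omega>) = c * (\<integral>x. \<psi> x \<bullet> fst (f x) \<partial>lebesgue_on \<omega>)" for c
    by simp
  have "\<bar>\<integral>x. \<psi> x \<bullet> fst (f x) \<partial>lebesgue_on \<omega>\<bar> \<le> Lp_norm q \<omega> \<psi> * Lp_norm p \<omega> (\<lambda>x. fst (f x))"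
    using H(2)[OF f] by (simp add: Lp_norm_eq)
  also have "\<dots> \<le> Lp_norm q \<omega> \<psi> * X_norm p q \<omega> f"
    by (intro mult_left_mono) (auto simp: X_norm_def)
  finally show "\<bar>\<integral>x. \<psi> x \<bullet> fst (f x) \<partial>lebesgue_on \<omega>\<bar> \<le> Lp_norm q \<omega> \<psi> * X_norm p q \<omega> f" .
qed

text \<open>Each component of the set integral is a bounded functional of the pair, given by the
  indicator times a constant matrix; in finite dimension componentwise convergence suffices.\<close>

lemma weakly_convergent_set_integral:
  fixes u :: "nat \<Rightarrow> ('n::finite) fields"
  assumes pq: "1 < p" "1 < q" "1 / p + 1 / q = 1" and \<omega>: "\<omega> \<in> lmeasurable"
    and w: "weakly_convergent_to (X_space p q \<omega>) (X_norm p q \<omega>) u u0" and A: "A \<in> sets lebesgue"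
  shows "(\<lambda>k. \<integral>x. indicator A x *\<^sub>R (fst (u k x) - fst (u0 x)) \<partial>lebesgue_on \<omega>) \<longlonglongrightarrow> 0"
proof -
  let ?M = "lebesgue_on \<omega>"
  have fm: "finite_measure ?M" by (rule finite_measure_lebesgue_on[OF \<omega>])
  have p0: "p \<ge> 0" "q \<ge> 0" using pq by auto
  have qp: "1 / q + 1 / p = 1" using pq by simp
  note X = X_spaceD(1)[OF weakly_convergent_X_spaceD(1)[OF w]] X_spaceD(1)[OF weakly_convergent_X_spaceD(2)[OF w]]
  note d = Lp_fun_diff(1)[OF X p0(1)]
  have Am: "(indicator A :: _ \<Rightarrow> real) \<in> borel_measurable ?M"
    by (intro measurable_restrict_space1 borel_measurable_indicator A)
  have int: "integrable ?M (\<lambda>x. indicator A x *\<^sub>R (fst (u k x) - fst (u0 x)))" for k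
  proof (rule Bochner_Integration.integrable_bound[OF Lp_fun_integrable[OF fm d pq(1)]])
    show "(\<lambda>x. indicator A x *\<^sub>R (fst (u k x) - fst (u0 x))) \<in> borel_measurable ?M"
      by (intro borel_measurable_scaleR Am Lp_funD(1)[OF d])
  qed (auto simp: indicator_def)
  have "(\<lambda>k. (\<integral>x. indicator A x *\<^sub>R (fst (u k x) - fst (u0 x)) \<partial>?M) \<bullet> b) \<longlonglongrightarrow> 0 \<bullet> b" for b
  proof -
    have AL: "(\<lambda>x. indicator A x *\<^sub>R b) \<in> Lp_fun ?M q"
      by (rule Lp_fun_bounded[OF fm _ _ p0(2), of _ "norm b"])
        (intro borel_measurable_scaleR Am borel_measurable_const, simp add: indicator_def)
    define L where "L v = (\<integral>x. (indicator A x *\<^sub>R b) \<bullet> fst (v x) \<partial>?M)" for v :: "'n fields"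
    have "bounded_functional (X_space p q \<omega>) (X_norm p q \<omega>) L"
      unfolding L_def by (rule bounded_functional_pairing[OF pq AL])
    then have "(\<lambda>k. L (u k)) \<longlonglongrightarrow> L u0" using w by (simp add: weakly_convergent_to_def)
    then have "(\<lambda>k. L (u k) - L u0) \<longlonglongrightarrow> 0" by (rule LIM_zero)
    moreover have "(\<integral>x. indicator A x *\<^sub>R (fst (u k x) - fst (u0 x)) \<partial>?M) \<bullet> b = L (u k) - L u0" for k
    proof -
      note H = Holder_inner(1)[OF AL _ pq(2,1) qp]
      have "(\<integral>x. indicator A x *\<^sub>R (fst (u k x) - fst (u0 x)) \<partial>?M) \<bullet> b
          = (\<integral>x. (indicator A x *\<^sub>R (fst (u k x) - fst (u0 x))) \<bullet> b \<partial>?M)"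
        by (rule integral_inner_left[symmetric]) (rule int)
      also have "\<dots> = (\<integral>x. (indicator A x *\<^sub>R b) \<bullet> fst (u k x) - (indicator A x *\<^sub>R b) \<bullet> fst (u0 x) \<partial>?M)"
        by (simp add: inner_diff_left inner_commute[of b] right_diff_distrib)
      also have "\<dots> = L (u k) - L u0"
        unfolding L_def by (intro Bochner_Integration.integral_diff H[OF X(1)] H[OF X(2)])
      finally show ?thesis .
    qed
    ultimately show ?thesis by simp
  qed
  then show ?thesis by (subst tendsto_componentwise_iff) blast
qed

lemma Lp_int_linear_tendsto_0:
  assumes "(\<lambda>m. Lp_int M p (\<lambda>x. h m x - c x)) \<longlonglongrightarrow> 0" "bounded_linear T" "p \<ge> 0"
    and "\<And>m. h m \<in> Lp_fun M p" "c \<in> Lp_fun M p"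
  shows "(\<lambda>m. Lp_int M p (\<lambda>x. T (h m x) - T (c x))) \<longlonglongrightarrow> 0"
proof (rule Lim_null_comparison)
  show "\<forall>\<^sub>F m in sequentially. norm (Lp_int M p (\<lambda>x. T (h m x) - T (c x)))
      \<le> onorm T powr p * Lp_int M p (\<lambda>x. h m x - c x)"
    using Lp_fun_linear(2)[OF Lp_fun_diff(1)[OF assms(4,5,3)] assms(2,3)]
    by (simp add: linear_diff[OF bounded_linear.linear[OF assms(2)]])
  show "(\<lambda>m. onorm T powr p * Lp_int M p (\<lambda>x. h m x - c x)) \<longlonglongrightarrow> 0"
    by (rule tendsto_mult_right_zero[OF assms(1)])
qed

lemma bounded_functional_fst:
  fixes L :: "('n::finite) fields \<Rightarrow> real"
  assumes L: "bounded_functional (X_space p q \<omega>) (X_norm p q \<omega>) L"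
  shows "bounded_functional (Lp_fun (lebesgue_on \<omega>) p) (\<lambda>f. Lp_int (lebesgue_on \<omega>) p f powr (1 / p)) (\<lambda>f. L (\<lambda>x. (f x, 0)))"
proof -
  obtain C where C: "\<And>v. v \<in> X_space p q \<omega> \<Longrightarrow> \<bar>L v\<bar> \<le> C * X_norm p q \<omega> v"
    using L unfolding bounded_functional_def by blast
  have X: "(\<lambda>x. (f x, 0)) \<in> X_space p q \<omega>" if "f \<in> Lp_fun (lebesgue_on \<omega>) p" for f
    using that by (intro X_spaceI) auto
  show ?thesis
    unfolding bounded_functional_def
  proof (intro conjI ballI allI exI)
    fix f :: "real ^ 'n \<Rightarrow> real ^ 'n ^ 'n" assume f: "f \<in> Lp_fun (lebesgue_on \<omega>) p"
    show "L (\<lambda>x. (f x + g x, 0)) = L (\<lambda>x. (f x, 0)) + L (\<lambda>x. (g x, 0))" if "g \<in> Lp_fun (lebesgue_on \<omega>) p" for g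
      using bounded_functionalD(1)[OF L X[OF f] X[OF that]] by simp
    show "L (\<lambda>x. (c *\<^sub>R f x, 0)) = c * L (\<lambda>x. (f x, 0))" for c
      using bounded_functionalD(2)[OF L X[OF f], of c] by simp
    show "\<bar>L (\<lambda>x. (f x, 0))\<bar> \<le> C * Lp_int (lebesgue_on \<omega>) p f powr (1 / p)"
      using C[OF X[OF f]] by (simp add: X_norm_def Lp_norm_eq)
  qed
qed

text \<open>For fixed \<open>i\<close> the closeness requirements hold for all large
  \<open>k\<close> and the bound \<open>K\<close> for arbitrarily large \<open>k\<close>, so some
  \<open>k\<close> meets both. The resulting sequence inherits its limit from \<open>w i\<close>,
  which tends strongly to the constant.\<close>

lemma div_curl_diagonal:
  fixes v :: "nat \<Rightarrow> nat \<Rightarrow> ('n::finite) fields"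
  assumes pq: "1 < p" "1 < q" "1 / p + 1 / q = 1" and \<omega>: "\<omega> \<in> lmeasurable"
    and conv: "\<And>i. div_curl_convergent_to p q \<omega> (v i) (w i)"
    and c: "(\<lambda>i. Lp_int (lebesgue_on \<omega>) p (\<lambda>y. fst (w i y) - fst c)) \<longlonglongrightarrow> 0"
      "(\<lambda>i. Lp_int (lebesgue_on \<omega>) q (\<lambda>y. snd (w i y) - snd c)) \<longlonglongrightarrow> 0"
    and K: "\<And>i N. \<exists>k\<ge>N. Lp_int (lebesgue_on \<omega>) p (\<lambda>y. fst (v i k y)) \<le> K \<and>
        Lp_int (lebesgue_on \<omega>) q (\<lambda>y. snd (v i k y)) \<le> K"
  obtains \<kappa> where "div_curl_convergent_to p q \<omega> (\<lambda>i. v i (\<kappa> i)) (\<lambda>_. c)"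
proof -
  let ?M = "lebesgue_on \<omega>"
  have fm: "finite_measure ?M" by (rule finite_measure_lebesgue_on[OF \<omega>])
  have p0: "p \<ge> 0" "q \<ge> 0" using pq by auto
  have qp: "1 / q + 1 / p = 1" using pq by simp
  obtain G :: "nat \<Rightarrow> (real ^ 'n) set" where G: "Int_stable (range G)" "UNIV \<in> range G" "sets borel = sigma_sets UNIV (range G)"
    by (rule countable_generator_borel)
  have Gl: "G n \<in> sets lebesgue" for n
  proof -
    have "G n \<in> sets borel" unfolding G(3) by auto
    then show ?thesis by auto
  qed
  note D = conv[unfolded div_curl_convergent_iff[OF pq \<omega>]]
  have wk: "weakly_convergent_to (X_space p q \<omega>) (X_norm p q \<omega>) (v i) (w i)" for i using D by blast
  note Xv = X_spaceD[OF weakly_convergent_X_spaceD(1)[OF wk]] and Xw = X_spaceD[OF weakly_convergent_X_spaceD(2)[OF wk]]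
  \<comment> \<open>Naming the property of the error sequence lets one family of sequences be chosen
    simultaneously for all indices.\<close>
  define Pc where "Pc i a b d \<epsilon> \<longleftrightarrow> \<epsilon> \<longlonglongrightarrow> 0 \<and> (\<forall>m. \<forall>\<phi>\<in>test_functions \<omega>.
      \<bar>\<integral>x. (curl_field a b d (fst (v i m x)) - curl_field a b d (fst (w i x))) \<bullet> grad \<phi> x \<partial>?M\<bar>
      \<le> \<epsilon> m * W1_norm q \<omega> (with_grad \<phi>))" for i a b d \<epsilon>
  have "\<exists>\<epsilon>. Pc i a b d \<epsilon>" for i a b d
    using D[of i] unfolding test_convergent_def Pc_def by blast
  then obtain \<epsilon>c where Pc: "\<And>i a b d. Pc i a b d (\<epsilon>c i a b d)" by metis
  have \<epsilon>c: "\<epsilon>c i a b d \<longlonglongrightarrow> 0" "\<phi> \<in> test_functions \<omega> \<Longrightarrow>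
      \<bar>\<integral>x. (curl_field a b d (fst (v i m x)) - curl_field a b d (fst (w i x))) \<bullet> grad \<phi> x \<partial>?M\<bar>
      \<le> \<epsilon>c i a b d m * W1_norm q \<omega> (with_grad \<phi>)" for i a b d m \<phi>
    using Pc[of i a b d] unfolding Pc_def by simp_all
  define Pd where "Pd i a \<epsilon> \<longleftrightarrow> \<epsilon> \<longlonglongrightarrow> 0 \<and> (\<forall>m. \<forall>\<phi>\<in>test_functions \<omega>.
      \<bar>\<integral>x. (snd (v i m x) $ a - snd (w i x) $ a) \<bullet> grad \<phi> x \<partial>?M\<bar>
      \<le> \<epsilon> m * W1_norm p \<omega> (with_grad \<phi>))" for i a \<epsilon>
  have "\<exists>\<epsilon>. Pd i a \<epsilon>" for i a
    using D[of i] unfolding test_convergent_def Pd_def by blast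
  then obtain \<epsilon>d where Pd: "\<And>i a. Pd i a (\<epsilon>d i a)" by metis
  have \<epsilon>d: "\<epsilon>d i a \<longlonglongrightarrow> 0" "\<phi> \<in> test_functions \<omega> \<Longrightarrow>
      \<bar>\<integral>x. (snd (v i m x) $ a - snd (w i x) $ a) \<bullet> grad \<phi> x \<partial>?M\<bar>
      \<le> \<epsilon>d i a m * W1_norm p \<omega> (with_grad \<phi>)" for i a m \<phi>
    using Pd[of i a] unfolding Pd_def by simp_all
  \<comment> \<open>Only the first \<open>i + 1\<close> sets of the generator and the finitely many
    matrix indices are tested, so the condition holds for all large \<open>k\<close>. Every fixed
    set is still tested from some \<open>i\<close> on.\<close>
  define good where "good i k \<longleftrightarrow>
      (\<forall>n\<in>{..i}. norm (\<integral>x. indicator (G n) x *\<^sub>R (fst (v i k x) - fst (w i x)) \<partial>?M) < 1 / real (Suc i)) \<and>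
      (\<forall>n\<in>{..i}. norm (\<integral>x. indicator (G n) x *\<^sub>R (snd (v i k x) - snd (w i x)) \<partial>?M) < 1 / real (Suc i)) \<and>
      (\<forall>a b d. \<epsilon>c i a b d k < 1 / real (Suc i)) \<and> (\<forall>a. \<epsilon>d i a k < 1 / real (Suc i))" for i k
  have ev: "\<forall>\<^sub>F k in sequentially. good i k" for i
  proof -
    have pos: "1 / real (Suc i) > 0" by simp
    have "\<forall>\<^sub>F k in sequentially. \<forall>n\<in>{..i}. norm (\<integral>x. indicator (G n) x *\<^sub>R (fst (v i k x) - fst (w i x)) \<partial>?M) < 1 / real (Suc i)"
      by (rule eventually_ball_finite[OF finite_atMost], rule ballI,
          rule order_tendstoD(2)[OF tendsto_norm_zero[OF weakly_convergent_set_integral[OF pq \<omega> wk Gl]] pos])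
    moreover have "\<forall>\<^sub>F k in sequentially. \<forall>n\<in>{..i}. norm (\<integral>x. indicator (G n) x *\<^sub>R (snd (v i k x) - snd (w i x)) \<partial>?M) < 1 / real (Suc i)"
      by (rule eventually_ball_finite[OF finite_atMost], rule ballI,
          rule order_tendstoD(2)[OF tendsto_norm_zero[OF weakly_convergent_set_integral[OF pq(2,1) qp \<omega> weakly_convergent_swap[OF wk] Gl, simplified]] pos])
    moreover have "\<forall>\<^sub>F k in sequentially. \<forall>a b d. \<epsilon>c i a b d k < 1 / real (Suc i)"
      by (rule eventually_all_finite)+ (rule order_tendstoD(2)[OF \<epsilon>c(1) pos])
    moreover have "\<forall>\<^sub>F k in sequentially. \<forall>a. \<epsilon>d i a k < 1 / real (Suc i)"
      by (rule eventually_all_finite) (rule order_tendstoD(2)[OF \<epsilon>d(1) pos])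
    ultimately show ?thesis
      unfolding good_def by eventually_elim blast
  qed
  have "\<exists>k. good i k \<and> Lp_int ?M p (\<lambda>y. fst (v i k y)) \<le> K \<and> Lp_int ?M q (\<lambda>y. snd (v i k y)) \<le> K" for i
  proof -
    obtain N where "\<And>k. k \<ge> N \<Longrightarrow> good i k" using ev[of i] by (auto simp: eventually_sequentially)
    then show ?thesis using K[of N i] by blast
  qed
  then obtain \<kappa> where \<kappa>: "\<And>i. good i (\<kappa> i)" "\<And>i. Lp_int ?M p (\<lambda>y. fst (v i (\<kappa> i) y)) \<le> K"
    "\<And>i. Lp_int ?M q (\<lambda>y. snd (v i (\<kappa> i) y)) \<le> K" by metis
  have cL: "(\<lambda>_. fst c) \<in> Lp_fun ?M p" "(\<lambda>_. snd c) \<in> Lp_fun ?M q" by (rule Lp_fun_const[OF fm])+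
  have weak: "weakly_convergent_to (X_space p q \<omega>) (X_norm p q \<omega>) (\<lambda>i. v i (\<kappa> i)) (\<lambda>_. c)"
    unfolding weakly_convergent_to_def
  proof (intro conjI allI impI)
    show "v i (\<kappa> i) \<in> X_space p q \<omega>" for i by (rule weakly_convergent_X_spaceD(1)[OF wk])
    show cX: "(\<lambda>_. c) \<in> X_space p q \<omega>" using cL by (intro X_spaceI) auto
    fix L assume L: "bounded_functional (X_space p q \<omega>) (X_norm p q \<omega>) L"
    have close1: "norm (\<integral>x. indicator (G n) x *\<^sub>R (fst (v m (\<kappa> m) x) - fst (w m x)) \<partial>?M) \<le> 1 / real (Suc m)" if "n \<le> m" for n m
      using \<kappa>(1)[of m] that unfolding good_def by (blast intro: less_imp_le)
    have close2: "norm (\<integral>x. indicator (G n) x *\<^sub>R (snd (v m (\<kappa> m) x) - snd (w m x)) \<partial>?M) \<le> 1 / real (Suc m)" if "n \<le> m" for n m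
      using \<kappa>(1)[of m] that unfolding good_def by (blast intro: less_imp_le)
    note 1 = bounded_functional_diagonal[OF pq \<omega> refl G Xv(1) \<kappa>(2) Xw(1) cL(1) c(1) close1 bounded_functional_fst[OF L]]
    note 2 = bounded_functional_diagonal[OF pq(2,1) qp \<omega> refl G Xv(2) \<kappa>(3) Xw(2) cL(2) c(2) close2 bounded_functional_fst[OF bounded_functional_swap[OF L], simplified]]
    \<comment> \<open>Splitting off the constant and separating the components reduces the
      functional on pairs to functionals on single Lebesgue spaces.\<close>
    have "L (v i (\<kappa> i)) = L (\<lambda>x. (fst (v i (\<kappa> i) x) - fst c, 0)) + L (\<lambda>x. (0, snd (v i (\<kappa> i) x) - snd c)) + L (\<lambda>_. c)" for i
    proof -
      have X1: "(\<lambda>x. (fst (v i (\<kappa> i) x) - fst c, 0)) \<in> X_space p q \<omega>"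
        using Lp_fun_diff(1)[OF Xv(1) cL(1) p0(1)] by (intro X_spaceI) auto
      have X2: "(\<lambda>x. (0, snd (v i (\<kappa> i) x) - snd c)) \<in> X_space p q \<omega>"
        using Lp_fun_diff(1)[OF Xv(2) cL(2) p0(2)] by (intro X_spaceI) auto
      have X12: "(\<lambda>x. (fst (v i (\<kappa> i) x) - fst c, 0) + (0, snd (v i (\<kappa> i) x) - snd c)) \<in> X_space p q \<omega>"
        using Lp_fun_diff(1)[OF Xv(1) cL(1) p0(1)] Lp_fun_diff(1)[OF Xv(2) cL(2) p0(2)] by (intro X_spaceI) auto
      have "v i (\<kappa> i) = (\<lambda>x. ((fst (v i (\<kappa> i) x) - fst c, 0) + (0, snd (v i (\<kappa> i) x) - snd c)) + c)"
        by (auto simp: prod_eq_iff)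
      then have "L (v i (\<kappa> i)) = L (\<lambda>x. ((fst (v i (\<kappa> i) x) - fst c, 0) + (0, snd (v i (\<kappa> i) x) - snd c)) + c)"
        by (rule arg_cong)
      also have "\<dots> = L (\<lambda>x. (fst (v i (\<kappa> i) x) - fst c, 0) + (0, snd (v i (\<kappa> i) x) - snd c)) + L (\<lambda>_. c)"
        by (rule bounded_functionalD(1)[OF L X12 cX])
      also note bounded_functionalD(1)[OF L X1 X2]
      finally show ?thesis .
    qed
    then show "(\<lambda>i. L (v i (\<kappa> i))) \<longlonglongrightarrow> L (\<lambda>_. c)"
      using tendsto_add[OF tendsto_add[OF 1 2] tendsto_const[of "L (\<lambda>_. c)"]] by simp
  qed
  note lin = Lp_fun_linear(1)[OF _ linear_curl_field p0(1)] Lp_fun_linear(1)[OF _ bounded_linear_vec_nth p0(2)]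
  have "test_convergent q \<omega> (\<lambda>i x. curl_field a b d (fst (v i (\<kappa> i) x))) (\<lambda>_. curl_field a b d (fst c))" for a b d
  proof (rule test_convergent_diagonal[OF pq \<omega> lin(1)[OF Xv(1)] lin(1)[OF Xw(1)] lin(1)[OF cL(1)]])
    show "(\<lambda>i. Lp_int ?M p (\<lambda>x. curl_field a b d (fst (w i x)) - curl_field a b d (fst c))) \<longlonglongrightarrow> 0"
      by (rule Lp_int_linear_tendsto_0[OF c(1) linear_curl_field p0(1) Xw(1) cL(1)])
    fix m \<phi> assume \<phi>: "\<phi> \<in> test_functions \<omega>"
    have "\<epsilon>c m a b d (\<kappa> m) \<le> 1 / real (Suc m)"
      using \<kappa>(1)[of m] unfolding good_def by (blast intro: less_imp_le)
    then have "\<epsilon>c m a b d (\<kappa> m) * W1_norm q \<omega> (with_grad \<phi>) \<le> 1 / real (Suc m) * W1_norm q \<omega> (with_grad \<phi>)"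
      by (intro mult_right_mono W1_norm_nonneg)
    with \<epsilon>c(2)[where i = m and a = a and b = b and d = d and m = "\<kappa> m", OF \<phi>]
    show "\<bar>\<integral>x. (curl_field a b d (fst (v m (\<kappa> m) x)) - curl_field a b d (fst (w m x))) \<bullet> grad \<phi> x \<partial>?M\<bar>
      \<le> 1 / real (Suc m) * W1_norm q \<omega> (with_grad \<phi>)" by (rule order_trans)
  qed
  moreover have "test_convergent p \<omega> (\<lambda>i x. snd (v i (\<kappa> i) x) $ a) (\<lambda>_. snd c $ a)" for a
  proof (rule test_convergent_diagonal[OF pq(2,1) qp \<omega> lin(2)[OF Xv(2)] lin(2)[OF Xw(2)] lin(2)[OF cL(2)]])
    show "(\<lambda>i. Lp_int ?M q (\<lambda>x. snd (w i x) $ a - snd c $ a)) \<longlonglongrightarrow> 0"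
      by (rule Lp_int_linear_tendsto_0[OF c(2) bounded_linear_vec_nth p0(2) Xw(2) cL(2)])
    fix m \<phi> assume \<phi>: "\<phi> \<in> test_functions \<omega>"
    have "\<epsilon>d m a (\<kappa> m) \<le> 1 / real (Suc m)"
      using \<kappa>(1)[of m] unfolding good_def by (blast intro: less_imp_le)
    then have "\<epsilon>d m a (\<kappa> m) * W1_norm p \<omega> (with_grad \<phi>) \<le> 1 / real (Suc m) * W1_norm p \<omega> (with_grad \<phi>)"
      by (intro mult_right_mono W1_norm_nonneg)
    with \<epsilon>d(2)[where i = m and a = a and m = "\<kappa> m", OF \<phi>]
    show "\<bar>\<integral>x. (snd (v m (\<kappa> m) x) $ a - snd (w m x) $ a) \<bullet> grad \<phi> x \<partial>?M\<bar>
      \<le> 1 / real (Suc m) * W1_norm p \<omega> (with_grad \<phi>)" by (rule order_trans)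
  qed
  ultimately have "div_curl_convergent_to p q \<omega> (\<lambda>i. v i (\<kappa> i)) (\<lambda>_. c)"
    unfolding div_curl_convergent_iff[OF pq \<omega>] using weak by blast
  then show ?thesis by (rule that)
qed

subsection \<open>Blow-up at Lebesgue points\<close>

text \<open>The extremal function in the Hoelder inequality is the duality map of \<open>f\<close>,
  scaled to norm 1 in the conjugate space.\<close>

lemma Lp_norming_functional:
  fixes f :: "'a \<Rightarrow> 'b::euclidean_space"
  assumes pq: "1 < p" "1 < q" "1 / p + 1 / q = 1" and f: "f \<in> Lp_fun M p"
  obtains \<psi> where "\<psi> \<in> Lp_fun M q"
    "\<And>g. g \<in> Lp_fun M p \<Longrightarrow> \<bar>\<integral>x. \<psi> x \<bullet> g x \<partial>M\<bar> \<le> Lp_int M p g powr (1 / p)"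
    "(\<integral>x. \<psi> x \<bullet> f x \<partial>M) = Lp_int M p f powr (1 / p)"
proof -
  define A where "A = Lp_int M p f"
  \<comment> \<open>If \<open>A = 0\<close>, then \<open>s = 0\<close> because
    \<open>0 powr a = 0\<close>, and the zero functional norms \<open>f\<close>; hence only an
    inequality for \<open>s * A powr (1 / q)\<close> below.\<close>
  define s where "s = A powr - (1 / q)"
  note J = duality_map_Lp[OF f pq]
  have qp: "1 / q + 1 / p = 1" using pq by simp
  have A: "A \<ge> 0" by (simp add: A_def)
  show ?thesis
  proof (rule that[of "\<lambda>x. s *\<^sub>R duality_map p (f x)"])
    show "(\<lambda>x. s *\<^sub>R duality_map p (f x)) \<in> Lp_fun M q" by (rule Lp_fun_scaleR(1)[OF J(1)])
    have sA: "s * A powr (1 / q) \<le> 1"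
      unfolding s_def by (simp flip: powr_add)
    fix g :: "'a \<Rightarrow> 'b" assume g: "g \<in> Lp_fun M p"
    have "\<bar>\<integral>x. (s *\<^sub>R duality_map p (f x)) \<bullet> g x \<partial>M\<bar> = s * \<bar>\<integral>x. duality_map p (f x) \<bullet> g x \<partial>M\<bar>"
      by (simp add: abs_mult s_def)
    also have "\<dots> \<le> s * (A powr (1 / q) * Lp_int M p g powr (1 / p))"
      using Holder_inner(2)[OF J(1) g pq(2,1) qp] unfolding J(2) A_def[symmetric]
      by (intro mult_left_mono) (auto simp: s_def)
    also have "\<dots> \<le> 1 * Lp_int M p g powr (1 / p)"
      unfolding mult.assoc[symmetric] by (intro mult_right_mono sA) auto
    finally show "\<bar>\<integral>x. (s *\<^sub>R duality_map p (f x)) \<bullet> g x \<partial>M\<bar> \<le> Lp_int M p g powr (1 / p)" by simp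
  next
    have "(\<integral>x. (s *\<^sub>R duality_map p (f x)) \<bullet> f x \<partial>M) = s * A"
      by (simp add: duality_map_inner_self A_def Lp_int_def)
    also have "\<dots> = A powr (1 / p)"
    proof -
      have "s * A = A powr (- (1 / q) + 1)" unfolding s_def by (rule powr_mult_self[OF A])
      also have "- (1 / q) + 1 = 1 / p" using pq(3) by linarith
      finally show ?thesis .
    qed
    finally show "(\<integral>x. (s *\<^sub>R duality_map p (f x)) \<bullet> f x \<partial>M) = Lp_int M p f powr (1 / p)"
      by (simp add: A_def)
  qed
qed

text \<open>Uniform boundedness is applied with the seminorm of the first component, whose norming
  functionals come from \<open>Lp_norming_functional\<close>. The second component follows by
  swapping.\<close>

lemma weakly_convergent_fst_bounded:
  fixes u :: "nat \<Rightarrow> ('n::finite) fields"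
  assumes pq: "1 < p" "1 < q" "1 / p + 1 / q = 1"
    and w: "weakly_convergent_to (X_space p q \<omega>) (X_norm p q \<omega>) u u0"
  obtains C where "\<And>k. Lp_int (lebesgue_on \<omega>) p (\<lambda>x. fst (u k x)) \<le> C"
proof -
  let ?M = "lebesgue_on \<omega>"
  note X = X_spaceD[OF weakly_convergent_X_spaceD(1)[OF w]]
  have "\<exists>C. \<forall>k. Lp_norm p \<omega> (\<lambda>x. fst (u k x)) \<le> C"
  proof (rule weakly_convergent_imp_bounded[OF w])
    fix k
    obtain \<psi> where \<psi>: "\<psi> \<in> Lp_fun ?M q"
      "\<And>g. g \<in> Lp_fun ?M p \<Longrightarrow> \<bar>\<integral>x. \<psi> x \<bullet> g x \<partial>?M\<bar> \<le> Lp_int ?M p g powr (1 / p)"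
      "(\<integral>x. \<psi> x \<bullet> fst (u k x) \<partial>?M) = Lp_int ?M p (\<lambda>x. fst (u k x)) powr (1 / p)"
      using Lp_norming_functional[OF pq X(1)] by blast
    define L where "L v = (\<integral>x. \<psi> x \<bullet> fst (v x) \<partial>?M)" for v :: "'n fields"
    have "\<bar>L v\<bar> \<le> Lp_norm p \<omega> (\<lambda>x. fst (v x))" if "v \<in> X_space p q \<omega>" for v
      using \<psi>(2)[OF X_spaceD(1)[OF that]] by (simp add: L_def Lp_norm_eq)
    moreover have "bounded_functional (X_space p q \<omega>) (X_norm p q \<omega>) L"
      unfolding L_def by (rule bounded_functional_pairing[OF pq \<psi>(1)])
    ultimately show "\<exists>L. bounded_functional (X_space p q \<omega>) (X_norm p q \<omega>) L \<and>
        (\<forall>v\<in>X_space p q \<omega>. \<bar>L v\<bar> \<le> Lp_norm p \<omega> (\<lambda>x. fst (v x))) \<and> L (u k) = Lp_norm p \<omega> (\<lambda>x. fst (u k x))"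
      using \<psi>(3) by (intro exI[of _ L]) (simp add: L_def Lp_norm_eq)
  qed (auto simp: X_norm_def)
  then obtain C where C: "\<And>k. Lp_norm p \<omega> (\<lambda>x. fst (u k x)) \<le> C" by blast
  have "Lp_int ?M p (\<lambda>x. fst (u k x)) \<le> C powr p" for k
  proof -
    have "Lp_int ?M p (\<lambda>x. fst (u k x)) = Lp_norm p \<omega> (\<lambda>x. fst (u k x)) powr p"
      using pq by (simp add: Lp_norm_eq powr_powr)
    also have "\<dots> \<le> C powr p" using pq C by (intro powr_mono2) auto
    finally show ?thesis .
  qed
  then show ?thesis by (rule that)
qed

lemma Lp_int_le_ball_average:
  fixes f :: "'a::euclidean_space \<Rightarrow> 'b::euclidean_space"
  assumes f: "(\<lambda>y. f (x + r *\<^sub>R y)) \<in> Lp_fun (lebesgue_on (ball 0 1)) p"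
    and le: "\<And>y. y \<in> ball 0 1 \<Longrightarrow> ennreal (norm (f (x + r *\<^sub>R y)) powr p) \<le> F (x + r *\<^sub>R y)"
    and K: "ball_average r F x < K" "K < top"
  shows "Lp_int (lebesgue_on (ball 0 1)) p (\<lambda>y. f (x + r *\<^sub>R y)) \<le> enn2real K"
proof -
  have "ennreal (Lp_int (lebesgue_on (ball 0 1)) p (\<lambda>y. f (x + r *\<^sub>R y)))
      = (\<integral>\<^sup>+y. ennreal (norm (f (x + r *\<^sub>R y)) powr p) * indicator (ball 0 1) y \<partial>lebesgue)"
    unfolding ennreal_Lp_int[OF f] by (subst nn_integral_restrict_space) auto
  also have "\<dots> \<le> ball_average r F x"
    unfolding ball_average_def
  proof (intro nn_integral_mono)
    fix y show "ennreal (norm (f (x + r *\<^sub>R y)) powr p) * indicator (ball 0 1) y \<le> F (x + r *\<^sub>R y) * indicator (ball 0 1) y"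
      using le[of y] by (cases "y \<in> ball 0 1") (simp_all del: mem_ball)
  qed
  also have "\<dots> \<le> ennreal (enn2real K)" using K by simp
  finally show ?thesis by (simp add: ennreal_le_iff)
qed

lemma locally_imp_div_curl_closed:
  fixes \<Omega> :: "(real ^ 'n) set"
  assumes \<Omega>: "bounded \<Omega>" "open \<Omega>" and pq: "1 < p" "1 < q" "1 / p + 1 / q = 1"
    and loc: "locally_div_curl_closed p q Dloc"
  shows "div_curl_closed p q \<Omega> {u \<in> X_space p q \<Omega>. AE x in lebesgue_on \<Omega>. u x \<in> Dloc}"
  unfolding div_curl_closed_def
proof (intro allI impI, elim conjE)
  fix u u0
  assume uD: "\<forall>m. u m \<in> {u \<in> X_space p q \<Omega>. AE x in lebesgue_on \<Omega>. u x \<in> Dloc}"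
    and conv: "div_curl_convergent_to p q \<Omega> u u0"
  let ?B = "ball (0 :: real ^ 'n) 1"
  have lm: "\<Omega> \<in> lmeasurable" "?B \<in> lmeasurable" using \<Omega> by (auto intro: lmeasurable_open)
  have s: "\<Omega> \<in> sets lebesgue" "?B \<in> sets lebesgue" using lm by (auto simp: fmeasurable_def)
  have p0: "p > 0" "q > 0" "p \<ge> 0" "q \<ge> 0" using pq by auto
  have wk: "weakly_convergent_to (X_space p q \<Omega>) (X_norm p q \<Omega>) u u0"
    using conv by (simp add: div_curl_convergent_to_def)
  note X = X_spaceD[OF weakly_convergent_X_spaceD(1)[OF wk]]
  note X0 = weakly_convergent_X_spaceD(2)[OF wk]
  have qp: "1 / q + 1 / p = 1" using pq by simp
  obtain C where C: "\<And>k. Lp_int (lebesgue_on \<Omega>) p (\<lambda>x. fst (u k x)) \<le> C"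
    using weakly_convergent_fst_bounded[OF pq wk] by blast
  obtain C' where C': "\<And>k. Lp_int (lebesgue_on \<Omega>) q (\<lambda>x. snd (u k x)) \<le> C'"
    using weakly_convergent_fst_bounded[OF pq(2,1) qp weakly_convergent_swap[OF wk]] by auto
  \<comment> \<open>Both components enter one density, so that the same radius and the same
    \<open>k\<close> bound them simultaneously; separate selections could be disjoint.\<close>
  define E where "E k x = (ennreal (norm (fst (u k x)) powr p) + ennreal (norm (snd (u k x)) powr q)) * indicator \<Omega> x" for k x
  have Em: "E k \<in> borel_measurable lebesgue" for k
  proof -
    have "(\<lambda>x. ennreal (norm (fst (u k x)) powr p) + ennreal (norm (snd (u k x)) powr q)) \<in> borel_measurable (lebesgue_on \<Omega>)"
      using Lp_funD(1)[OF X(1)[of k]] Lp_funD(1)[OF X(2)[of k]] by measurable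
    then show ?thesis unfolding E_def using s by (subst (asm) borel_measurable_restrict_space_iff_ennreal) auto
  qed
  have Ei: "(\<integral>\<^sup>+x. E k x \<partial>lebesgue) \<le> ennreal C + ennreal C'" for k
  proof -
    have "(\<integral>\<^sup>+x. E k x \<partial>lebesgue) = (\<integral>\<^sup>+x. ennreal (norm (fst (u k x)) powr p) + ennreal (norm (snd (u k x)) powr q) \<partial>lebesgue_on \<Omega>)"
      unfolding E_def using s by (subst nn_integral_restrict_space) auto
    also have "\<dots> = ennreal (Lp_int (lebesgue_on \<Omega>) p (\<lambda>x. fst (u k x))) + ennreal (Lp_int (lebesgue_on \<Omega>) q (\<lambda>x. snd (u k x)))"
      unfolding ennreal_Lp_int[OF X(1)] ennreal_Lp_int[OF X(2)]
    proof (rule nn_integral_add)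
      show "(\<lambda>x. ennreal (norm (fst (u k x)) powr p)) \<in> borel_measurable (lebesgue_on \<Omega>)"
        using Lp_funD(1)[OF X(1)[of k]] by measurable
      show "(\<lambda>x. ennreal (norm (snd (u k x)) powr q)) \<in> borel_measurable (lebesgue_on \<Omega>)"
        using Lp_funD(1)[OF X(2)[of k]] by measurable
    qed
    also have "\<dots> \<le> ennreal C + ennreal C'" by (intro add_mono ennreal_leI C C')
    finally show ?thesis .
  qed
  obtain \<rho>1 :: "nat \<Rightarrow> real" where \<rho>1: "\<And>i. \<rho>1 i > 0" "\<And>r. (\<And>i. 0 < r i \<and> r i \<le> \<rho>1 i) \<Longrightarrow> r \<longlonglongrightarrow> 0 \<Longrightarrow>
      AE x in lebesgue. x \<in> \<Omega> \<longrightarrow> (\<lambda>i. Lp_int (lebesgue_on ?B) p (\<lambda>y. fst (u0 (x + r i *\<^sub>R y)) - fst (u0 x))) \<longlonglongrightarrow> 0"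
    using Lp_Lebesgue_points[OF \<Omega> X_spaceD(1)[OF X0] p0(1)] by blast
  obtain \<rho>2 :: "nat \<Rightarrow> real" where \<rho>2: "\<And>i. \<rho>2 i > 0" "\<And>r. (\<And>i. 0 < r i \<and> r i \<le> \<rho>2 i) \<Longrightarrow> r \<longlonglongrightarrow> 0 \<Longrightarrow>
      AE x in lebesgue. x \<in> \<Omega> \<longrightarrow> (\<lambda>i. Lp_int (lebesgue_on ?B) q (\<lambda>y. snd (u0 (x + r i *\<^sub>R y)) - snd (u0 x))) \<longlonglongrightarrow> 0"
    using Lp_Lebesgue_points[OF \<Omega> X_spaceD(2)[OF X0] p0(2)] by blast
  \<comment> \<open>One sequence of radii below both thresholds serves both components and is fixed
    before any point is chosen.\<close>
  define r where "r i = min (1 / real (Suc i)) (min (\<rho>1 i) (\<rho>2 i))" for i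
  have r: "0 < r i" "r i \<le> \<rho>1 i" "r i \<le> \<rho>2 i" "r i \<noteq> 0" for i
    using \<rho>1(1)[of i] \<rho>2(1)[of i] by (auto simp: r_def min_def)
  have r0: "r \<longlonglongrightarrow> 0"
  proof -
    have "\<forall>\<^sub>F i in sequentially. 0 \<le> r i" using r(1) by (simp add: less_imp_le)
    moreover have "\<forall>\<^sub>F i in sequentially. r i \<le> 1 / real (Suc i)" by (simp add: r_def)
    moreover have "(\<lambda>i. 1 / real (Suc i)) \<longlonglongrightarrow> 0" using LIMSEQ_inverse_real_of_nat by (simp add: inverse_eq_divide)
    ultimately show ?thesis by (rule tendsto_sandwich[OF _ _ tendsto_const])
  qed
  have "AE x in lebesgue. x \<in> \<Omega> \<longrightarrow> (\<lambda>i. Lp_int (lebesgue_on ?B) p (\<lambda>y. fst (u0 (x + r i *\<^sub>R y)) - fst (u0 x))) \<longlonglongrightarrow> 0"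
    by (rule \<rho>1(2)[OF _ r0]) (simp add: r)
  moreover have "AE x in lebesgue. x \<in> \<Omega> \<longrightarrow> (\<lambda>i. Lp_int (lebesgue_on ?B) q (\<lambda>y. snd (u0 (x + r i *\<^sub>R y)) - snd (u0 x))) \<longlonglongrightarrow> 0"
    by (rule \<rho>2(2)[OF _ r0]) (simp add: r)
  moreover have "AE x in lebesgue. \<exists>K<top. \<forall>N. \<exists>i\<ge>N. \<forall>N'. \<exists>k\<ge>N'. ball_average (r i) (E k) x < K"
    by (rule AE_frequently_bounded_ball_average[OF Em Ei _ r(4)]) simp
  ultimately have "AE x in lebesgue. x \<in> \<Omega> \<longrightarrow> u0 x \<in> Dloc"
  proof (eventually_elim, intro impI)
    fix x
    assume x: "x \<in> \<Omega>" and "x \<in> \<Omega> \<longrightarrow> (\<lambda>i. Lp_int (lebesgue_on ?B) p (\<lambda>y. fst (u0 (x + r i *\<^sub>R y)) - fst (u0 x))) \<longlonglongrightarrow> 0"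
      and "x \<in> \<Omega> \<longrightarrow> (\<lambda>i. Lp_int (lebesgue_on ?B) q (\<lambda>y. snd (u0 (x + r i *\<^sub>R y)) - snd (u0 x))) \<longlonglongrightarrow> 0"
      and "\<exists>K<top. \<forall>N. \<exists>i\<ge>N. \<forall>N'. \<exists>k\<ge>N'. ball_average (r i) (E k) x < K"
    then have l: "(\<lambda>i. Lp_int (lebesgue_on ?B) p (\<lambda>y. fst (u0 (x + r i *\<^sub>R y)) - fst (u0 x))) \<longlonglongrightarrow> 0"
      "(\<lambda>i. Lp_int (lebesgue_on ?B) q (\<lambda>y. snd (u0 (x + r i *\<^sub>R y)) - snd (u0 x))) \<longlonglongrightarrow> 0" by auto
    obtain K where K: "K < top" "\<And>N. \<exists>i\<ge>N. \<forall>N'. \<exists>k\<ge>N'. ball_average (r i) (E k) x < K"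
      using \<open>\<exists>K<top. \<forall>N. \<exists>i\<ge>N. \<forall>N'. \<exists>k\<ge>N'. ball_average (r i) (E k) x < K\<close> by blast
    obtain \<delta> where \<delta>: "\<delta> > 0" "ball x \<delta> \<subseteq> \<Omega>" using \<Omega>(2) x open_contains_ball by blast
    obtain I where I: "\<And>i. i \<ge> I \<Longrightarrow> r i < \<delta>"
      using order_tendstoD(2)[OF r0 \<delta>(1)] by (auto simp: eventually_sequentially)
    \<comment> \<open>The subsequence of radii may depend on \<open>x\<close>. It retains radii for
      which the bound recurs in \<open>k\<close> and the ball lies in \<Omega>, as
      \<open>div_curl_diagonal\<close> asks for its bound at every index.\<close>
    have "\<exists>i. i \<ge> m \<and> r i < \<delta> \<and> (\<forall>N'. \<exists>k\<ge>N'. ball_average (r i) (E k) x < K)" for m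
    proof -
      obtain i where "i \<ge> max m I" "\<forall>N'. \<exists>k\<ge>N'. ball_average (r i) (E k) x < K" using K(2) by blast
      then show ?thesis using I[of i] by (intro exI[of _ i]) auto
    qed
    then obtain \<sigma> where \<sigma>: "\<And>m. \<sigma> m \<ge> m" "\<And>m. r (\<sigma> m) < \<delta>"
      "\<And>m N'. \<exists>k\<ge>N'. ball_average (r (\<sigma> m)) (E k) x < K" by metis
    have \<sigma>_lim: "filterlim \<sigma> sequentially sequentially"
      by (rule filterlim_at_top_mono[OF filterlim_ident]) (simp add: \<sigma>(1))
    have sub: "x + r (\<sigma> m) *\<^sub>R y \<in> \<Omega>" if "y \<in> ?B" for m y
    proof -
      have "norm (r (\<sigma> m) *\<^sub>R y) \<le> r (\<sigma> m)" using that r(1)[of "\<sigma> m"] by (simp add: mult_left_le)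
      then have "norm (r (\<sigma> m) *\<^sub>R y) < \<delta>" using \<sigma>(2)[of m] by linarith
      then show ?thesis using \<delta>(2) by (auto simp: dist_norm)
    qed
    define v where "v m k y = u k (x + r (\<sigma> m) *\<^sub>R y)" for m k y
    have vL: "(\<lambda>y. fst (v m k y)) \<in> Lp_fun (lebesgue_on ?B) p" "(\<lambda>y. snd (v m k y)) \<in> Lp_fun (lebesgue_on ?B) q" for m k
      unfolding v_def using Lp_fun_affine(1)[OF X(1) r(1) p0(3) s sub] Lp_fun_affine(1)[OF X(2) r(1) p0(4) s sub] by auto
    have cv: "div_curl_convergent_to p q ?B (v m) (\<lambda>y. u0 (x + r (\<sigma> m) *\<^sub>R y))" for m
      unfolding v_def by (rule div_curl_convergent_affine[OF conv pq r(1) lm sub])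
    have bd: "\<exists>k\<ge>N. Lp_int (lebesgue_on ?B) p (\<lambda>y. fst (v m k y)) \<le> enn2real K \<and>
        Lp_int (lebesgue_on ?B) q (\<lambda>y. snd (v m k y)) \<le> enn2real K" for m N
    proof -
      obtain k where k: "k \<ge> N" "ball_average (r (\<sigma> m)) (E k) x < K" using \<sigma>(3) by blast
      have "Lp_int (lebesgue_on ?B) p (\<lambda>y. fst (v m k y)) \<le> enn2real K"
        unfolding v_def
        by (rule Lp_int_le_ball_average[where F = "E k", OF vL(1)[unfolded v_def] _ k(2) K(1)])
          (simp add: E_def sub del: mem_ball)
      moreover have "Lp_int (lebesgue_on ?B) q (\<lambda>y. snd (v m k y)) \<le> enn2real K"
        unfolding v_def
        by (rule Lp_int_le_ball_average[where F = "E k", OF vL(2)[unfolded v_def] _ k(2) K(1)])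
          (simp add: E_def sub del: mem_ball)
      ultimately show ?thesis using k(1) by blast
    qed
    \<comment> \<open>The strong limits along all radii pass to the subsequence, and the diagonal
      sequence on the unit ball has the constant limit required by local closedness.\<close>
    obtain \<kappa> where \<kappa>: "div_curl_convergent_to p q ?B (\<lambda>m. v m (\<kappa> m)) (\<lambda>_. u0 x)"
      by (rule div_curl_diagonal[OF pq lm(2) cv filterlim_compose[OF l(1) \<sigma>_lim] filterlim_compose[OF l(2) \<sigma>_lim] bd])
    have "AE y in lebesgue_on ?B. v m (\<kappa> m) y \<in> Dloc" for m
      unfolding v_def by (rule AE_lebesgue_on_affine[OF _ r(4) s sub]) (use uD in auto)
    then have "(fst (u0 x), snd (u0 x)) \<in> Dloc"
      using loc \<kappa> unfolding locally_div_curl_closed_def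
      by (intro loc[unfolded locally_div_curl_closed_def, rule_format, of ?B]) (auto intro!: exI[of _ "\<lambda>m. v m (\<kappa> m)"])
    then show "u0 x \<in> Dloc" by simp
  qed
  then have "AE x in lebesgue_on \<Omega>. u0 x \<in> Dloc" using s by (simp add: AE_restrict_space_iff)
  then show "u0 \<in> {u \<in> X_space p q \<Omega>. AE x in lebesgue_on \<Omega>. u x \<in> Dloc}" using X0 by simp
qed

theorem proposition4p4:
  fixes \<Omega> :: "(real ^ 'n) set"
    and p q :: real
    and Dloc :: "((real ^ 'n ^ 'n) \<times> (real ^ 'n ^ 'n)) set"
  assumes "bounded \<Omega>" and "connected \<Omega>" and "open \<Omega>" and "\<Omega> \<noteq> {}" and "lipschitz_set \<Omega>"
    and "1 < p" and "1 < q" and "1 / p + 1 / q = 1"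
  shows "div_curl_closed p q \<Omega> {u \<in> X_space p q \<Omega>. AE x in lebesgue_on \<Omega>. u x \<in> Dloc}
         \<longleftrightarrow> locally_div_curl_closed p q Dloc"
  using div_curl_closed_imp_locally[OF assms(1,3,4,6-8)] locally_imp_div_curl_closed[OF assms(1,3,6-8)]
  by blast

end
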